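(* Let $Q(w,\ell)=a_0+\sum_{i=1}^m a_ie^{\ell_i w}$ with $a_i\in\mathbb{R}$, $a_0\ne0$. Let $\{\psi_i\}_i$ be a countable collection of continuous roots $\psi_i:\mathcal{S}\to\mathbb{C}$ of $Q$ such that $\mathcal{Z}(\ell)=\{\psi_i(\ell)\}_i$ for every $\ell\in\mathcal{S}$. For each $i$ define $\psi_i':\mathcal{S}\to\mathbb{C}'$ by $$\psi_i'(\ell)=\begin{cases}[\psi_i(\ell)] & \psi_i(\ell)\in\mathcal{H}_0,\\ [\min(\ell)\,\psi_i(\ell)] & \psi_i(\ell)\in\mathcal{H}_-,\\ [\min(\overline{\ell})\,\psi_i(\ell)] & \psi_i(\ell)\in\mathcal{H}_+.\end{cases}$$ Let $(p,q)\in[0,\infty]^m\times[0,\infty]^m$ lie in the closure of $\iota(\mathcal{S})$. Then for every $i$ the limit $\lim_{\iota(\ell)\to(p,q)}\psi_i'(\ell)$ (over $\ell\in\mathcal{S}$) exists in $\mathbb{C}'$, and $$\Big\{\lim_{\iota(\ell)\to(p,q)}\psi_i'(\ell)\Big\}_i-\{[0]\}=\mathcal{Z}(p,q),$$ where $\mathcal{Z}(p,q)\subset\mathcal{H}_-\cup\mathcal{H}_+$ is identified with its image in $\mathbb{C}'$.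
   Context: $\mathcal{S}=\{\ell\in\mathbb{R}_{>0}^m:\ell_1,\ldots,\ell_{m-1}<\ell_m\}$; $\mathcal{Z}(\ell)=\{w\in\mathbb{C}:Q(w,\ell)=0\}$; a root of $Q$ is a function $\psi:\mathcal{S}\to\mathbb{C}$ with $\psi(\ell)\in\mathcal{Z}(\ell)$ for all $\ell$. For $\ell\in\mathbb{R}_{>0}^m$, $\min(\ell)=\min(\ell_1,\ldots,\ell_m)$. For $\ell\in\mathcal{S}$, $\overline{\ell}=(\ell_m,\ell_m-\ell_1,\ldots,\ell_m-\ell_{m-1})$, and $\iota(\ell)=\left(\frac{1}{\min(\ell)}\ell,\ \frac{1}{\min(\overline{\ell})}\overline{\ell}\right)\in[0,\infty]^m\times[0,\infty]^m$. $\mathcal{H}_-,\mathcal{H}_+,\mathcal{H}_0$ are the sets of complex numbers with negative, positive and zero real part, respectively. $\mathbb{C}'=\mathbb{C}/\mathcal{H}_0$ is the quotient space of $\mathbb{C}$ obtained by collapsing $\mathcal{H}_0$ to a point, with quotient map $z\mapsto[z]$. The reversed poly-exponential is $\overline{Q}(w,\ell)=a_0e^{\ell_mw}+\sum_{i=1}^{m-1}a_ie^{(\ell_m-\ell_i)w}+a_m=e^{\ell_mw}Q(-w,\ell)$; viewed as a function of the exponent vector $q=(q_1,\ldots,q_m)$ (playing the role of $\overline{\ell}$) it is $a_m+a_0e^{q_1w}+\sum_{i=1}^{m-1}a_ie^{q_{i+1}w}$. With the convention $e^{\infty w}=0$ for $w\in\mathcal{H}_-$, for $p,q\in[0,\infty]^m$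 set $\mathcal{Z}_-(Q,p)=\{w\in\mathcal{H}_-: a_0+\sum_{i=1}^m a_ie^{p_iw}=0\}$ and $\mathcal{Z}_-(\overline{Q},q)=\{w\in\mathcal{H}_-: a_m+a_0e^{q_1w}+\sum_{i=1}^{m-1}a_ie^{q_{i+1}w}=0\}$. Finally $\mathcal{Z}(p,q)=\mathcal{Z}_-(Q,p)\cup\big(-\mathcal{Z}_-(\overline{Q},q)\big)$.
   Formalization: The formal statement also assumes a_m ≠ 0; without it the claim fails, e.g. m = 2, Q = -2 + e^{ℓ_1 w}: along ℓ = (ε,1), ε→0, the rescaled roots have real part tending to infinity, so the limit does not exist in C'. *)

theory Defs
  imports "HOL-Analysis.Analysis"
begin

(* A vector of length m is a function on nat that is extensional on {1..m}
   (value undefined elsewhere).  On such functions the product topology of the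
   full function space restricts to the usual topology of the m-fold product,
   so continuous_on, nhds and closure below have their usual meaning.
   [0,\<infinity>] is the type ennreal. *)

definition param_space :: "nat \<Rightarrow> (nat \<Rightarrow> real) set" where
  "param_space m = {l \<in> {1..m} \<rightarrow>\<^sub>E {0<..}. \<forall>i\<in>{1..<m}. l i < l m}"

definition polyexp :: "(nat \<Rightarrow> real) \<Rightarrow> nat \<Rightarrow> complex \<Rightarrow> (nat \<Rightarrow> real) \<Rightarrow> complex" where
  "polyexp a m w l = of_real (a 0) + (\<Sum>i=1..m. of_real (a i) * exp (of_real (l i) * w))"

definition zero_set :: "(nat \<Rightarrow> real) \<Rightarrow> nat \<Rightarrow> (nat \<Rightarrow> real) \<Rightarrow> complex set" where
  "zero_set a m l = {w. polyexp a m w l = 0}"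

definition is_root :: "(nat \<Rightarrow> real) \<Rightarrow> nat \<Rightarrow> ((nat \<Rightarrow> real) \<Rightarrow> complex) \<Rightarrow> bool" where
  "is_root a m \<psi> \<longleftrightarrow> (\<forall>l\<in>param_space m. \<psi> l \<in> zero_set a m l)"

definition min_entry :: "nat \<Rightarrow> (nat \<Rightarrow> real) \<Rightarrow> real" where
  "min_entry m l = Min (l ` {1..m})"

definition reversed :: "nat \<Rightarrow> (nat \<Rightarrow> real) \<Rightarrow> (nat \<Rightarrow> real)" where
  "reversed m l = (\<lambda>i\<in>{1..m}. if i = 1 then l m else l m - l (i - 1))"

definition normalized :: "nat \<Rightarrow> (nat \<Rightarrow> real) \<Rightarrow> (nat \<Rightarrow> ennreal)" where
  "normalized m l = (\<lambda>i\<in>{1..m}. ennreal (l i / min_entry m l))"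

definition iota :: "nat \<Rightarrow> (nat \<Rightarrow> real) \<Rightarrow> (nat \<Rightarrow> ennreal) \<times> (nat \<Rightarrow> ennreal)" where
  "iota m l = (normalized m l, normalized m (reversed m l))"

definition Hneg :: "complex set" where "Hneg = {z. Re z < 0}"
definition Hpos :: "complex set" where "Hpos = {z. Re z > 0}"
definition Hzero :: "complex set" where "Hzero = {z. Re z = 0}"

definition collapse_rel :: "complex \<Rightarrow> complex \<Rightarrow> bool" where
  "collapse_rel z w \<longleftrightarrow> z = w \<or> z \<in> Hzero \<and> w \<in> Hzero"

lemma equivp_collapse_rel: "equivp collapse_rel"
  by (rule equivpI) (auto simp: reflp_def symp_def transp_def collapse_rel_def)

(* The quotient space C' of the complex plane, with quotient map proj and the
   quotient topology; it is Hausdorff, so limits are unique and Lim applies. *)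

quotient_type collapsed = complex / collapse_rel
  morphisms repr proj
  by (rule equivp_collapse_rel)

lemma proj_eq_iff: "proj z = proj w \<longleftrightarrow> z = w \<or> z \<in> Hzero \<and> w \<in> Hzero"
  by (simp add: collapsed.abs_eq_iff collapse_rel_def)

lemma proj_cases: obtains z where "c = proj z"
  by (metis Quotient3_abs_rep Quotient3_collapsed)

instantiation collapsed :: topological_space
begin

definition open_collapsed :: "collapsed set \<Rightarrow> bool" where
  "open_collapsed U \<longleftrightarrow> open (proj -` U)"

instance
proof
  show "open (UNIV :: collapsed set)" by (simp add: open_collapsed_def)
next
  fix S T :: "collapsed set" assume "open S" "open T"
  then show "open (S \<inter> T)" by (simp add: open_collapsed_def open_Int)
next
  fix K :: "collapsed set set" assume "\<forall>S\<in>K. open S"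
  then show "open (\<Union>K)" by (auto simp: open_collapsed_def vimage_Union)
qed

end

lemma open_proj_image:
  assumes "open V" "V \<inter> Hzero = {} \<or> Hzero \<subseteq> V"
  shows "open (proj ` V)"
proof -
  have "proj -` (proj ` V) = V" using assms(2) by (auto simp: proj_eq_iff)
  then show ?thesis using assms(1) by (simp add: open_collapsed_def)
qed

instance collapsed :: t2_space
proof
  fix c d :: collapsed assume "c \<noteq> d"
  obtain z w where zw: "c = proj z" "d = proj w" by (metis proj_cases)
  have sep: "\<exists>U V. open U \<and> open V \<and> proj u \<in> U \<and> proj v \<in> V \<and> U \<inter> V = {}"
    if v: "v \<notin> Hzero" and ne: "u \<noteq> v" for u v
  proof (cases "u \<in> Hzero")
    case True
    let ?r = "\<bar>Re v\<bar> / 2"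
    let ?U = "{x. \<bar>Re x\<bar> < ?r}" and ?V = "{x. \<bar>Re x\<bar> > ?r}"
    have "open ?U" "open ?V" by (intro open_Collect_less continuous_intros)+
    moreover have "?V \<inter> Hzero = {}" "Hzero \<subseteq> ?U" using v by (auto simp: Hzero_def)
    ultimately have "open (proj ` ?U)" "open (proj ` ?V)" by (auto intro!: open_proj_image)
    moreover have "u \<in> ?U" "v \<in> ?V" using v True by (auto simp: Hzero_def)
    moreover have "proj ` ?U \<inter> proj ` ?V = {}" using v by (auto simp: proj_eq_iff Hzero_def)
    ultimately show ?thesis by (metis imageI)
  next
    case False
    obtain U V where UV: "open U" "open V" "u \<in> U" "v \<in> V" "U \<inter> V = {}"
      using hausdorff[OF ne] by blast
    have "open (- Hzero)"
      unfolding Hzero_def by (intro open_Compl closed_Collect_eq continuous_intros)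
    then have "open (proj ` (U - Hzero))" "open (proj ` (V - Hzero))"
      using UV by (auto intro!: open_proj_image simp: Diff_eq open_Int)
    moreover have "proj ` (U - Hzero) \<inter> proj ` (V - Hzero) = {}"
      using UV(5) by (auto simp: proj_eq_iff)
    ultimately show ?thesis using UV(3,4) False v by (metis DiffI imageI)
  qed
  have "z \<noteq> w" "z \<notin> Hzero \<or> w \<notin> Hzero" using \<open>c \<noteq> d\<close> zw by (auto simp: proj_eq_iff)
  then show "\<exists>U V. open U \<and> open V \<and> c \<in> U \<and> d \<in> V \<and> U \<inter> V = {}"
    using sep[of w z] sep[of z w] zw by (metis inf_commute)
qed

definition rescaled :: "nat \<Rightarrow> ((nat \<Rightarrow> real) \<Rightarrow> complex) \<Rightarrow> (nat \<Rightarrow> real) \<Rightarrow> collapsed" where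
  "rescaled m \<psi> l =
    (if \<psi> l \<in> Hzero then proj (\<psi> l)
     else if \<psi> l \<in> Hneg then proj (of_real (min_entry m l) * \<psi> l)
     else proj (of_real (min_entry m (reversed m l)) * \<psi> l))"

(* exp (x w) for x in [0,\<infinity>], with the convention that it is 0 at x = \<infinity>;
   only used for w in Hneg. *)
definition ext_exp :: "ennreal \<Rightarrow> complex \<Rightarrow> complex" where
  "ext_exp x w = (if x = \<infinity> then 0 else exp (of_real (enn2real x) * w))"

definition Zneg :: "(nat \<Rightarrow> real) \<Rightarrow> nat \<Rightarrow> (nat \<Rightarrow> ennreal) \<Rightarrow> complex set" where
  "Zneg a m p =
    {w \<in> Hneg. of_real (a 0) + (\<Sum>i=1..m. of_real (a i) * ext_exp (p i) w) = 0}"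

definition Zneg_rev :: "(nat \<Rightarrow> real) \<Rightarrow> nat \<Rightarrow> (nat \<Rightarrow> ennreal) \<Rightarrow> complex set" where
  "Zneg_rev a m q =
    {w \<in> Hneg. of_real (a m) + of_real (a 0) * ext_exp (q 1) w
       + (\<Sum>i=1..<m. of_real (a i) * ext_exp (q (i + 1)) w) = 0}"

definition limit_zeros ::
  "(nat \<Rightarrow> real) \<Rightarrow> nat \<Rightarrow> (nat \<Rightarrow> ennreal) \<Rightarrow> (nat \<Rightarrow> ennreal) \<Rightarrow> complex set" where
  "limit_zeros a m p q = Zneg a m p \<union> uminus ` Zneg_rev a m q"

(* The filter "iota l tends to (p, q), l in the parameter space".  It is not
   punctured: points l with iota l = (p, q) count (for m = 1 there are no others). *)
definition approach ::
  "nat \<Rightarrow> (nat \<Rightarrow> ennreal) \<times> (nat \<Rightarrow> ennreal) \<Rightarrow> (nat \<Rightarrow> real) filter" where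
  "approach m pq = inf (filtercomap (iota m) (nhds pq)) (principal (param_space m))"

end

theory Submission
  imports Defs "HOL-Complex_Analysis.Complex_Analysis" "HOL-Real_Asymp.Real_Asymp"
begin

text \<open>
  In the half-plane of negative real part the rescaled polynomials converge locally uniformly, so
  by Hurwitz a rescaled root either converges to a zero of the limit or leaves every compact set.
  The point at issue is that it must not escape to infinity: the neighbourhoods of the collapsed
  axis become arbitrarily thin at infinity, so convergence to it needs a bound on the imaginary part.

  The bound comes from the existence of the continuous roots. Around a non-real double zero two
  zeros are interchanged, which excludes a complete system of continuous roots. Shifting
  by \<open>2 \<pi> \<i> n\<close> with exponents near \<open>k / n\<close> makes the phases of the terms free parameters, so
  such double zeros exist for every coefficient vector with at least two non-zero middle
  coefficients, unless the two outer coefficients or one middle coefficient dominate the rest.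
  Under these dominance conditions, and for three terms near the ends of the parameter
  interval, a suitable multiple of the imaginary part of a root avoids a translate
  of \<open>2 \<pi> \<int>\<close> and is therefore bounded on connected sets.
\<close>

section \<open>Parameter space and reversal\<close>

text \<open>Interchange of two zeros contradicts the continuity of a single root: the roots exhaust
  the zero set at every parameter, so a zero next to the double zero is a value of some
  \<open>\<psi> i\<close>, and following this root along a closed loop of parameters would give a
  continuous square root of a loop around 0. The loop is driven by the phases of two middle terms
  that are linearly independent over the reals; a single middle term offers no such pair and has to
  be bounded directly.

  The bounds are stated for the left half-plane only. The right half-plane is the left one of the
  reversed system, so the whole argument is run twice.

  Following one root, rather than the zero set, to its limit needs connected sets of parameters near
  the limit: on such a set a continuous root cannot pass from the inside of a disc to its outside
  when the boundary circle carries no zeros. Connectedness comes from convexity of suitable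
  neighbourhoods.\<close>

definition lerp :: "nat \<Rightarrow> (nat \<Rightarrow> real) \<Rightarrow> (nat \<Rightarrow> real) \<Rightarrow> real \<Rightarrow> nat \<Rightarrow> real" where
  "lerp m l l' t = (\<lambda>i\<in>{1..m}. (1 - t) * l i + t * l' i)"

text \<open>
  Unlike \<^const>\<open>reversed\<close>, which puts the largest exponent first, this version of the reversal is
  an involution of the parameter space.
\<close>
definition flip :: "nat \<Rightarrow> (nat \<Rightarrow> real) \<Rightarrow> nat \<Rightarrow> real" where
  "flip m l = (\<lambda>i\<in>{1..m}. if i = m then l m else l m - l i)"

text \<open>The coefficients that belong to \<open>flip\<close>: the middle indices stay in place,
  and only the two outer coefficients change roles.\<close>

definition rev_coeff :: "(nat \<Rightarrow> real) \<Rightarrow> nat \<Rightarrow> nat \<Rightarrow> real" where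
  "rev_coeff a m i = (if i = 0 then a m else if i = m then a 0 else a i)"

lemma continuous_on_param:
  assumes "\<And>i. i \<in> {1..m} \<Longrightarrow> continuous_on X (\<lambda>x. f x i)"
    "\<And>x i. x \<in> X \<Longrightarrow> i \<notin> {1..m} \<Longrightarrow> f x i = undefined"
  shows "continuous_on X f"
proof (rule continuous_on_coordinatewise_then_product)
  fix i
  show "continuous_on X (\<lambda>x. f x i)"
  proof (cases "i \<in> {1..m}")
    case False
    show ?thesis
      by (rule continuous_on_eq[OF continuous_on_const[of X undefined]]) (simp add: assms(2)[OF _ False])
  qed (rule assms(1))
qed

lemma continuous_on_component [continuous_intros]:
  "continuous_on X (\<lambda>l :: nat \<Rightarrow> real. l i)"
  by (rule continuous_on_product_then_coordinatewise) (rule continuous_on_id)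

lemma param_spaceD:
  assumes "l \<in> param_space m"
  shows "i \<in> {1..m} \<Longrightarrow> 0 < l i" "i \<in> {1..<m} \<Longrightarrow> l i < l m"
    "i \<notin> {1..m} \<Longrightarrow> l i = undefined"
  using assms by (auto simp: param_space_def PiE_def extensional_def Pi_def)

lemma param_spaceI:
  assumes "\<And>i. i \<in> {1..m} \<Longrightarrow> 0 < l i" "\<And>i. i \<in> {1..<m} \<Longrightarrow> l i < l m"
    "\<And>i. i \<notin> {1..m} \<Longrightarrow> l i = undefined"
  shows "l \<in> param_space m"
  unfolding param_space_def PiE_def extensional_def Pi_def using assms by blast

lemma convex_comb_less:
  fixes a b c d t :: real
  assumes "a < b" "c < d" "0 \<le> t" "t \<le> 1"
  shows "(1 - t) * a + t * c < (1 - t) * b + t * d"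
proof (cases "t = 1")
  case False
  then have "(1 - t) * a < (1 - t) * b" using assms by simp
  moreover have "t * c \<le> t * d" using assms by (simp add: mult_left_mono)
  ultimately show ?thesis by linarith
qed (use assms in auto)

lemma lerp_param_space:
  assumes "l \<in> param_space m" "l' \<in> param_space m" "0 \<le> t" "t \<le> 1"
  shows "lerp m l l' t \<in> param_space m"
proof (rule param_spaceI)
  fix i assume i: "i \<in> {1..m}"
  have "(1 - t) * 0 + t * 0 < (1 - t) * l i + t * l' i"
    using assms i by (intro convex_comb_less param_spaceD(1)[of _ m])
  then show "0 < lerp m l l' t i" using i by (simp add: lerp_def)
next
  fix i assume i: "i \<in> {1..<m}"
  then show "lerp m l l' t i < lerp m l l' t m"
    using assms convex_comb_less[OF param_spaceD(2)[OF assms(1) i] param_spaceD(2)[OF assms(2) i]]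
    by (simp add: lerp_def)
qed (simp add: lerp_def del: atLeastAtMost_iff)

text \<open>Convexity for extensional vectors: two points of X are joined by the continuous image of
  the unit interval under \<open>lerp\<close>.\<close>

lemma connected_lerp_closed:
  assumes "\<And>l. l \<in> X \<Longrightarrow> l \<in> extensional {1..m}"
    "\<And>l l' t. l \<in> X \<Longrightarrow> l' \<in> X \<Longrightarrow> 0 \<le> t \<Longrightarrow> t \<le> 1 \<Longrightarrow> lerp m l l' t \<in> X"
  shows "connected X"
proof -
  have *: "\<exists>T. connected T \<and> T \<subseteq> X \<and> l \<in> T \<and> l' \<in> T" if l: "l \<in> X" "l' \<in> X" for l l'
  proof (intro exI conjI)
    show "connected (lerp m l l' ` {0..1})"
    proof (rule connected_continuous_image)
      show "continuous_on {0..1} (lerp m l l')"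
        by (rule continuous_on_param[of m]) (auto simp: lerp_def intro!: continuous_intros)
    qed simp
    show "lerp m l l' ` {0..1} \<subseteq> X" using assms(2)[OF l] by auto
    have "lerp m l l' 0 = l" "lerp m l l' 1 = l'"
      using assms(1)[OF l(1)] assms(1)[OF l(2)] by (auto simp: lerp_def extensional_def)
    then show "l \<in> lerp m l l' ` {0..1}" "l' \<in> lerp m l l' ` {0..1}"
      by (metis atLeastAtMost_iff image_eqI le_numeral_extra(3) zero_le_one order_refl)+
  qed
  show ?thesis
    by (rule iffD2[OF connected_iff_connected_component])
      (auto simp only: connected_component_def intro!: *)
qed

lemma param_space_extensional: "l \<in> param_space m \<Longrightarrow> l \<in> extensional {1..m}"
  by (simp add: param_space_def PiE_def)

lemma connected_param_space: "connected (param_space m)"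
  by (rule connected_lerp_closed[OF param_space_extensional lerp_param_space])

lemma flip_param_space:
  assumes "1 \<le> m" "l \<in> param_space m"
  shows "flip m l \<in> param_space m"
proof (rule param_spaceI)
  fix i assume "i \<in> {1..m}"
  then show "0 < flip m l i"
    using param_spaceD(1)[OF assms(2), of i] param_spaceD(2)[OF assms(2), of i]
    by (cases "i = m") (auto simp: flip_def)
next
  fix i assume "i \<in> {1..<m}"
  then show "flip m l i < flip m l m"
    using param_spaceD(1)[OF assms(2), of i] by (auto simp: flip_def)
qed (simp add: flip_def del: atLeastAtMost_iff)

lemma flip_flip: "l \<in> param_space m \<Longrightarrow> flip m (flip m l) = l"
proof
  fix i assume "l \<in> param_space m"
  then show "flip m (flip m l) i = l i"
    using param_spaceD(3)[of l m i] by (cases "i \<in> {1..m}") (auto simp: flip_def)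
qed

lemma continuous_on_flip: "continuous_on X (flip m)"
proof (rule continuous_on_param[of m])
  fix i assume "i \<in> {1..m}"
  then show "continuous_on X (\<lambda>l. flip m l i)"
    by (cases "i = m") (auto simp: flip_def intro!: continuous_intros)
qed (simp add: flip_def del: atLeastAtMost_iff)

text \<open>The two reversals list the same values, only shifted cyclically.\<close>

lemma min_entry_reversed:
  assumes "1 \<le> m"
  shows "min_entry m (reversed m l) = min_entry m (flip m l)"
proof -
  have A: "{1..m} = insert 1 (Suc ` {1..<m})"
  proof (intro equalityI subsetI)
    fix i assume "i \<in> {1..m}"
    then show "i \<in> insert 1 (Suc ` {1..<m})"
      by (cases i) (auto simp: image_iff)
  qed (use assms in auto)
  have B: "{1..m} = insert m {1..<m}" using assms by auto
  have "(\<lambda>i. reversed m l (Suc i)) ` {1..<m} = (\<lambda>i. l m - l i) ` {1..<m}"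
    by (rule image_cong) (auto simp: reversed_def)
  then have "reversed m l ` insert 1 (Suc ` {1..<m}) = insert (l m) ((\<lambda>i. l m - l i) ` {1..<m})"
    using assms by (simp only: image_insert image_image) (simp add: reversed_def)
  moreover have "flip m l ` insert m {1..<m} = insert (l m) ((\<lambda>i. l m - l i) ` {1..<m})"
    using assms by (auto simp: flip_def image_iff)
  ultimately show ?thesis unfolding min_entry_def using A B by metis
qed

lemma min_entry_le: "i \<in> {1..m} \<Longrightarrow> min_entry m l \<le> l i"
  unfolding min_entry_def by (intro Min_le) auto

lemma min_entry_in: "1 \<le> m \<Longrightarrow> \<exists>i\<in>{1..m}. min_entry m l = l i"
  unfolding min_entry_def using Min_in[of "l ` {1..m}"] by (auto simp: image_iff)

lemma min_entry_pos: "1 \<le> m \<Longrightarrow> l \<in> param_space m \<Longrightarrow> 0 < min_entry m l"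
  using min_entry_in[of m l] param_spaceD(1)[of l m] by auto

lemma continuous_on_min_entry:
  assumes "1 \<le> m" shows "continuous_on X (min_entry m)"
proof -
  have "continuous_on X (\<lambda>l :: nat \<Rightarrow> real. Min ((\<lambda>i. l i) ` {1..n}))" if "1 \<le> n" for n
    using that
  proof (induction n rule: nat_induct_at_least)
    case base
    then show ?case by (auto intro!: continuous_intros)
  next
    case (Suc n)
    have "(\<lambda>l :: nat \<Rightarrow> real. Min ((\<lambda>i. l i) ` {1..Suc n})) =
        (\<lambda>l. min (l (Suc n)) (Min ((\<lambda>i. l i) ` {1..n})))"
      using Suc.hyps by (auto simp: atLeastAtMostSuc_conv fun_eq_iff intro!: Min_insert)
    moreover have "continuous_on X (\<lambda>l :: nat \<Rightarrow> real. min (l (Suc n)) (Min ((\<lambda>i. l i) ` {1..n})))"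
      using Suc.IH by (intro continuous_intros)
    ultimately show ?case by (simp only: image_ident)
  qed
  then show ?thesis using assms by (simp add: min_entry_def)
qed

section \<open>Reversal of poly-exponentials\<close>

lemma sum_to_last:
  fixes f :: "nat \<Rightarrow> 'a::comm_monoid_add"
  assumes "1 \<le> m" shows "(\<Sum>i=1..m. f i) = (\<Sum>i=1..<m. f i) + f m"
  using assms by (simp add: sum.last_plus add.commute)

lemma polyexp_split:
  assumes "1 \<le> m"
  shows "polyexp a m w l = of_real (a 0) + (\<Sum>i=1..<m. of_real (a i) * exp (of_real (l i) * w))
    + of_real (a m) * exp (of_real (l m) * w)"
  unfolding polyexp_def by (subst sum_to_last[OF assms]) (simp add: add.assoc)

text \<open>The factor \<open>exp (l m * w)\<close> turns the exponents 0, \<open>l i\<close>,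
  \<open>l m\<close> of the polynomial at \<open>- w\<close> into \<open>l m\<close>,
  \<open>l m - l i\<close>, 0.\<close>

lemma polyexp_flip:
  assumes "1 \<le> m"
  shows "polyexp (rev_coeff a m) m w (flip m l) = exp (of_real (l m) * w) * polyexp a m (- w) l"
proof -
  have "(\<Sum>i=1..<m. of_real (rev_coeff a m i) * exp (of_real (flip m l i) * w))
    = (\<Sum>i=1..<m. exp (of_real (l m) * w) * (of_real (a i) * exp (of_real (l i) * (- w))))"
    by (intro sum.cong refl) (auto simp: rev_coeff_def flip_def algebra_simps exp_diff exp_minus field_simps)
  then show ?thesis
    using assms unfolding polyexp_split[OF assms]
    by (simp add: rev_coeff_def flip_def algebra_simps sum_distrib_left exp_minus_inverse)
qed

lemma polyexp_flip_zero_iff: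
  assumes "1 \<le> m"
  shows "polyexp (rev_coeff a m) m w (flip m l) = 0 \<longleftrightarrow> polyexp a m (- w) l = 0"
  by (simp add: polyexp_flip[OF assms])

text \<open>The hypotheses on the roots are bundled because they are invariant under reversal: the
  theorem interprets them once for each half-plane.\<close>

locale root_system =
  fixes a :: "nat \<Rightarrow> real" and m :: nat and I :: "'i set" and \<psi> :: "'i \<Rightarrow> (nat \<Rightarrow> real) \<Rightarrow> complex"
  assumes m_pos: "1 \<le> m" and a0: "a 0 \<noteq> 0" and am: "a m \<noteq> 0" and cI: "countable I"
    and root: "\<And>i l. i \<in> I \<Longrightarrow> l \<in> param_space m \<Longrightarrow> polyexp a m (\<psi> i l) l = 0"
    and cont: "\<And>i. i \<in> I \<Longrightarrow> continuous_on (param_space m) (\<psi> i)"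
    and full: "\<And>l w. l \<in> param_space m \<Longrightarrow> polyexp a m w l = 0 \<Longrightarrow> \<exists>i\<in>I. \<psi> i l = w"
begin

lemma reversed_root_system: "root_system (rev_coeff a m) m I (\<lambda>i l. - \<psi> i (flip m l))"
proof
  fix i l assume il: "i \<in> I" "l \<in> param_space m"
  show "polyexp (rev_coeff a m) m (- \<psi> i (flip m l)) l = 0"
    using polyexp_flip_zero_iff[OF m_pos, of a "- \<psi> i (flip m l)" "flip m l"]
      root[OF il(1) flip_param_space[OF m_pos il(2)]] flip_flip[OF il(2)] by simp
next
  fix i assume "i \<in> I"
  then show "continuous_on (param_space m) (\<lambda>l. - \<psi> i (flip m l))"
    using flip_param_space[OF m_pos]
    by (intro continuous_on_minus continuous_on_compose2[OF cont continuous_on_flip]) auto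
next
  fix l w assume l: "l \<in> param_space m" and w: "polyexp (rev_coeff a m) m w l = 0"
  have "polyexp a m (- w) (flip m l) = 0"
    using polyexp_flip_zero_iff[OF m_pos, of a w "flip m l"] w flip_flip[OF l] by simp
  then show "\<exists>i\<in>I. - \<psi> i (flip m l) = w"
    using full[OF flip_param_space[OF m_pos l]] by (metis minus_minus)
qed (use m_pos a0 am cI in \<open>auto simp: rev_coeff_def\<close>)

end

section \<open>Non-real double zeros\<close>

lemma exp_second_order:
  fixes x :: complex
  assumes "norm x \<le> 1" shows "norm (exp x - (1 + x + x\<^sup>2 / 2)) \<le> 2 * norm x ^ 3"
proof -
  have "norm (exp x - (\<Sum>k\<le>2. x ^ k / fact k)) \<le> exp \<bar>Re x\<bar> * norm x ^ Suc 2 / fact 2"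
    by (rule Taylor_exp)
  also have "(\<Sum>k\<le>2. x ^ k / fact k) = 1 + x + x\<^sup>2 / 2"
    by (simp add: numeral_2_eq_2)
  also have "exp \<bar>Re x\<bar> * norm x ^ Suc 2 / fact 2 \<le> 3 * norm x ^ 3 / 2"
  proof -
    have "exp \<bar>Re x\<bar> \<le> exp 1" using abs_Re_le_cmod[of x] assms by simp
    then have "exp \<bar>Re x\<bar> \<le> 3" using exp_le by linarith
    then show ?thesis by (simp add: mult_right_mono numeral_3_eq_3 numeral_2_eq_2)
  qed
  also have "3 * norm x ^ 3 / 2 \<le> 2 * norm x ^ 3" by simp
  finally show ?thesis .
qed

text \<open>The scaling behind the double zero: y is of order r, the phase t of order r^2, the error
  d of the exponent of order r^3. Up to order r^2 only the phase and the Taylor terms in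
  \<open>c * y\<close> survive, and the bound is uniform in all perturbations.\<close>

lemma perturbed_exp_estimate:
  fixes y z :: complex and c t d r M :: real
  assumes c: "0 \<le> c" "c \<le> 1" and r: "0 < r" "r \<le> 1" "2 * M * r \<le> 1" and M: "1 \<le> M"
    and t: "\<bar>t\<bar> \<le> K * r\<^sup>2" and y: "norm y \<le> B * r" and d: "\<bar>d\<bar> \<le> r ^ 3"
    and z: "norm z \<le> Z" and KBZ: "0 \<le> K" "0 \<le> B" "0 \<le> Z" "K + B + Z \<le> M"
  shows "norm (exp (\<i> * of_real t + of_real c * y + of_real d * (z + y))
     - (1 + \<i> * of_real t + of_real c * y + of_real (c\<^sup>2) * y\<^sup>2 / 2)) \<le> 19 * M ^ 3 * r ^ 3"
proof -
  \<comment> \<open>\<open>s\<close> is the part of the exponent of order r^2. The Taylor remainder,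
    the term with \<open>d\<close>, and the products containing \<open>s\<close> contribute 16, 1
    and 2 to the constant 19.\<close>
  define s where "s = \<i> * of_real t + of_real d * (z + y)"
  define x where "x = of_real c * y + s"
  have r32: "r ^ 3 \<le> r\<^sup>2" "r\<^sup>2 \<le> r" using r power_decreasing[of 2 3 r] power_decreasing[of 1 2 r] by auto
  have dzy: "norm (of_real d * (z + y)) \<le> r ^ 3 * (Z + B)"
  proof -
    have "norm (z + y) \<le> Z + B * r" using z y norm_triangle_ineq[of z y] by linarith
    also have "\<dots> \<le> Z + B" using KBZ r by (simp add: mult_left_le)
    finally show ?thesis using d r by (simp add: norm_mult mult_mono)
  qed
  have "norm s \<le> norm (\<i> * of_real t :: complex) + norm (of_real d * (z + y))"
    unfolding s_def by (rule norm_triangle_ineq)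
  also have "\<dots> \<le> K * r\<^sup>2 + r\<^sup>2 * (Z + B)"
  proof -
    have "r ^ 3 * (Z + B) \<le> r\<^sup>2 * (Z + B)" using r32 KBZ by (intro mult_right_mono) auto
    then show ?thesis using dzy t by (simp add: norm_mult)
  qed
  also have "\<dots> = (K + B + Z) * r\<^sup>2" by (simp add: algebra_simps)
  also have "\<dots> \<le> M * r\<^sup>2" using KBZ by (intro mult_right_mono) auto
  finally have s: "norm s \<le> M * r\<^sup>2" .
  have cy: "norm (of_real c * y) \<le> M * r"
  proof -
    have "norm (of_real c * y) \<le> 1 * norm y" unfolding norm_mult using c by (intro mult_right_mono) auto
    also have "\<dots> \<le> B * r" using y by simp
    also have "\<dots> \<le> M * r" using KBZ r by (intro mult_right_mono) auto
    finally show ?thesis .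
  qed
  have Mr: "M * r\<^sup>2 \<le> M * r" using r32 M by simp
  have x: "norm x \<le> 2 * M * r"
    using norm_triangle_ineq[of "of_real c * y" s] s cy Mr unfolding x_def by linarith
  have e1: "norm (exp x - (1 + x + x\<^sup>2 / 2)) \<le> 16 * M ^ 3 * r ^ 3"
  proof -
    have "norm (exp x - (1 + x + x\<^sup>2 / 2)) \<le> 2 * norm x ^ 3"
      using x r by (intro exp_second_order) linarith
    also have "\<dots> \<le> 2 * (2 * M * r) ^ 3" using x by (intro mult_left_mono power_mono) auto
    finally show ?thesis by (simp add: power_mult_distrib)
  qed
  have e2: "norm (of_real d * (z + y)) \<le> M ^ 3 * r ^ 3"
  proof -
    have "Z + B \<le> M" using KBZ by linarith
    also have "M \<le> M ^ 3" using M self_le_power[of M 3] by simp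
    finally have "r ^ 3 * (Z + B) \<le> r ^ 3 * M ^ 3" using r by (intro mult_left_mono) auto
    with dzy show ?thesis by (simp add: mult.commute)
  qed
  have e3: "norm (s * (2 * (of_real c * y) + s) / 2) \<le> 2 * M ^ 3 * r ^ 3"
  proof -
    have "norm (2 * (of_real c * y) + s) \<le> 3 * (M * r)"
      using norm_triangle_ineq[of "2 * (of_real c * y)" s] s cy Mr by (simp add: norm_mult)
    then have "norm s * norm (2 * (of_real c * y) + s) \<le> (M * r\<^sup>2) * (3 * (M * r))"
      using s M r by (intro mult_mono) auto
    also have "\<dots> = 3 * (M\<^sup>2 * r ^ 3)" by (simp add: power2_eq_square power3_eq_cube)
    also have "\<dots> \<le> 3 * (M ^ 3 * r ^ 3)"
      using M r by (intro mult_left_mono mult_right_mono) (auto simp: power_increasing)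
    also have "\<dots> \<le> 4 * (M ^ 3 * r ^ 3)" using M r by simp
    finally show ?thesis by (simp add: norm_mult norm_divide)
  qed
  have "exp (\<i> * of_real t + of_real c * y + of_real d * (z + y))
     - (1 + \<i> * of_real t + of_real c * y + of_real (c\<^sup>2) * y\<^sup>2 / 2)
    = (exp x - (1 + x + x\<^sup>2 / 2)) + of_real d * (z + y) + s * (2 * (of_real c * y) + s) / 2"
  proof -
    have "x\<^sup>2 / 2 = of_real (c\<^sup>2) * y\<^sup>2 / 2 + s * (2 * (of_real c * y) + s) / 2"
      unfolding x_def by (simp add: algebra_simps power2_eq_square flip: add_divide_distrib)
    moreover have "x = \<i> * of_real t + of_real c * y + of_real d * (z + y)"
      unfolding x_def s_def by simp
    ultimately show ?thesis by (simp only:) (simp add: algebra_simps)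
  qed
  also have "norm \<dots> \<le> 16 * M ^ 3 * r ^ 3 + M ^ 3 * r ^ 3 + 2 * M ^ 3 * r ^ 3"
    by (intro norm_triangle_le add_mono e1 e2 e3)
  finally show ?thesis by simp
qed

text \<open>The fractions \<open>k i / n\<close> approximate \<open>c i\<close>, and for large n the
  bounded offsets \<open>s i + u\<close> hardly move the quotient. The same n and k serve all u, so
  that u can later vary continuously.\<close>

lemma rational_phase_approximation:
  fixes s c :: "nat \<Rightarrow> real"
  assumes "finite N" "0 < \<delta>" and c: "\<And>i. i \<in> N \<Longrightarrow> 0 \<le> c i \<and> c i \<le> 1"
  obtains n :: nat and k :: "nat \<Rightarrow> int" where "1 \<le> n"
    "\<And>i u. i \<in> N \<Longrightarrow> \<bar>u\<bar> \<le> 1 \<Longrightarrow> 0 < (s i + u + 2 * pi * k i) / (2 * pi * n)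
      \<and> (s i + u + 2 * pi * k i) / (2 * pi * n) < 1
      \<and> \<bar>(s i + u + 2 * pi * k i) / (2 * pi * n) - c i\<bar> < \<delta>"
proof -
  define B where "B = 1 + (\<Sum>i\<in>N. \<bar>s i\<bar>)"
  have B: "\<bar>s i\<bar> + 1 \<le> B" if "i \<in> N" for i
    unfolding B_def using member_le_sum[OF that, of "\<lambda>i. \<bar>s i\<bar>"] assms(1) by auto
  have B1: "1 \<le> B" unfolding B_def by (simp add: sum_nonneg)
  \<comment> \<open>A safety margin: \<open>k i\<close> will lie between q and n - q, and
    \<open>2 * pi * q\<close> exceeds every \<open>\<bar>s i + u\<bar>\<close>. This keeps the
    quotient strictly between 0 and 1 even where \<open>c i\<close> is 0 or 1. The price is that
    \<open>k i\<close> may differ from \<open>c i * n\<close> by up to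
    \<open>3 * q + 1\<close>.\<close>
  obtain q :: nat where q: "B < real q" using reals_Archimedean2 by blast
  obtain n0 :: nat where n0: "(B + 2 * pi * (3 * q + 1)) / (2 * pi * \<delta>) < real n0"
    using reals_Archimedean2 by blast
  define n where "n = n0 + 2 * q + 1"
  define k where "k i = int q + \<lfloor>c i * (real n - 2 * real q)\<rfloor>" for i
  have nq: "2 * real q \<le> real n" "1 \<le> n" unfolding n_def by auto
  have pi1: "1 \<le> 2 * pi" using pi_gt3 by linarith
  have "0 < (s i + u + 2 * pi * k i) / (2 * pi * n)
      \<and> (s i + u + 2 * pi * k i) / (2 * pi * n) < 1
      \<and> \<bar>(s i + u + 2 * pi * k i) / (2 * pi * n) - c i\<bar> < \<delta>" if i: "i \<in> N" and u: "\<bar>u\<bar> \<le> 1" for i u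
  proof -
    have su: "\<bar>s i + u\<bar> \<le> B" using B[OF i] u by linarith
    have cq: "0 \<le> c i * (real n - 2 * q)" "c i * (real n - 2 * q) \<le> real n - 2 * q"
      using c[OF i] nq by (auto simp: mult_left_le_one_le)
    have kk: "of_int (k i) = real q + of_int \<lfloor>c i * (real n - 2 * q)\<rfloor>" unfolding k_def by simp
    have klo: "real q \<le> of_int (k i)" using cq unfolding kk by simp
    have khi: "of_int (k i) \<le> real n - q"
      using cq(2) of_int_floor_le[of "c i * (real n - 2 * q)"] unfolding kk by linarith
    have kc: "\<bar>of_int (k i) - c i * n\<bar> \<le> 3 * q + 1"
    proof -
      have "of_int (k i) - c i * n = (of_int \<lfloor>c i * (real n - 2 * q)\<rfloor> - c i * (real n - 2 * q)) + q - 2 * (c i * q)"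
        unfolding kk by (simp add: algebra_simps)
      moreover have "\<bar>of_int \<lfloor>c i * (real n - 2 * q)\<rfloor> - c i * (real n - 2 * q)\<bar> \<le> 1" by linarith
      moreover have "0 \<le> c i * q" "c i * q \<le> q" using c[OF i] by (auto simp: mult_left_le_one_le)
      ultimately show ?thesis by linarith
    qed
    have Bq: "B < 2 * pi * q"
    proof -
      have "1 * real q \<le> 2 * pi * q" using pi1 by (intro mult_right_mono) auto
      with q show ?thesis by simp
    qed
    have n': "0 < 2 * pi * real n" using nq by simp
    have p1: "0 < s i + u + 2 * pi * k i"
    proof -
      have "2 * pi * q \<le> 2 * pi * k i" using klo by (intro mult_left_mono) auto
      then show ?thesis using su Bq by linarith
    qed
    have p2: "s i + u + 2 * pi * k i < 2 * pi * n"
    proof -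
      have "2 * pi * k i \<le> 2 * pi * (real n - q)" using khi by (intro mult_left_mono) auto
      then show ?thesis using su Bq by (simp add: algebra_simps)
    qed
    have "\<bar>(s i + u + 2 * pi * k i) / (2 * pi * n) - c i\<bar> = \<bar>s i + u + 2 * pi * (k i - c i * n)\<bar> / (2 * pi * n)"
    proof -
      have "(s i + u + 2 * pi * k i) / (2 * pi * n) - c i = (s i + u + 2 * pi * (k i - c i * n)) / (2 * pi * n)"
        using n' nq(2) by (simp add: field_simps)
      then show ?thesis using n' by (simp add: abs_divide)
    qed
    also have "\<dots> \<le> (B + 2 * pi * (3 * q + 1)) / (2 * pi * n)"
    proof (rule divide_right_mono)
      have "\<bar>2 * pi * (k i - c i * n)\<bar> \<le> 2 * pi * (3 * q + 1)"
        using kc by (simp add: abs_mult)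
      then show "\<bar>s i + u + 2 * pi * (k i - c i * n)\<bar> \<le> B + 2 * pi * (3 * q + 1)" using su by linarith
    qed (use n' in simp)
    also have "\<dots> < \<delta>"
    proof -
      have "real n0 \<le> n" unfolding n_def by simp
      with n0 have "(B + 2 * pi * (3 * q + 1)) / (2 * pi * \<delta>) < real n" by linarith
      then show ?thesis using n' assms(2) by (simp add: field_simps)
    qed
    finally show ?thesis using p1 p2 n' by simp
  qed
  with nq(2) show thesis using that by blast
qed


text \<open>Cramer's rule for z in the real basis v, w of the plane; \<open>Im (v * cnj w)\<close>
  is the determinant up to sign.\<close>

lemma complex_coordinates:
  fixes v w z :: complex
  assumes "Im (v * cnj w) \<noteq> 0"
  shows "v * of_real (Im (z * cnj w) / Im (v * cnj w)) + w * of_real (- Im (z * cnj v) / Im (v * cnj w)) = z"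
proof -
  have "v * of_real (Im (z * cnj w)) - w * of_real (Im (z * cnj v)) = z * of_real (Im (v * cnj w))"
    by (rule complex_eqI) (simp_all add: algebra_simps)
  moreover have "v * of_real (A / D) + w * of_real (- B / D) = z"
    if "v * of_real A - w * of_real B = z * of_real D" "D \<noteq> 0" for A B D
    using that by (simp add: field_simps)
  ultimately show ?thesis using assms by blast
qed

text \<open>The quotient of \<open>y t\<close> by \<open>csqrt c * cis (t / 2)\<close> has a square
  within distance 1 of 1, so its real part never vanishes. After a full turn the denominator has
  changed its sign and the numerator has not, so the real part must vanish somewhere.\<close>

lemma no_continuous_square_root_loop:
  fixes y :: "real \<Rightarrow> complex"
  assumes "continuous_on {0..2 * pi} y" "y (2 * pi) = y 0" "c \<noteq> 0"
    and "\<And>t. t \<in> {0..2 * pi} \<Longrightarrow> norm ((y t)\<^sup>2 / (c * cis t) - 1) < 1"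
  shows False
proof -
  define g where "g t = Re (y t / (csqrt c * cis (t / 2)))" for t
  have ne: "g t \<noteq> 0" if t: "t \<in> {0..2 * pi}" for t
  proof
    assume "g t = 0"
    have "(y t / (csqrt c * cis (t / 2)))\<^sup>2 = (y t)\<^sup>2 / (c * cis t)"
      by (simp add: power_divide power_mult_distrib Complex.DeMoivre)
    moreover have "Re ((y t / (csqrt c * cis (t / 2)))\<^sup>2) \<le> 0"
      using \<open>g t = 0\<close> unfolding g_def power2_eq_square complex_mult_cnj times_complex.sel by simp
    ultimately have "Re ((y t)\<^sup>2 / (c * cis t) - 1) \<le> - 1" by simp
    then have "1 \<le> norm ((y t)\<^sup>2 / (c * cis t) - 1)"
      using abs_Re_le_cmod[of "(y t)\<^sup>2 / (c * cis t) - 1"] by linarith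
    then show False using assms(4)[OF t] by simp
  qed
  have cg: "continuous_on {0..2 * pi} g"
    unfolding g_def using assms(3) by (intro continuous_intros assms(1)) auto
  have "g (2 * pi) = - g 0"
    unfolding g_def using assms(2) by simp
  then have "\<exists>t. 0 \<le> t \<and> t \<le> 2 * pi \<and> g t = 0"
    using cg IVT'[of g 0 0 "2 * pi"] IVT2'[of g "2 * pi" 0 0] by (cases "g 0 \<le> 0") auto
  then show False using ne by auto
qed

context root_system
begin

text \<open>
  With \<open>l i = (s i + 2 \<pi> k i) / (2 \<pi> n)\<close> the shift of the argument by \<open>2 \<pi> \<i> n\<close> multiplies the
  \<open>i\<close>-th term by \<open>cis (s i)\<close>, so the phases of two independent terms can be moved
  along a small circle around the double zero.
\<close>
lemma no_nonreal_double_zero: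
  fixes c s :: "nat \<Rightarrow> real" and z :: complex and V :: "nat \<Rightarrow> complex"
  assumes c: "\<And>i. i \<in> {1..<m} \<Longrightarrow> 0 \<le> c i \<and> c i \<le> 1"
    and V: "\<And>i. i \<in> {1..<m} \<Longrightarrow> V i = of_real (a i) * cis (s i) * exp (of_real (c i) * z)"
    and Vm: "Vm = of_real (a m) * exp z"
    and zero: "of_real (a 0) + (\<Sum>i=1..<m. V i) + Vm = 0"
    and deriv: "(\<Sum>i=1..<m. of_real (c i) * V i) + Vm = 0"
    and W: "(\<Sum>i=1..<m. of_real ((c i)\<^sup>2) * V i) + Vm \<noteq> 0"
    and j: "j \<in> {1..<m}" "j' \<in> {1..<m}" "j \<noteq> j'" "Im (V j * cnj (V j')) \<noteq> 0"
  shows False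
proof -
  define W where "W = (\<Sum>i=1..<m. of_real ((c i)\<^sup>2) * V i) + Vm"
  define \<Delta> where "\<Delta> = Im (V j * cnj (V j'))"
  define K where "K = (norm (V j) + norm (V j')) / \<bar>\<Delta>\<bar>"
  \<comment> \<open>With this B the quadratic term \<open>W * y\<^sup>2 / 2\<close> has modulus 3
    r^2 on the circle of radius \<open>B * r\<close>, against r^2 for the moving term and less than
    r^2 / 2 for the error.\<close>
  define B where "B = sqrt (6 / norm W)"
  define M where "M = 1 + K + B + norm z"
  define S where "S = (\<Sum>i=1..<m. norm (V i)) + norm Vm"
  define C where "C = 19 * M ^ 3 * S"
  have W0: "W \<noteq> 0" using assms W_def by simp
  have B0: "0 \<le> B" "B\<^sup>2 * norm W = 6" "0 < B" using W0 by (auto simp: B_def)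
  have \<Delta>0: "\<Delta> \<noteq> 0" using j by (simp add: \<Delta>_def)
  have K0: "0 \<le> K" by (simp add: K_def)
  have M1: "1 \<le> M" "K + B + norm z \<le> M" unfolding M_def using K0 B0 by auto
  have S0: "0 \<le> S" unfolding S_def by (intro add_nonneg_nonneg sum_nonneg) auto
  have C0: "0 \<le> C" unfolding C_def using M1 S0 by simp
  \<comment> \<open>The denominator is the sum of what is required for
    \<open>2 * M * r \<le> 1\<close>, \<open>C * r < 1 / 2\<close>, \<open>K * r \<le> 1\<close> and
    \<open>r \<le> 1\<close>.\<close>
  define r where "r = 1 / (2 * M + 2 * C + K + 2)"
  have den: "0 < 2 * M + 2 * C + K + 2" using M1 C0 K0 by linarith
  have r: "0 < r" "r \<le> 1" "2 * M * r \<le> 1" "C * r < 1 / 2" "K * r \<le> 1"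
    using den M1 C0 K0 unfolding r_def by (auto simp: field_simps)
  obtain n :: nat and k :: "nat \<Rightarrow> int" where n: "1 \<le> n"
    and nk: "\<And>i u. i \<in> {1..<m} \<Longrightarrow> \<bar>u\<bar> \<le> 1 \<Longrightarrow> 0 < (s i + u + 2 * pi * k i) / (2 * pi * n)
      \<and> (s i + u + 2 * pi * k i) / (2 * pi * n) < 1
      \<and> \<bar>(s i + u + 2 * pi * k i) / (2 * pi * n) - c i\<bar> < r ^ 3"
    using rational_phase_approximation[of "{1..<m}" "r ^ 3" c s] c r by auto
  \<comment> \<open>The coordinates of \<open>r\<^sup>2 * cis \<phi>\<close> in the real basis
    \<open>V j\<close>, \<open>V j'\<close>. A small phase shift \<open>u \<phi> i\<close> changes
    the i-th term by about \<open>\<i> * u \<phi> i * V i\<close>, so the value at the double zero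
    runs once around a circle as \<open>\<phi>\<close> does.\<close>
  define u :: "real \<Rightarrow> nat \<Rightarrow> real" where "u \<phi> i = (if i = j then r\<^sup>2 * (Im (cis \<phi> * cnj (V j')) / \<Delta>)
      else if i = j' then r\<^sup>2 * (- Im (cis \<phi> * cnj (V j)) / \<Delta>) else 0)" for \<phi> i
  define l where "l \<phi> = (\<lambda>i\<in>{1..m}. if i = m then 1 else (s i + u \<phi> i + 2 * pi * k i) / (2 * pi * n))" for \<phi>
  have u: "\<bar>u \<phi> i\<bar> \<le> K * r\<^sup>2" for \<phi> i
  proof -
    have *: "\<bar>Im (cis \<phi> * cnj (V i))\<bar> \<le> norm (V i)" for i
      using abs_Im_le_cmod[of "cis \<phi> * cnj (V i)"] by (simp add: norm_mult)
    have "\<bar>Im (cis \<phi> * cnj (V i))\<bar> / \<bar>\<Delta>\<bar> \<le> K" if "i = j \<or> i = j'" for i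
      unfolding K_def using *[of i] that by (intro divide_right_mono) (auto simp: add_increasing add_increasing2)
    note *** = this
    have **: "r\<^sup>2 * (\<bar>Im (cis \<phi> * cnj (V i))\<bar> / \<bar>\<Delta>\<bar>) \<le> K * r\<^sup>2" if "i = j \<or> i = j'" for i
      using mult_left_mono[OF ***[OF that], of "r\<^sup>2"] by (simp add: mult.commute del: times_complex.sel)
    have "\<bar>u \<phi> i\<bar> = (if i = j then r\<^sup>2 * (\<bar>Im (cis \<phi> * cnj (V j'))\<bar> / \<bar>\<Delta>\<bar>)
      else if i = j' then r\<^sup>2 * (\<bar>Im (cis \<phi> * cnj (V j))\<bar> / \<bar>\<Delta>\<bar>) else 0)"
      unfolding u_def by (auto simp: abs_mult abs_divide simp del: times_complex.sel)
    then show ?thesis using **[of j] **[of j'] K0 by (simp del: times_complex.sel)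
  qed
  have u1: "\<bar>u \<phi> i\<bar> \<le> 1" for \<phi> i
  proof -
    have "K * r\<^sup>2 \<le> K * r" using r K0 by (intro mult_left_mono) (auto simp: power2_eq_square mult_left_le)
    then show ?thesis using u[of \<phi> i] r by linarith
  qed
  have usum: "(\<Sum>i=1..<m. V i * of_real (u \<phi> i)) = r\<^sup>2 * cis \<phi>" for \<phi>
  proof -
    have "(\<Sum>i=1..<m. V i * of_real (u \<phi> i)) = (\<Sum>i\<in>{j, j'}. V i * of_real (u \<phi> i))"
      using j by (intro sum.mono_neutral_right) (auto simp: u_def)
    also have "\<dots> = r\<^sup>2 * (V j * of_real (Im (cis \<phi> * cnj (V j')) / \<Delta>)
        + V j' * of_real (- Im (cis \<phi> * cnj (V j)) / \<Delta>))"
      using j by (simp add: u_def algebra_simps)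
    also have "\<dots> = r\<^sup>2 * cis \<phi>" unfolding \<Delta>_def by (subst complex_coordinates[OF j(4)]) simp
    finally show ?thesis .
  qed
  have l_in: "l \<phi> \<in> param_space m" for \<phi>
  proof (rule param_spaceI)
    fix i assume "i \<in> {1..m}"
    then show "0 < l \<phi> i" using nk[OF _ u1[of \<phi> i], of i] by (cases "i = m") (auto simp: l_def)
  next
    fix i assume "i \<in> {1..<m}"
    then show "l \<phi> i < l \<phi> m" using nk[OF _ u1[of \<phi> i], of i] by (auto simp: l_def)
  qed (simp add: l_def del: atLeastAtMost_iff)
  have lc: "\<bar>l \<phi> i - c i\<bar> \<le> r ^ 3" if "i \<in> {1..<m}" for \<phi> i
    using nk[OF that u1[of \<phi> i]] that by (auto simp: l_def)
  have cont_l: "continuous_on X l" for X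
  proof (rule continuous_on_param[of m])
    fix i assume "i \<in> {1..m}"
    then show "continuous_on X (\<lambda>\<phi>. l \<phi> i)"
      using n \<Delta>0 by (cases "i = m"; cases "i = j"; cases "i = j'") (auto simp: l_def u_def intro!: continuous_intros)
  qed (simp add: l_def del: atLeastAtMost_iff)
  \<comment> \<open>Since \<open>l \<phi> m\<close> is 1, the shift by
    \<open>2 * pi * \<i> * n\<close> leaves the last term unchanged.\<close>
  define w0 where "w0 = 2 * of_real pi * \<i> * of_nat n + z"
  have term_eq: "of_real (a i) * exp (of_real (l \<phi> i) * (w0 + y))
      = V i * exp (\<i> * of_real (u \<phi> i) + of_real (c i) * y + of_real (l \<phi> i - c i) * (z + y))"
    if i: "i \<in> {1..<m}" for i \<phi> y
  proof -
    have ln: "of_real (l \<phi> i) * (2 * of_real pi * of_nat n) = (of_real (s i + u \<phi> i + 2 * pi * k i) :: complex)"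
      using i n by (simp add: l_def)
    have "of_real (l \<phi> i) * (w0 + y) = \<i> * (of_real (l \<phi> i) * (2 * of_real pi * of_nat n)) + of_real (l \<phi> i) * (z + y)"
      by (simp add: w0_def algebra_simps)
    also have "\<dots> = \<i> * of_real (s i) + of_real (c i) * z + (\<i> * of_real (u \<phi> i) + of_real (c i) * y + of_real (l \<phi> i - c i) * (z + y))
        + 2 * of_int (k i) * of_real pi * \<i>"
      unfolding ln by (simp add: algebra_simps)
    also have "exp \<dots> = cis (s i) * exp (of_real (c i) * z) * exp (\<i> * of_real (u \<phi> i) + of_real (c i) * y + of_real (l \<phi> i - c i) * (z + y))"
    proof -
      have "exp (2 * of_int (k i) * of_real pi * \<i>) = 1"
        using exp_integer_2pi[of "of_int (k i)"] by simp
      then show ?thesis by (simp only: exp_add cis_conv_exp mult_1_right)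
    qed
    finally show ?thesis by (simp add: V[OF i])
  qed
  have last_eq: "of_real (a m) * exp (of_real (l \<phi> m) * (w0 + y)) = Vm * exp y" for \<phi> y
  proof -
    have "exp (w0 + y) = exp z * exp y"
      using exp_integer_2pi[OF Ints_of_nat[of n]] by (simp add: w0_def exp_add mult.commute mult.left_commute)
    then show ?thesis using m_pos by (simp add: l_def Vm)
  qed
  \<comment> \<open>The orders 0 and 1 in y cancel by \<open>zero\<close> and \<open>deriv\<close>.
    What remains is the moving term and half the second derivative W, that is, a quadratic equation
    whose discriminant runs around 0.\<close>
  have main: "norm (polyexp a m (w0 + y) (l \<phi>) - (\<i> * r\<^sup>2 * cis \<phi> + W * y\<^sup>2 / 2)) \<le> C * r ^ 3"
    if y: "norm y \<le> B * r" for y \<phi>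
  proof -
    define E where "E i = exp (\<i> * of_real (u \<phi> i) + of_real (c i) * y + of_real (l \<phi> i - c i) * (z + y))
      - (1 + \<i> * of_real (u \<phi> i) + of_real (c i) * y + of_real ((c i)\<^sup>2) * y\<^sup>2 / 2)" for i
    define E' where "E' = exp y - (1 + y + y\<^sup>2 / 2)"
    have E: "norm (E i) \<le> 19 * M ^ 3 * r ^ 3" if i: "i \<in> {1..<m}" for i
      unfolding E_def using c[OF i] r M1 u[of \<phi> i] y lc[OF i, of \<phi>] K0 B0
      by (intro perturbed_exp_estimate[where K=K and B=B and Z="norm z"]) auto
    have E': "norm E' \<le> 19 * M ^ 3 * r ^ 3"
      unfolding E'_def using r M1 y K0 B0
        perturbed_exp_estimate[where K=K and B=B and Z="norm z" and c=1 and t=0 and d=0 and y=y and r=r and M=M and z=z]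
      by simp
    have "polyexp a m (w0 + y) (l \<phi>) = of_real (a 0) + (\<Sum>i=1..<m. V i *
       (1 + \<i> * of_real (u \<phi> i) + of_real (c i) * y + of_real ((c i)\<^sup>2) * y\<^sup>2 / 2 + E i)) + Vm * (1 + y + y\<^sup>2 / 2 + E')"
      unfolding polyexp_split[OF m_pos] last_eq E'_def E_def using term_eq by (simp cong: sum.cong_simp)
    also have "\<dots> = (of_real (a 0) + (\<Sum>i=1..<m. V i) + Vm) + \<i> * (\<Sum>i=1..<m. V i * of_real (u \<phi> i))
       + y * ((\<Sum>i=1..<m. of_real (c i) * V i) + Vm) + W * y\<^sup>2 / 2 + ((\<Sum>i=1..<m. V i * E i) + Vm * E')"
      unfolding W_def by (simp add: algebra_simps sum.distrib sum_distrib_left sum_divide_distrib add_divide_distrib)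
    finally have "polyexp a m (w0 + y) (l \<phi>) - (\<i> * r\<^sup>2 * cis \<phi> + W * y\<^sup>2 / 2) = (\<Sum>i=1..<m. V i * E i) + Vm * E'"
      unfolding zero deriv usum by simp
    also have "norm \<dots> \<le> (\<Sum>i=1..<m. norm (V i) * (19 * M ^ 3 * r ^ 3)) + norm Vm * (19 * M ^ 3 * r ^ 3)"
      using E E' by (intro norm_triangle_le add_mono sum_norm_le) (auto simp: norm_mult mult_left_mono)
    also have "\<dots> = C * r ^ 3" unfolding C_def S_def by (simp add: algebra_simps sum_distrib_left)
    finally show ?thesis .
  qed
  have Cr3: "C * r ^ 3 < r\<^sup>2 / 2"
  proof -
    have "C * r ^ 3 = (C * r) * r\<^sup>2" by (simp add: power3_eq_cube power2_eq_square)
    also have "\<dots> < 1 / 2 * r\<^sup>2" using r by (intro mult_strict_right_mono) auto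
    finally show ?thesis by simp
  qed
  \<comment> \<open>The value 3/2 r^2 separates the circle, where the modulus exceeds 3 r^2 - r^2 -
    r^2 / 2, from the centre, where it is below r^2 + r^2 / 2. Hence there is a zero inside and none
    on the circle.\<close>
  have sphere: "3 / 2 * r\<^sup>2 < norm (polyexp a m (w0 + y) (l \<phi>))" if y: "norm y = B * r" for y \<phi>
  proof -
    have "norm (W * y\<^sup>2 / 2) = 3 * r\<^sup>2"
      using B0(2) y by (simp add: norm_mult norm_divide norm_power power_mult_distrib)
        (metis mult.assoc mult.commute mult_2 numeral_Bit0)
    moreover have "norm (\<i> * r\<^sup>2 * cis \<phi>) = r\<^sup>2" by (simp add: norm_mult norm_power)
    moreover have "norm (W * y\<^sup>2 / 2) \<le> norm (polyexp a m (w0 + y) (l \<phi>)) + norm (\<i> * r\<^sup>2 * cis \<phi>)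
      + norm (polyexp a m (w0 + y) (l \<phi>) - (\<i> * r\<^sup>2 * cis \<phi> + W * y\<^sup>2 / 2))"
      by norm
    ultimately show ?thesis using main[of y \<phi>] y Cr3 by linarith
  qed
  have center: "norm (polyexp a m w0 (l \<phi>)) < 3 / 2 * r\<^sup>2" for \<phi>
  proof -
    have "norm (\<i> * r\<^sup>2 * cis \<phi>) = r\<^sup>2" by (simp add: norm_mult norm_power)
    moreover have "norm (polyexp a m w0 (l \<phi>) - \<i> * r\<^sup>2 * cis \<phi>) \<le> C * r ^ 3"
      using main[of 0 \<phi>] B0 r by simp
    moreover have "norm (polyexp a m w0 (l \<phi>)) \<le> norm (\<i> * r\<^sup>2 * cis \<phi>) + norm (polyexp a m w0 (l \<phi>) - \<i> * r\<^sup>2 * cis \<phi>)"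
      by norm
    ultimately show ?thesis using Cr3 by linarith
  qed
  have Br: "0 < B * r" using B0 r by simp
  obtain w where w: "w \<in> ball w0 (B * r)" "polyexp a m w (l 0) = 0"
  proof (rule holomorphic_contract_to_zero[of w0 "B * r" "\<lambda>w. polyexp a m w (l 0)"])
    show "continuous_on (cball w0 (B * r)) (\<lambda>w. polyexp a m w (l 0))"
      unfolding polyexp_def by (intro continuous_intros)
    show "(\<lambda>w. polyexp a m w (l 0)) holomorphic_on ball w0 (B * r)"
      unfolding polyexp_def by (intro holomorphic_intros)
    fix w assume "norm (w0 - w) = B * r"
    then show "norm (polyexp a m w0 (l 0)) < norm (polyexp a m w (l 0))"
      using sphere[of "w - w0" 0] center[of 0] by (simp add: norm_minus_commute)
  qed (use Br in auto)
  obtain i where i: "i \<in> I" "\<psi> i (l 0) = w" using full[OF l_in w(2)] by blast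
  define y where "y \<phi> = \<psi> i (l \<phi>) - w0" for \<phi>
  have y0: "polyexp a m (w0 + y \<phi>) (l \<phi>) = 0" for \<phi>
    unfolding y_def using root[OF i(1) l_in] by simp
  have cy: "continuous_on X y" for X
    unfolding y_def using l_in by (intro continuous_intros continuous_on_compose2[OF cont[OF i(1)] cont_l]) auto
  \<comment> \<open>The root starts inside the circle and cannot cross it, because no zero lies on
    the circle for any \<open>\<phi>\<close>.\<close>
  have trapped: "norm (y \<phi>) < B * r" if \<phi>: "0 \<le> \<phi>" for \<phi>
  proof (rule ccontr)
    assume "\<not> norm (y \<phi>) < B * r"
    moreover have "norm (y 0) \<le> B * r" using w i by (simp add: y_def dist_norm norm_minus_commute)
    ultimately obtain t where "norm (y t) = B * r"
      using IVT'[of "\<lambda>t. norm (y t)" 0 "B * r" \<phi>] \<phi> continuous_on_norm[OF cy] by auto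
    then show False using sphere[of "y t" t] y0[of t] r by simp
  qed
  \<comment> \<open>The model equation makes \<open>(y \<phi>)\<^sup>2\<close> equal to
    \<open>- 2 * \<i> / W * r\<^sup>2 * cis \<phi>\<close>; the error below r^2 / 2 keeps the true
    quotient within distance 1 of 1.\<close>
  show False
  proof (rule no_continuous_square_root_loop[OF cy, of "- 2 * \<i> / W * r\<^sup>2"])
    have "l (2 * pi) = l 0" unfolding l_def u_def cis_2pi cis_zero by (rule refl)
    then show "y (2 * pi) = y 0" by (simp add: y_def)
    show "- 2 * \<i> / W * r\<^sup>2 \<noteq> 0" using W0 r by simp
    fix \<phi> assume "\<phi> \<in> {0..2 * pi}"
    then have "norm (\<i> * r\<^sup>2 * cis \<phi> + W * (y \<phi>)\<^sup>2 / 2) \<le> C * r ^ 3"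
      using main[of "y \<phi>" \<phi>] trapped[of \<phi>] unfolding y0 diff_0 norm_minus_cancel by simp
    also note Cr3
    finally have *: "norm (\<i> * r\<^sup>2 * cis \<phi> + W * (y \<phi>)\<^sup>2 / 2) < r\<^sup>2 / 2" .
    have "(y \<phi>)\<^sup>2 / (- 2 * \<i> / W * r\<^sup>2 * cis \<phi>) - 1
      = (\<i> * r\<^sup>2 * cis \<phi> + W * (y \<phi>)\<^sup>2 / 2) / (- (\<i> * r\<^sup>2 * cis \<phi>))"
      using W0 r by (simp add: field_simps)
    also have "norm \<dots> < 1"
    proof -
      have "0 < r\<^sup>2" using r by simp
      then have "norm (\<i> * r\<^sup>2 * cis \<phi> + W * (y \<phi>)\<^sup>2 / 2) < r\<^sup>2" using * by linarith
      then show ?thesis using \<open>0 < r\<^sup>2\<close> unfolding norm_divide norm_minus_cancel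
        by (simp add: norm_mult norm_power divide_less_eq)
    qed
    finally show "norm ((y \<phi>)\<^sup>2 / (- 2 * \<i> / W * r\<^sup>2 * cis \<phi>) - 1) < 1" .
  qed
qed

end

section \<open>Dominance of coefficients\<close>

text \<open>Law of cosines, with x as the cosine of the angle. The strict triangle inequalities
  exclude collinear summands: the non-zero sine later provides the pair of linearly independent
  terms.\<close>

lemma exists_phase_norm:
  fixes c R A :: real
  assumes "0 < c" "0 \<le> R" "R = 0 \<and> A = c \<or> \<bar>c - R\<bar> < A \<and> A < c + R"
  obtains \<theta> where "sin \<theta> \<noteq> 0" "norm (of_real c + of_real R * cis \<theta>) = A"
proof (cases "R = 0")
  case True
  then show thesis using assms that[of "pi / 2"] by auto
next
  case False
  define x where "x = (A\<^sup>2 - c\<^sup>2 - R\<^sup>2) / (2 * c * R)"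
  have R: "0 < R" and A: "\<bar>c - R\<bar> < A" "A < c + R" using assms False by auto
  have "(c - R)\<^sup>2 < A\<^sup>2" using A(1) power_strict_mono[of "\<bar>c - R\<bar>" A 2] by simp
  moreover have "A\<^sup>2 < (c + R)\<^sup>2" using A by (intro power_strict_mono) auto
  ultimately have x: "- 1 < x" "x < 1"
    using assms R by (auto simp: x_def field_simps power2_eq_square)
  have "norm (of_real c + of_real R * cis (arccos x)) ^ 2 = c\<^sup>2 + R\<^sup>2 + 2 * c * R * x"
  proof -
    have "norm (of_real c + of_real R * cis (arccos x)) ^ 2 = (c + R * x)\<^sup>2 + (R * sin (arccos x))\<^sup>2"
      using x by (simp add: cmod_def)
    also have "(R * sin (arccos x))\<^sup>2 = R\<^sup>2 * (1 - x\<^sup>2)"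
      using x by (simp add: power_mult_distrib sin_squared_eq)
    finally show ?thesis by (simp add: algebra_simps power2_eq_square)
  qed
  also have "\<dots> = A\<^sup>2" using assms R by (simp add: x_def)
  finally have "norm (of_real c + of_real R * cis (arccos x)) ^ 2 = A\<^sup>2" .
  then have "norm (of_real c + of_real R * cis (arccos x)) = A"
    by (rule power2_eq_imp_eq) (use A in auto)
  moreover have "sin (arccos x) \<noteq> 0" using x by (rule sin_arccos_nonzero)
  ultimately show thesis using that by blast
qed

text \<open>
  The left-hand side attains its maximum \<open>ln (A + B)\<close> at \<open>l = B / (A + B)\<close> and tends to \<open>ln A\<close> at \<open>0\<close>.
  It equals \<open>ln c\<close> if and only if three terms of moduli \<open>A\<close>, \<open>c * exp (l * x)\<close>, \<open>B * exp x\<close> with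
  exponents \<open>0\<close>, \<open>l\<close>, \<open>1\<close> can form a double zero.
\<close>
lemma weighted_entropy_IVT:
  fixes A B c :: real
  assumes "0 < A" "0 < B" "A < c" "c < A + B"
  shows "\<exists>l. 0 < l \<and> l < 1 \<and> (1 - l) * ln (A / (1 - l)) + l * ln (B / l) = ln c"
proof -
  define f where "f l = (1 - l) * ln (A / (1 - l)) + l * ln (B / l)" for l
  define l0 where "l0 = B / (A + B)"
  have l0: "0 < l0" "l0 < 1" "1 - l0 = A / (A + B)" using assms by (auto simp: l0_def field_simps)
  have "A / (1 - l0) = A + B" "B / l0 = A + B" using assms l0 by (auto simp: l0_def)
  then have f0: "f l0 = ln (A + B)" by (simp add: f_def algebra_simps)
  have "(f \<longlongrightarrow> ln A) (at_right 0)"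
    unfolding f_def using assms(1,2) by real_asymp
  moreover have "ln A < ln c" using assms by simp
  ultimately have "eventually (\<lambda>l. f l < ln c) (at_right 0)" by (rule order_tendstoD)
  then obtain e where e: "0 < e" "\<And>l. 0 < l \<Longrightarrow> l < e \<Longrightarrow> f l < ln c"
    unfolding eventually_at_right_field by auto
  define l1 where "l1 = min (e / 2) l0"
  have l1: "0 < l1" "l1 \<le> l0" "l1 < e" using e l0 unfolding l1_def by auto
  have "continuous_on {l1..l0} f"
    unfolding f_def using l1 l0 assms by (intro continuous_intros) auto
  moreover have "f l1 \<le> ln c" using e l1 by (simp add: less_imp_le)
  moreover have "ln c \<le> f l0" using f0 assms by simp
  ultimately obtain l where "l1 \<le> l" "l \<le> l0" "f l = ln c" using IVT'[of f l1 "ln c" l0] l1 by auto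
  then show ?thesis using l0 l1 unfolding f_def by (intro exI[of _ l]) auto
qed

text \<open>The last two conclusions are the solution of
  \<open>A - c * exp (l * x) + B * exp x = 0\<close> together with its derivative in x. Eliminating
  x leaves the equation of \<open>weighted_entropy_IVT\<close> for l. If c does not exceed A, it
  exceeds B, and the exchange of A and B replaces l by 1 - l.\<close>

lemma trinomial_double_zero_moduli:
  fixes A B c :: real
  assumes "0 < A" "0 < B" "min A B < c" "c < A + B"
  obtains l x where "0 < l" "l < 1" "c * exp (l * x) = A / (1 - l)" "B * exp x = l * A / (1 - l)"
proof -
  have c: "0 < c" using assms by (auto simp: min_def split: if_splits)
  obtain l where l: "0 < l" "l < 1" "(1 - l) * ln (A / (1 - l)) + l * ln (B / l) = ln c"
  proof (cases "A < c")
    case True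
    then show thesis using weighted_entropy_IVT[OF assms(1,2) True assms(4)] that by blast
  next
    case False
    then have "B < c" using assms(3) by auto
    then obtain l where "0 < l" "l < 1" "(1 - l) * ln (B / (1 - l)) + l * ln (A / l) = ln c"
      using weighted_entropy_IVT[OF assms(2,1), of c] assms(4) by (auto simp: add.commute)
    then show thesis using that[of "1 - l"] by (simp add: add.commute)
  qed
  define x where "x = ln (l * A / ((1 - l) * B))"
  have ex: "exp x = l * A / ((1 - l) * B)" unfolding x_def using l assms by simp
  have "ln c + l * x = ln (A / (1 - l))"
  proof -
    have x: "x = ln l + ln A - (ln (1 - l) + ln B)"
      using ln_div[of "l * A" "(1 - l) * B"] ln_mult[of l A] ln_mult[of "1 - l" B] l assms
      by (simp add: x_def)
    then show ?thesis
      unfolding l(3)[symmetric] x using l(1,2) assms(1,2) by (simp add: ln_div algebra_simps)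
  qed
  then have "exp (ln c + l * x) = A / (1 - l)" using l assms by simp
  then have "c * exp (l * x) = A / (1 - l)" using c by (simp add: exp_add)
  moreover have "B * exp x = l * A / (1 - l)" using assms ex by simp
  ultimately show thesis using that l by blast
qed

text \<open>The extra angle \<open>pi\<close> absorbs a difference in sign, so that terms with real
  coefficients of either sign can be given a common direction.\<close>

lemma of_real_mult_cis_aligned:
  assumes "y \<noteq> 0"
  shows "of_real x * cis (\<theta> + (if x * y < 0 then pi else 0)) = of_real (sgn y * \<bar>x\<bar>) * cis \<theta>"
proof -
  have "sgn y * \<bar>x\<bar> = (if x * y < 0 then - x else x)"
    using assms by (cases "0 < y"; cases "0 < x") (simp_all add: mult_less_0_iff)
  then show ?thesis by (simp add: minus_cis[symmetric])
qed

lemma exists_cis: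
  assumes "norm z = 1" shows "\<exists>s. cis s = z"
proof
  have "z \<noteq> 0" using assms by auto
  then show "cis (Arg z) = z" using assms by (simp add: cis_Arg sgn_eq)
qed

context root_system
begin

text \<open>
  The exponents in \<open>L\<close> tend to \<open>0\<close> and those in \<open>H\<close> to \<open>1\<close>; with free phases the low and high
  groups act as single terms of moduli \<open>A\<close> and \<open>B\<close>.
\<close>
lemma trinomial_exclusion:
  fixes L H :: "nat set" and A B :: real
  assumes j: "j \<in> {1..<m}" and LH: "L \<union> H = {1..<m} - {j}" "L \<inter> H = {}"
    and i: "i \<in> {1..<m}" "i \<noteq> j" "a i \<noteq> 0"
    and A: "(\<Sum>i\<in>L. \<bar>a i\<bar>) = 0 \<and> A = \<bar>a 0\<bar> \<or>
      \<bar>\<bar>a 0\<bar> - (\<Sum>i\<in>L. \<bar>a i\<bar>)\<bar> < A \<and> A < \<bar>a 0\<bar> + (\<Sum>i\<in>L. \<bar>a i\<bar>)"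
    and B: "(\<Sum>i\<in>H. \<bar>a i\<bar>) = 0 \<and> B = \<bar>a m\<bar> \<or>
      \<bar>\<bar>a m\<bar> - (\<Sum>i\<in>H. \<bar>a i\<bar>)\<bar> < B \<and> B < \<bar>a m\<bar> + (\<Sum>i\<in>H. \<bar>a i\<bar>)"
    and triangle: "min A B < \<bar>a j\<bar>" "\<bar>a j\<bar> < A + B"
  shows False
proof -
  define RL where "RL = (\<Sum>i\<in>L. \<bar>a i\<bar>)"
  define RH where "RH = (\<Sum>i\<in>H. \<bar>a i\<bar>)"
  have R0: "0 \<le> RL" "0 \<le> RH" by (auto simp: RL_def RH_def intro: sum_nonneg)
  have fin: "finite L" "finite H" using LH(1) by (metis finite_Diff finite_Un finite_atLeastLessThan)+
  have AB: "0 < A" "0 < B" using A B a0 am by auto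
  obtain \<theta>0 where th0: "sin \<theta>0 \<noteq> 0" "norm (of_real \<bar>a 0\<bar> + of_real RL * cis \<theta>0) = A"
    using exists_phase_norm[of "\<bar>a 0\<bar>" RL A] a0 R0 A unfolding RL_def by auto
  obtain \<theta>1 where th1: "sin \<theta>1 \<noteq> 0" "norm (of_real \<bar>a m\<bar> + of_real RH * cis \<theta>1) = B"
    using exists_phase_norm[of "\<bar>a m\<bar>" RH B] am R0 B unfolding RH_def by auto
  obtain l x where l: "0 < l" "l < 1" and lx: "\<bar>a j\<bar> * exp (l * x) = A / (1 - l)" "B * exp x = l * A / (1 - l)"
    using trinomial_double_zero_moduli[OF AB triangle] by blast
  define C0 where "C0 = of_real (sgn (a 0)) * (of_real \<bar>a 0\<bar> + of_real RL * cis \<theta>0)"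
  define C1 where "C1 = of_real (sgn (a m)) * (of_real \<bar>a m\<bar> + of_real RH * cis \<theta>1)"
  have nC: "norm C0 = A" "norm C1 = B" using a0 am th0 th1 by (auto simp: C0_def C1_def norm_mult)
  have C0: "C0 \<noteq> 0" "C1 \<noteq> 0" using nC AB by auto
  have "norm (C0 / A / (C1 / B)) = 1"
    using AB unfolding norm_divide norm_of_real nC by simp
  then obtain \<tau> where tau: "cis \<tau> = C0 / A / (C1 / B)"
    using exists_cis by blast
  \<comment> \<open>The real part makes the moduli fit a double zero; the imaginary part turns the
    high group into the direction of the low group.\<close>
  define z where "z = Complex x \<tau>"
  have exp_z: "exp z = of_real (exp x) * cis \<tau>" "norm (exp (of_real l * z)) = exp (l * x)"
    by (auto simp: z_def exp_eq_polar norm_mult)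
  have aj: "a j \<noteq> 0" using triangle AB by auto
  have C1z: "C1 * exp z = of_real (l / (1 - l)) * C0"
  proof -
    have "C1 * exp z = of_real (B * exp x) * C0 / A" unfolding exp_z tau using C0 AB by simp
    also have "\<dots> = of_real (l / (1 - l)) * C0" unfolding lx using AB by simp
    finally show ?thesis .
  qed
  have "norm (- (C0 / of_real (1 - l)) / (of_real (a j) * exp (of_real l * z))) = 1"
  proof -
    have "\<bar>1 - l\<bar> = 1 - l" using l by simp
    then show ?thesis
      unfolding norm_divide norm_mult norm_minus_cancel norm_of_real nC exp_z(2) lx(1) using AB l by simp
  qed
  then obtain sj where sj: "cis sj = - (C0 / of_real (1 - l)) / (of_real (a j) * exp (of_real l * z))"
    using exists_cis by blast
  have sj': "of_real (a j) * cis sj * exp (of_real l * z) = - (C0 / of_real (1 - l))"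
    using sj aj by simp
  \<comment> \<open>Inside each group the phases differ only by the signs of the coefficients, so
    the variable terms of the group point in one direction. The phase \<open>sj\<close> makes the
    middle term opposite to the low group.\<close>
  define s where "s i = (if i = j then sj else if i \<in> L then \<theta>0 + (if a i * a 0 < 0 then pi else 0)
     else \<theta>1 + (if a i * a m < 0 then pi else 0))" for i
  define c :: "nat \<Rightarrow> real" where "c i = (if i = j then l else if i \<in> L then 0 else 1)" for i
  define V where "V i = of_real (a i) * cis (s i) * exp (of_real (c i) * z)" for i
  have Vj: "V j = - (C0 / of_real (1 - l))" unfolding V_def s_def c_def using sj' by simp
  have jLH: "j \<notin> L" "j \<notin> H" using LH(1) by blast+
  have VL: "V k = of_real (sgn (a 0)) * (of_real \<bar>a k\<bar> * cis \<theta>0)" "c k = 0" if "k \<in> L" for k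
    unfolding V_def s_def c_def using that jLH of_real_mult_cis_aligned[OF a0] by auto
  have VH: "V k = of_real (sgn (a m)) * (of_real \<bar>a k\<bar> * cis \<theta>1) * exp z" "c k = 1" if "k \<in> H" for k
  proof -
    have "k \<noteq> j" "k \<notin> L" using that jLH LH(2) by auto
    then show "V k = of_real (sgn (a m)) * (of_real \<bar>a k\<bar> * cis \<theta>1) * exp z" "c k = 1"
      unfolding V_def s_def c_def using of_real_mult_cis_aligned[OF am, of "a k" \<theta>1] by auto
  qed
  have split: "(\<Sum>k=1..<m. f k) = f j + ((\<Sum>k\<in>L. f k) + (\<Sum>k\<in>H. f k))" for f :: "nat \<Rightarrow> complex"
  proof -
    have "(\<Sum>k=1..<m. f k) = f j + (\<Sum>k\<in>{1..<m} - {j}. f k)" using j by (simp add: sum.remove)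
    also have "{1..<m} - {j} = L \<union> H" using LH by simp
    also have "(\<Sum>k\<in>L \<union> H. f k) = (\<Sum>k\<in>L. f k) + (\<Sum>k\<in>H. f k)"
      by (rule sum.union_disjoint[OF fin LH(2)])
    finally show ?thesis .
  qed
  have sgn_abs: "of_real x = (of_real (sgn x) * of_real \<bar>x\<bar> :: complex)" for x :: real
    by (simp only: of_real_mult[symmetric] sgn_mult_abs)
  have low: "of_real (a 0) + (\<Sum>k\<in>L. V k) = C0"
  proof -
    have "(\<Sum>k\<in>L. V k) = of_real (sgn (a 0)) * (of_real RL * cis \<theta>0)"
      using VL by (simp add: RL_def sum_distrib_left sum_distrib_right)
    then show ?thesis unfolding C0_def distrib_left using sgn_abs[of "a 0"] by simp
  qed
  have high: "(\<Sum>k\<in>H. V k) + of_real (a m) * exp z = of_real (l / (1 - l)) * C0"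
  proof -
    have "(\<Sum>k\<in>H. V k) = of_real (sgn (a m)) * (of_real RH * cis \<theta>1) * exp z"
      using VH by (simp add: RH_def sum_distrib_left sum_distrib_right)
    then have "(\<Sum>k\<in>H. V k) + of_real (a m) * exp z = C1 * exp z"
      unfolding C1_def distrib_left distrib_right using sgn_abs[of "a m"] by simp
    then show ?thesis using C1z by simp
  qed
  have cL: "(\<Sum>k\<in>L. of_real (c k) * V k) = 0" "(\<Sum>k\<in>L. of_real ((c k)\<^sup>2) * V k) = 0"
    using VL by auto
  have cH: "(\<Sum>k\<in>H. of_real (c k) * V k) = (\<Sum>k\<in>H. V k)" "(\<Sum>k\<in>H. of_real ((c k)\<^sup>2) * V k) = (\<Sum>k\<in>H. V k)"
    using VH by (auto intro!: sum.cong)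
  have cj: "c j = l" by (simp add: c_def)
  have l1: "of_real (1 - l) \<noteq> (0 :: complex)" using l by (simp del: of_real_diff)
  have cnj0: "Im (cis \<theta>0 * cnj C0) = sgn (a 0) * \<bar>a 0\<bar> * sin \<theta>0"
    unfolding C0_def by (simp add: algebra_simps)
  have cnj1: "Im (cis \<theta>1 * cnj C1) = sgn (a m) * \<bar>a m\<bar> * sin \<theta>1"
    unfolding C1_def by (simp add: algebra_simps)
  have Im_of_real: "Im (of_real r * w) = r * Im w" "Im (w * of_real r) = Im w * r" for r w
    by simp_all
  show False
  proof (rule no_nonreal_double_zero[where c=c and s=s and z=z and V=V and j=i and j'=j])
    show "of_real (a 0) + (\<Sum>i=1..<m. V i) + of_real (a m) * exp z = 0"
    proof -
      have "of_real (a 0) + (\<Sum>i=1..<m. V i) + of_real (a m) * exp z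
        = (of_real (a 0) + (\<Sum>k\<in>L. V k)) + V j + ((\<Sum>k\<in>H. V k) + of_real (a m) * exp z)"
        unfolding split by simp
      also have "\<dots> = 0" unfolding low high Vj using l1 by (simp add: field_simps)
      finally show ?thesis .
    qed
    show "(\<Sum>i=1..<m. of_real (c i) * V i) + of_real (a m) * exp z = 0"
    proof -
      have "(\<Sum>i=1..<m. of_real (c i) * V i) + of_real (a m) * exp z
        = of_real l * V j + ((\<Sum>k\<in>H. V k) + of_real (a m) * exp z)"
        unfolding split cL cH cj by simp
      also have "\<dots> = 0" unfolding high Vj by simp
      finally show ?thesis .
    qed
    show "(\<Sum>i=1..<m. of_real ((c i)\<^sup>2) * V i) + of_real (a m) * exp z \<noteq> 0"
    proof -
      have "(\<Sum>i=1..<m. of_real ((c i)\<^sup>2) * V i) + of_real (a m) * exp z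
        = of_real (l\<^sup>2) * V j + ((\<Sum>k\<in>H. V k) + of_real (a m) * exp z)"
        unfolding split cL cH cj by simp
      also have "\<dots> = of_real l * C0"
      proof -
        have "of_real (l\<^sup>2) * (- (C0 / of_real (1 - l))) + of_real (l / (1 - l)) * C0
          = of_real ((l - l\<^sup>2) / (1 - l)) * C0"
          by (simp add: diff_divide_distrib left_diff_distrib)
        also have "(l - l\<^sup>2) / (1 - l) = l" using l by (simp add: field_simps power2_eq_square)
        finally show ?thesis unfolding high Vj .
      qed
      finally show ?thesis using l C0 by simp
    qed
    \<comment> \<open>\<open>V j\<close> is a real multiple of \<open>C0\<close>, and also of
      \<open>C1 * exp z\<close>. A single term of a group is not parallel to the sum of its group,
      because \<open>\<theta>0\<close> and \<open>\<theta>1\<close> have non-zero sine; hence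
      \<open>V i\<close> and \<open>V j\<close> are independent.\<close>
    have "i \<in> L \<or> i \<in> H" using i LH by auto
    then show "Im (V i * cnj (V j)) \<noteq> 0"
    proof
      assume iL: "i \<in> L"
      have "V i * cnj (V j) = of_real (- (sgn (a 0) * \<bar>a i\<bar> / (1 - l))) * (cis \<theta>0 * cnj C0)"
        unfolding VL[OF iL] Vj by simp
      then have "Im (V i * cnj (V j)) = - (sgn (a 0) * \<bar>a i\<bar> / (1 - l)) * (sgn (a 0) * \<bar>a 0\<bar> * sin \<theta>0)"
        by (simp only: Im_of_real(1) cnj0)
      then show ?thesis using a0 i l th0 by (simp add: sgn_if)
    next
      assume iH: "i \<in> H"
      have "V j = - of_real (1 / l) * (C1 * exp z)"
        unfolding Vj C1z using l l1 by (simp add: field_simps)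
      then have "V i * cnj (V j) = of_real (- (sgn (a m) * \<bar>a i\<bar> / l)) * (cis \<theta>1 * cnj C1) * (exp z * cnj (exp z))"
        unfolding VH[OF iH] by (simp del: exp_cnj)
      also have "exp z * cnj (exp z) = of_real ((norm (exp z))\<^sup>2)" by (simp only: complex_norm_square)
      finally have "Im (V i * cnj (V j)) = - (sgn (a m) * \<bar>a i\<bar> / l) * (sgn (a m) * \<bar>a m\<bar> * sin \<theta>1) * (norm (exp z))\<^sup>2"
        by (simp only: Im_of_real(2) Im_of_real(1) cnj1)
      then show ?thesis using am i l th1 by (simp add: sgn_if)
    qed
  qed (use i j l in \<open>auto simp: V_def c_def\<close>)
qed

end

text \<open>Elements are added to L until the remainder of s drops below b. Each of them is at most
  b, so the last one does not make the remainder negative.\<close>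

lemma greedy_subset:
  fixes c :: "'a \<Rightarrow> real"
  assumes "finite X" "\<And>x. x \<in> X \<Longrightarrow> c x \<le> b" "s < b + sum c X"
  shows "\<exists>L\<subseteq>X. s - sum c L < b \<and> (L = {} \<or> 0 \<le> s - sum c L)"
  using assms
proof (induction X rule: finite_induct)
  case empty
  then show ?case by simp
next
  case (insert x X)
  show ?case
  proof (cases "s < b + sum c X")
    case True
    then show ?thesis using insert.IH insert.prems(1) by (metis insertCI subset_insertI2)
  next
    case False
    moreover have "sum c (insert x X) = c x + sum c X" "c x \<le> b" using insert by auto
    ultimately have "s - sum c (insert x X) < b" "0 \<le> s - sum c (insert x X)"
      using insert.prems(2) by linarith+
    then show ?thesis by blast
  qed
qed

context root_system
begin

text \<open>Otherwise \<open>trinomial_exclusion\<close> applies with middle term j. Terms of N that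
  outweigh \<open>a 0\<close> contain a greedy subset L that can bring the low group to a modulus A
  below \<open>\<bar>a j\<bar>\<close>. By \<open>top\<close> the remaining terms can give the high
  group a modulus B of at least \<open>\<bar>a j\<bar>\<close>, and then
  \<open>A < \<bar>a j\<bar> < A + B\<close>.\<close>

lemma low_dominates:
  assumes N: "N \<subseteq> {1..<m}" and j: "j \<in> N" "a j \<noteq> 0" and max: "\<And>i. i \<in> N \<Longrightarrow> \<bar>a i\<bar> \<le> \<bar>a j\<bar>"
    and top: "\<bar>a j\<bar> \<le> \<bar>a m\<bar> \<or> \<bar>a j\<bar> < \<bar>a m\<bar> + (\<Sum>i\<in>{1..<m} - N. \<bar>a i\<bar>)"
    and i: "i \<in> {1..<m}" "i \<noteq> j" "a i \<noteq> 0"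
  shows "(\<Sum>i\<in>N. \<bar>a i\<bar>) \<le> \<bar>a 0\<bar>"
proof (rule ccontr)
  define c where "c i = \<bar>a i\<bar>" for i
  assume "\<not> (\<Sum>i\<in>N. \<bar>a i\<bar>) \<le> \<bar>a 0\<bar>"
  then have less: "c 0 < sum c N" by (simp add: c_def[abs_def])
  have finN: "finite N" using N finite_subset by blast
  have "c 0 < c j + sum c (N - {j})" using less finN j by (simp add: sum.remove)
  then obtain L where L: "L \<subseteq> N - {j}" "c 0 - sum c L < c j" "L = {} \<or> 0 \<le> c 0 - sum c L"
    using greedy_subset[of "N - {j}" c "c j" "c 0"] finN max by (auto simp: c_def)
  define H where "H = {1..<m} - {j} - L"
  have fin: "finite L" "finite H" using L(1) finN finite_subset unfolding H_def by blast+
  have LH: "L \<union> H = {1..<m} - {j}" "L \<inter> H = {}" using L(1) N unfolding H_def by blast+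
  have s0: "0 \<le> sum c L" "0 \<le> sum c H" by (auto simp: c_def intro: sum_nonneg)
  have c0: "0 < c 0" "0 < c m" "0 < c j" using a0 am j by (auto simp: c_def)
  have rest: "sum c ({1..<m} - N) \<le> sum c H"
    by (rule sum_mono2) (use fin L j in \<open>auto simp: H_def c_def\<close>)
  have "\<exists>A. (sum c L = 0 \<and> A = c 0 \<or> \<bar>c 0 - sum c L\<bar> < A \<and> A < c 0 + sum c L) \<and> 0 < A \<and> A < c j"
  proof (cases "sum c L = 0")
    case True
    then show ?thesis using L c0 by auto
  next
    case False
    then have "L \<noteq> {}" by auto
    then have "0 \<le> c 0 - sum c L" using L by blast
    moreover have "c 0 - sum c L < min (c j) (c 0 + sum c L)" using L s0 False by auto
    ultimately show ?thesis using dense[of "c 0 - sum c L" "min (c j) (c 0 + sum c L)"] by auto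
  qed
  then obtain A where A: "sum c L = 0 \<and> A = c 0 \<or> \<bar>c 0 - sum c L\<bar> < A \<and> A < c 0 + sum c L" "0 < A" "A < c j"
    by blast
  have top': "c j \<le> c m \<or> c j < c m + sum c ({1..<m} - N)" using top by (simp add: c_def[abs_def])
  have "\<exists>B. (sum c H = 0 \<and> B = c m \<or> \<bar>c m - sum c H\<bar> < B \<and> B < c m + sum c H) \<and> c j \<le> B"
  proof (cases "sum c H = 0")
    case True
    then show ?thesis using top' rest by auto
  next
    case False
    then have "max \<bar>c m - sum c H\<bar> (c j) < c m + sum c H" using top' rest s0 c0 by auto
    then show ?thesis using dense[of "max \<bar>c m - sum c H\<bar> (c j)" "c m + sum c H"] by (auto intro: less_imp_le)
  qed
  then obtain B where B: "sum c H = 0 \<and> B = c m \<or> \<bar>c m - sum c H\<bar> < B \<and> B < c m + sum c H" "c j \<le> B"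
    by blast
  have "j \<in> {1..<m}" using N j by auto
  then show False
    using trinomial_exclusion[OF _ LH i, of A B] A B by (auto simp: c_def[abs_def] min_def)
qed

text \<open>Here all other middle terms join the low group and the high group is \<open>a m\<close>
  alone. Without dominance the low group can be given a modulus above
  \<open>\<bar>a j\<bar> - \<bar>a m\<bar>\<close>, and the triangle conditions of
  \<open>trinomial_exclusion\<close> hold.\<close>

lemma middle_dominates_of_gt_top:
  assumes j: "j \<in> {1..<m}" and gt: "\<bar>a m\<bar> < \<bar>a j\<bar>"
    and i: "i \<in> {1..<m}" "i \<noteq> j" "a i \<noteq> 0"
  shows "\<bar>a 0\<bar> + \<bar>a m\<bar> + (\<Sum>i\<in>{1..<m} - {j}. \<bar>a i\<bar>) \<le> \<bar>a j\<bar>"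
proof (rule ccontr)
  define R where "R = (\<Sum>i\<in>{1..<m} - {j}. \<bar>a i\<bar>)"
  assume "\<not> \<bar>a 0\<bar> + \<bar>a m\<bar> + (\<Sum>i\<in>{1..<m} - {j}. \<bar>a i\<bar>) \<le> \<bar>a j\<bar>"
  then have less: "\<bar>a j\<bar> < \<bar>a 0\<bar> + \<bar>a m\<bar> + R" by (simp add: R_def)
  have "\<bar>a i\<bar> \<le> R" unfolding R_def using i by (intro member_le_sum) auto
  then have "0 < R" using i by auto
  then have "max \<bar>\<bar>a 0\<bar> - R\<bar> (\<bar>a j\<bar> - \<bar>a m\<bar>) < \<bar>a 0\<bar> + R" using less a0 by auto
  then obtain A where A: "max \<bar>\<bar>a 0\<bar> - R\<bar> (\<bar>a j\<bar> - \<bar>a m\<bar>) < A" "A < \<bar>a 0\<bar> + R" using dense by blast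
  show False
  proof (rule trinomial_exclusion[OF j _ _ i, of "{1..<m} - {j}" "{}" A "\<bar>a m\<bar>"])
    show "min A \<bar>a m\<bar> < \<bar>a j\<bar>" using gt by (simp add: min_less_iff_disj)
  qed (use A in \<open>auto simp: R_def\<close>)
qed

text \<open>The largest middle coefficient \<open>a j\<close> decides. If both outer coefficients
  are at least as large, \<open>low_dominates\<close> for the system and for its reversal gives
  \<open>outer\<close>. Otherwise \<open>middle_dominates_of_gt_top\<close>, possibly reversed,
  applies to j; the remaining two bounds of \<open>inner\<close> come from
  \<open>low_dominates\<close> for the other middle terms, where \<open>a j\<close> strengthens the
  high group.\<close>

lemma dominance_cases:
  assumes i: "i1 \<in> {1..<m}" "i2 \<in> {1..<m}" "i1 \<noteq> i2" "a i1 \<noteq> 0" "a i2 \<noteq> 0"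
  obtains (outer) "(\<Sum>i=1..<m. \<bar>a i\<bar>) \<le> \<bar>a 0\<bar>" "(\<Sum>i=1..<m. \<bar>a i\<bar>) \<le> \<bar>a m\<bar>"
  | (inner) k where "k \<in> {1..<m}" "\<bar>a 0\<bar> + \<bar>a m\<bar> + (\<Sum>i\<in>{1..<m} - {k}. \<bar>a i\<bar>) \<le> \<bar>a k\<bar>"
      "(\<Sum>i\<in>{1..<m} - {k}. \<bar>a i\<bar>) \<le> \<bar>a 0\<bar>" "(\<Sum>i\<in>{1..<m} - {k}. \<bar>a i\<bar>) \<le> \<bar>a m\<bar>"
proof -
  interpret rev: root_system "rev_coeff a m" m I "\<lambda>i l. - \<psi> i (flip m l)"
    by (rule reversed_root_system)
  have rv: "rev_coeff a m 0 = a m" "rev_coeff a m m = a 0" "rev_coeff a m i = a i" if "i \<in> {1..<m}" for i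
    using that m_pos by (auto simp: rev_coeff_def)
  have rv0: "rev_coeff a m 0 = a m" "rev_coeff a m m = a 0" using m_pos by (auto simp: rev_coeff_def)
  have rvs: "(\<Sum>i\<in>X. \<bar>rev_coeff a m i\<bar>) = (\<Sum>i\<in>X. \<bar>a i\<bar>)" if "X \<subseteq> {1..<m}" for X
    using that rv(3) by (intro sum.cong) auto
  have obtain_max: "\<exists>j\<in>X. \<forall>i\<in>X. \<bar>a i\<bar> \<le> \<bar>a j\<bar>" if "finite X" "X \<noteq> {}" for X
    using Max_in[of "(\<lambda>i. \<bar>a i\<bar>) ` X"] Max_ge[of "(\<lambda>i. \<bar>a i\<bar>) ` X"] that by fastforce
  obtain j where j: "j \<in> {1..<m}" "\<And>i. i \<in> {1..<m} \<Longrightarrow> \<bar>a i\<bar> \<le> \<bar>a j\<bar>"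
    using obtain_max[of "{1..<m}"] i(1) by auto
  have aj: "a j \<noteq> 0" using j(2)[OF i(1)] i(4) by auto
  obtain i where i': "i \<in> {1..<m}" "i \<noteq> j" "a i \<noteq> 0" using i by blast
  show thesis
  proof (cases "\<bar>a j\<bar> \<le> \<bar>a 0\<bar> \<and> \<bar>a j\<bar> \<le> \<bar>a m\<bar>")
    case True
    have "(\<Sum>i=1..<m. \<bar>a i\<bar>) \<le> \<bar>a 0\<bar>"
      using low_dominates[of "{1..<m}" j i] j aj i' True by auto
    moreover have "(\<Sum>i=1..<m. \<bar>a i\<bar>) \<le> \<bar>a m\<bar>"
      using rev.low_dominates[of "{1..<m}" j i] j aj i' True rv rv0 rvs[of "{1..<m}"] by auto
    ultimately show thesis by (rule outer)
  next
    case False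
    define R where "R = (\<Sum>i\<in>{1..<m} - {j}. \<bar>a i\<bar>)"
    have dom: "\<bar>a 0\<bar> + \<bar>a m\<bar> + R \<le> \<bar>a j\<bar>"
    proof (cases "\<bar>a m\<bar> < \<bar>a j\<bar>")
      case True
      then show ?thesis using middle_dominates_of_gt_top[OF j(1) _ i'] by (simp add: R_def)
    next
      case False
      then have "\<bar>a 0\<bar> < \<bar>a j\<bar>" using \<open>\<not> (\<bar>a j\<bar> \<le> \<bar>a 0\<bar> \<and> \<bar>a j\<bar> \<le> \<bar>a m\<bar>)\<close> by auto
      then have "\<bar>rev_coeff a m m\<bar> < \<bar>rev_coeff a m j\<bar>" "rev_coeff a m i \<noteq> 0" using rv(3) j(1) i' rv0 by auto
      then show ?thesis
        using rev.middle_dominates_of_gt_top[OF j(1) _ i'(1,2)] rvs[of "{1..<m} - {j}"] rv(3)[OF j(1)] rv0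
        by (auto simp: R_def)
    qed
    have ex: "R \<le> \<bar>a 0\<bar> \<and> R \<le> \<bar>a m\<bar>"
    proof -
      have ne: "finite ({1..<m} - {j})" "{1..<m} - {j} \<noteq> {}" using i' by auto
      obtain j' where j': "j' \<in> {1..<m} - {j}" "\<And>i. i \<in> {1..<m} - {j} \<Longrightarrow> \<bar>a i\<bar> \<le> \<bar>a j'\<bar>"
        using obtain_max[OF ne] by blast
      have aj': "a j' \<noteq> 0" using j'(2)[of i] i' by auto
      have D: "{1..<m} - ({1..<m} - {j}) = {j}" using j(1) by auto
      have lt: "\<bar>a j'\<bar> < \<bar>a m\<bar> + \<bar>a j\<bar>" "\<bar>a j'\<bar> < \<bar>a 0\<bar> + \<bar>a j\<bar>" using j(2)[of j'] j'(1) a0 am by auto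
      have "R \<le> \<bar>a 0\<bar>"
        using low_dominates[of "{1..<m} - {j}" j' j] j' aj' j(1) aj lt(1) unfolding R_def D by auto
      moreover have "R \<le> \<bar>a m\<bar>"
        using rev.low_dominates[of "{1..<m} - {j}" j' j] j' aj' j(1) aj lt(2) rv(3) rv0 rvs[of "{1..<m} - {j}"]
        unfolding R_def D by auto
      ultimately show ?thesis ..
    qed
    show thesis using inner[OF j(1)] dom ex unfolding R_def by blast
  qed
qed

end

section \<open>Barriers for the imaginary part\<close>

text \<open>The solutions of \<open>cos z = s\<close> are spaced by \<open>2 * pi\<close>, so an
  interval that avoids them has length at most \<open>2 * pi\<close>. The values of g form such an
  interval.\<close>

lemma cos_barrier:
  fixes g :: "'a::topological_space \<Rightarrow> real"
  assumes "connected X" "continuous_on X g" "s = 1 \<or> s = -1" "\<And>x. x \<in> X \<Longrightarrow> cos (g x) \<noteq> s"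
  shows "\<exists>C. \<forall>x\<in>X. \<bar>g x\<bar> \<le> C"
proof (cases "X = {}")
  case False
  then obtain x0 where x0: "x0 \<in> X" by blast
  define d where "d = (if s = 1 then 0 else pi)"
  have cosd: "cos (d + 2 * pi * of_int n) = s" for n
    using assms(3) cos_int_2pin[of n] sin_int_2pin[of n] by (auto simp: d_def cos_add)
  have conn: "connected (g ` X)" using assms by (intro connected_continuous_image)
  have hit: False if uv: "u \<in> g ` X" "v \<in> g ` X" "u + 2 * pi < v" for u v
  proof -
    \<comment> \<open>The least solution of \<open>cos z = s\<close> that is not below u.\<close>
    define z where "z = d + 2 * pi * of_int \<lceil>(u - d) / (2 * pi)\<rceil>"
    have "(u - d) / (2 * pi) \<le> of_int \<lceil>(u - d) / (2 * pi)\<rceil>"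
      "of_int \<lceil>(u - d) / (2 * pi)\<rceil> < (u - d) / (2 * pi) + 1" by linarith+
    then have "2 * pi * ((u - d) / (2 * pi)) \<le> 2 * pi * of_int \<lceil>(u - d) / (2 * pi)\<rceil>"
      "2 * pi * of_int \<lceil>(u - d) / (2 * pi)\<rceil> < 2 * pi * ((u - d) / (2 * pi) + 1)"
      using pi_gt_zero by - (rule mult_left_mono mult_strict_left_mono; simp)+
    moreover have "2 * pi * ((u - d) / (2 * pi)) = u - d" by simp
    ultimately have "u \<le> z" "z \<le> v" using uv(3) by (auto simp: z_def algebra_simps)
    then have "z \<in> g ` X" using connectedD_interval[OF conn uv(1,2)] by simp
    moreover have "cos z = s" unfolding z_def by (rule cosd)
    ultimately show False using assms(4) by auto
  qed
  have "\<bar>g x\<bar> \<le> \<bar>g x0\<bar> + 2 * pi" if "x \<in> X" for x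
    using hit[of "g x" "g x0"] hit[of "g x0" "g x"] x0 that by force
  then show ?thesis by blast
qed simp

lemma cis_eq_sign: "s = 1 \<or> s = -1 \<Longrightarrow> cos y = s \<Longrightarrow> cis y = of_real s"
  using sin_zero_iff_int2[of y] sin_cos_squared_add[of y] by (auto simp: cis.code complex_eq_iff)

text \<open>The condition on the cosine says that both summands point in the same direction, so
  nothing cancels.\<close>

lemma norm_add_aligned:
  fixes A B t :: real
  assumes "A \<noteq> 0" "B \<noteq> 0" "cos y = sgn (A * B)" "0 \<le> t"
  shows "norm (of_real A + of_real B * (of_real t * cis y)) = \<bar>A\<bar> + \<bar>B\<bar> * t"
proof -
  have s: "sgn (A * B) = 1 \<or> sgn (A * B) = -1" using assms by (auto simp: sgn_if)
  have "of_real A + of_real B * (of_real t * cis y) = (of_real (A + B * t * sgn (A * B)) :: complex)"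
    using cis_eq_sign[OF s assms(3)] by simp
  also have "norm \<dots> = \<bar>A + B * t * sgn (A * B)\<bar>" by (rule norm_of_real)
  also have "A + B * t * sgn (A * B) = sgn A * (\<bar>A\<bar> + \<bar>B\<bar> * t)"
    using assms by (auto simp: sgn_if mult_less_0_iff zero_less_mult_iff)
  also have "\<bar>\<dots>\<bar> = \<bar>A\<bar> + \<bar>B\<bar> * t" using assms by (simp add: abs_mult)
  finally show ?thesis .
qed

lemma exp_real_mult: "exp (of_real x * w) = of_real (exp (x * Re w)) * cis (x * Im w)"
  by (simp add: exp_eq_polar)

lemma polyexp_split_at:
  assumes "1 \<le> m" "k \<in> {1..<m}"
  shows "polyexp a m w l = of_real (a 0) + of_real (a k) * exp (of_real (l k) * w)
    + ((\<Sum>i\<in>{1..<m} - {k}. of_real (a i) * exp (of_real (l i) * w)) + of_real (a m) * exp (of_real (l m) * w))"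
  unfolding polyexp_split[OF assms(1)] sum.remove[OF finite_atLeastLessThan assms(2)] by (simp add: add_ac)

text \<open>If the two outer terms were aligned, their moduli would add up to
  \<open>\<bar>a 0\<bar> + \<bar>a m\<bar> * E\<close>. The middle terms together reach at most
  \<open>max 1 E\<close> times the smaller outer coefficient, which is less.\<close>

lemma polyexp_outer_barrier:
  assumes m: "1 \<le> m" and l: "l \<in> param_space m" and w: "polyexp a m w l = 0"
    and a: "a 0 \<noteq> 0" "a m \<noteq> 0"
    and dom: "(\<Sum>i=1..<m. \<bar>a i\<bar>) \<le> \<bar>a 0\<bar>" "(\<Sum>i=1..<m. \<bar>a i\<bar>) \<le> \<bar>a m\<bar>"
  shows "cos (l m * Im w) \<noteq> sgn (a 0 * a m)"
proof
  assume c: "cos (l m * Im w) = sgn (a 0 * a m)"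
  define E where "E = exp (l m * Re w)"
  define M where "M = (\<Sum>i=1..<m. of_real (a i) * exp (of_real (l i) * w))"
  have "norm (of_real (a 0) + of_real (a m) * exp (of_real (l m) * w)) = \<bar>a 0\<bar> + \<bar>a m\<bar> * E"
    unfolding exp_real_mult E_def using a c by (intro norm_add_aligned) auto
  moreover have "of_real (a 0) + of_real (a m) * exp (of_real (l m) * w) = - M"
    using w unfolding polyexp_split[OF m] M_def by (simp add: eq_neg_iff_add_eq_0 add_ac)
  ultimately have "\<bar>a 0\<bar> + \<bar>a m\<bar> * E = norm M" by (simp only: norm_minus_cancel)
  also have "\<dots> \<le> (\<Sum>i=1..<m. \<bar>a i\<bar> * max 1 E)"
    unfolding M_def
  proof (rule sum_norm_le)
    fix i assume i: "i \<in> {1..<m}"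
    have "exp (l i * Re w) \<le> max 1 E"
    proof (cases "0 \<le> Re w")
      case True
      then have "l i * Re w \<le> l m * Re w" using param_spaceD(2)[OF l i] by (intro mult_right_mono) auto
      then show ?thesis by (simp add: E_def le_max_iff_disj)
    next
      case False
      then have "l i * Re w \<le> 0" using param_spaceD(1)[OF l, of i] i by (intro mult_nonneg_nonpos) auto
      then show ?thesis by (simp add: le_max_iff_disj)
    qed
    then show "norm (of_real (a i) * exp (of_real (l i) * w)) \<le> \<bar>a i\<bar> * max 1 E"
      by (simp add: exp_real_mult norm_mult mult_left_mono)
  qed
  also have "\<dots> = (\<Sum>i=1..<m. \<bar>a i\<bar>) * max 1 E" by (simp add: sum_distrib_right)
  also have "\<dots> < \<bar>a 0\<bar> + \<bar>a m\<bar> * E"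
  proof (cases "E \<le> 1")
    case True
    have "0 < \<bar>a m\<bar> * E" using a by (simp add: E_def)
    then show ?thesis using True dom by simp
  next
    case False
    have "(\<Sum>i=1..<m. \<bar>a i\<bar>) * E \<le> \<bar>a m\<bar> * E" using dom by (intro mult_right_mono) (auto simp: E_def)
    moreover have "max 1 E = E" "0 < \<bar>a 0\<bar>" using False a by auto
    ultimately show ?thesis by linarith
  qed
  finally show False by simp
qed

text \<open>In the closed left half-plane all exponentials are at most 1, and the m-th is at most E,
  the modulus of the k-th. Aligned terms 0 and k would therefore outweigh the rest:
  \<open>a 0\<close> covers the other middle terms and \<open>a k * E\<close> strictly covers the
  last one.\<close>

lemma polyexp_inner_barrier:
  assumes m: "1 \<le> m" and l: "l \<in> param_space m" and w: "polyexp a m w l = 0" "Re w \<le> 0"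
    and a: "a 0 \<noteq> 0" "a m \<noteq> 0" and k: "k \<in> {1..<m}"
    and dom: "\<bar>a 0\<bar> + \<bar>a m\<bar> + (\<Sum>i\<in>{1..<m} - {k}. \<bar>a i\<bar>) \<le> \<bar>a k\<bar>"
      "(\<Sum>i\<in>{1..<m} - {k}. \<bar>a i\<bar>) \<le> \<bar>a 0\<bar>"
  shows "cos (l k * Im w) \<noteq> sgn (a 0 * a k)"
proof
  assume c: "cos (l k * Im w) = sgn (a 0 * a k)"
  have "0 \<le> (\<Sum>i\<in>{1..<m} - {k}. \<bar>a i\<bar>)" by (intro sum_nonneg) auto
  moreover have "0 < \<bar>a 0\<bar>" "0 < \<bar>a m\<bar>" using a by auto
  ultimately have ak: "\<bar>a m\<bar> < \<bar>a k\<bar>" "a k \<noteq> 0" using dom(1) by linarith+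
  define E where "E = exp (l k * Re w)"
  define M where "M = (\<Sum>i\<in>{1..<m} - {k}. of_real (a i) * exp (of_real (l i) * w))"
  have "norm (of_real (a 0) + of_real (a k) * exp (of_real (l k) * w)) = \<bar>a 0\<bar> + \<bar>a k\<bar> * E"
    unfolding exp_real_mult E_def using a ak c by (intro norm_add_aligned) auto
  moreover have "of_real (a 0) + of_real (a k) * exp (of_real (l k) * w) = - (M + of_real (a m) * exp (of_real (l m) * w))"
    using w(1) unfolding polyexp_split_at[OF m k] M_def eq_neg_iff_add_eq_0 .
  ultimately have "\<bar>a 0\<bar> + \<bar>a k\<bar> * E = norm (M + of_real (a m) * exp (of_real (l m) * w))"
    by (simp only: norm_minus_cancel)
  also have "\<dots> \<le> (\<Sum>i\<in>{1..<m} - {k}. \<bar>a i\<bar>) + \<bar>a m\<bar> * E"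
  proof (intro norm_triangle_le add_mono)
    show "norm M \<le> (\<Sum>i\<in>{1..<m} - {k}. \<bar>a i\<bar>)"
      unfolding M_def
    proof (rule sum_norm_le)
      fix i assume i: "i \<in> {1..<m} - {k}"
      have "l i * Re w \<le> 0" using param_spaceD(1)[OF l, of i] i w by (intro mult_nonneg_nonpos) auto
      then show "norm (of_real (a i) * exp (of_real (l i) * w)) \<le> \<bar>a i\<bar>"
        by (simp add: exp_real_mult norm_mult mult_left_le)
    qed
    have "l m * Re w \<le> l k * Re w" using param_spaceD(2)[OF l k] w by (intro mult_right_mono_neg) auto
    then show "norm (of_real (a m) * exp (of_real (l m) * w)) \<le> \<bar>a m\<bar> * E"
      by (simp add: exp_real_mult norm_mult mult_left_mono E_def)
  qed
  also have "\<dots> < \<bar>a 0\<bar> + \<bar>a k\<bar> * E"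
    using dom ak by (intro add_le_less_mono) (auto simp: E_def)
  finally show False by simp
qed

text \<open>On the imaginary axis all exponentials have modulus 1, so the dominance of
  \<open>a k\<close> leaves no slack in the triangle inequality: after rotation by the phase of the
  k-th term every other non-zero term must point opposite to \<open>a k\<close>.\<close>

lemma polyexp_imaginary_zero:
  assumes m: "1 \<le> m" and w: "polyexp a m w l = 0" "Re w = 0" and k: "k \<in> {1..<m}"
    and a: "a 0 \<noteq> 0" "a m \<noteq> 0"
    and dom: "\<bar>a 0\<bar> + \<bar>a m\<bar> + (\<Sum>i\<in>{1..<m} - {k}. \<bar>a i\<bar>) \<le> \<bar>a k\<bar>"
  shows "cos (l k * Im w) = - sgn (a 0 * a k)" "cos ((l m - l k) * Im w) = - sgn (a k * a m)"
    "\<And>i. i \<in> {1..<m} - {k} \<Longrightarrow> a i \<noteq> 0 \<Longrightarrow> sin ((l i - l k) * Im w) = 0"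
proof -
  define T where "T = Im w"
  \<comment> \<open>The slack of a term of coefficient x and relative angle t: it is non-negative
    and vanishes only if the term is opposite to \<open>a k\<close>. The real part of the equation
    shows that the slacks sum to at most 0.\<close>
  define d where "d x t = \<bar>x\<bar> + sgn (a k) * x * cos t" for x t :: real
  have "0 \<le> (\<Sum>i\<in>{1..<m} - {k}. \<bar>a i\<bar>)" by (intro sum_nonneg) auto
  moreover have "0 < \<bar>a 0\<bar>" "0 < \<bar>a m\<bar>" using a by auto
  ultimately have ak: "a k \<noteq> 0" using dom by linarith
  have d0: "0 \<le> d x t" for x t
  proof -
    have "\<bar>sgn (a k) * x * cos t\<bar> \<le> \<bar>x\<bar>"
      using ak abs_cos_le_one[of t] by (simp add: abs_mult mult_left_le)
    then show ?thesis unfolding d_def by linarith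
  qed
  have dz: "cos t = - sgn (a k * x)" if "d x t = 0" "x \<noteq> 0" for x t
  proof -
    have "\<bar>x\<bar> + sgn (a k) * (sgn x * \<bar>x\<bar>) * cos t = 0" using that(1) unfolding d_def sgn_mult_abs .
    then have "\<bar>x\<bar> * (1 + sgn (a k * x) * cos t) = 0" by (simp add: sgn_mult algebra_simps)
    then have "1 + sgn (a k * x) * cos t = 0" using that(2) by simp
    moreover have "sgn (a k * x) = 1 \<or> sgn (a k * x) = -1" using ak that(2) by (auto simp: sgn_if)
    ultimately show ?thesis by auto
  qed
  have "cis (- (l k * T)) * polyexp a m w l = 0" using w by simp
  then have "Re (cis (- (l k * T)) * polyexp a m w l) = 0" by simp
  moreover have "cis (- (l k * T)) * polyexp a m w l = of_real (a 0) * cis (- (l k * T))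
      + (\<Sum>i\<in>{1..<m} - {k}. of_real (a i) * cis ((l i - l k) * T)) + of_real (a k) + of_real (a m) * cis ((l m - l k) * T)"
  proof -
    have e: "exp (of_real x * w) = cis (x * T)" for x
      using w(2) by (simp add: exp_real_mult T_def)
    have c: "cis (- (l k * T)) * (of_real x * cis (y * T)) = of_real x * cis ((y - l k) * T)" for x y
      by (simp add: cis_mult algebra_simps)
    have c0: "cis (- (l k * T)) * of_real x = of_real x * cis (- (l k * T))" for x
      by (rule mult.commute)
    show ?thesis
      unfolding polyexp_split_at[OF m k] e distrib_left sum_distrib_left c c0
      by (simp only: diff_self mult_zero_left cis_zero mult_1_right add_ac)
  qed
  ultimately have "a 0 * cos (l k * T) + (\<Sum>i\<in>{1..<m} - {k}. a i * cos ((l i - l k) * T)) + a k + a m * cos ((l m - l k) * T) = 0"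
    by simp
  then have "sgn (a k) * (a 0 * cos (l k * T) + (\<Sum>i\<in>{1..<m} - {k}. a i * cos ((l i - l k) * T)) + a k + a m * cos ((l m - l k) * T)) = 0"
    by simp
  then have "sgn (a k) * a 0 * cos (l k * T) + (\<Sum>i\<in>{1..<m} - {k}. sgn (a k) * a i * cos ((l i - l k) * T)) + \<bar>a k\<bar> + sgn (a k) * a m * cos ((l m - l k) * T) = 0"
    by (simp only: distrib_left sum_distrib_left mult.assoc abs_sgn mult.commute[of "a k" "sgn (a k)"])
  then have "d (a 0) (l k * T) + (\<Sum>i\<in>{1..<m} - {k}. d (a i) ((l i - l k) * T)) + d (a m) ((l m - l k) * T) \<le> 0"
    using dom by (simp add: d_def sum.distrib)
  moreover have s0: "0 \<le> (\<Sum>i\<in>{1..<m} - {k}. d (a i) ((l i - l k) * T))" by (intro sum_nonneg d0)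
  ultimately have z: "d (a 0) (l k * T) = 0" "d (a m) ((l m - l k) * T) = 0"
      "(\<Sum>i\<in>{1..<m} - {k}. d (a i) ((l i - l k) * T)) = 0"
    using d0[of "a 0" "l k * T"] d0[of "a m" "(l m - l k) * T"] by linarith+
  show "cos (l k * Im w) = - sgn (a 0 * a k)" "cos ((l m - l k) * Im w) = - sgn (a k * a m)"
    using dz[OF z(1) a(1)] dz[OF z(2) a(2)] by (simp_all add: T_def mult.commute)
  fix i assume i: "i \<in> {1..<m} - {k}" "a i \<noteq> 0"
  have "d (a i) ((l i - l k) * T) = 0"
    using z(3) i(1) d0 by (subst (asm) sum_nonneg_eq_0_iff) auto
  then have "cos ((l i - l k) * T) = - sgn (a k * a i)" using dz i by blast
  moreover have "\<bar>sgn (a k * a i)\<bar> = 1" using ak i by (simp add: abs_mult sgn_mult)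
  ultimately have "(cos ((l i - l k) * T))\<^sup>2 = 1" by (metis abs_minus_cancel power2_abs power_one)
  then show "sin ((l i - l k) * Im w) = 0" using sin_cos_squared_add[of "(l i - l k) * T"] by (simp add: T_def)
qed

section \<open>Three terms\<close>

text \<open>Convexity of exp between 0 and x: the tangent at \<open>t * x\<close>, evaluated at x
  and at 0, is weighted with t and 1 - t.\<close>

lemma exp_convex_combination:
  fixes t x :: real
  assumes "0 \<le> t" "t \<le> 1" shows "exp (t * x) \<le> t * exp x + (1 - t)"
proof -
  have "exp (t * x) * (1 + (1 - t) * x) \<le> exp (t * x) * exp ((1 - t) * x)"
    by (intro mult_left_mono exp_ge_add_one_self) auto
  then have 1: "exp (t * x) * (1 + (1 - t) * x) \<le> exp x"
    by (simp add: algebra_simps flip: exp_add)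
  have "exp (t * x) * (1 + (- t) * x) \<le> exp (t * x) * exp (- t * x)"
    by (intro mult_left_mono exp_ge_add_one_self) auto
  then have 2: "exp (t * x) * (1 - t * x) \<le> 1" by (simp flip: exp_add)
  have "t * (exp (t * x) * (1 + (1 - t) * x)) + (1 - t) * (exp (t * x) * (1 - t * x)) \<le> t * exp x + (1 - t) * 1"
    using assms by (intro add_mono mult_left_mono 1 2) auto
  then show ?thesis by (simp add: algebra_simps)
qed

lemma connected_avoid_cases:
  fixes h :: "'a::topological_space \<Rightarrow> real"
  assumes "connected X" "continuous_on X h" "\<And>x. x \<in> X \<Longrightarrow> h x \<noteq> r"
  shows "(\<forall>x\<in>X. h x < r) \<or> (\<forall>x\<in>X. r < h x)"
proof (rule ccontr)
  assume "\<not> ?thesis"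
  then obtain x y where "x \<in> X" "y \<in> X" "r \<le> h x" "h y \<le> r" by force
  then have "r \<in> h ` X"
    using connectedD_interval[OF connected_continuous_image[OF assms(2,1)], of "h y" "h x" r] by auto
  then show False using assms(3) by auto
qed

lemma sgn_mult_cases: "x \<noteq> 0 \<Longrightarrow> y \<noteq> 0 \<Longrightarrow> sgn (x * y) = 1 \<or> sgn (x * y) = (-1 :: real)"
  by (simp add: sgn_if)

text \<open>The case of one non-zero middle coefficient, normalised to \<open>l m = 1\<close>: t is
  the middle exponent and \<open>\<phi>\<close> a continuous root along the interval of all
  admissible t.\<close>

context
  fixes a b c :: real and \<phi> :: "real \<Rightarrow> complex"
  assumes nz: "a \<noteq> 0" "b \<noteq> 0" "c \<noteq> 0"
    and cont: "continuous_on {0<..<1} \<phi>"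
    and eq: "\<And>t. t \<in> {0<..<1} \<Longrightarrow> of_real a + of_real b * exp (of_real t * \<phi> t) + of_real c * exp (\<phi> t) = 0"
begin

lemma trinomial_exp: "exp (\<phi> t) = of_real (exp (Re (\<phi> t))) * cis (Im (\<phi> t))"
  by (simp add: exp_eq_polar)

lemma trinomial_barrier:
  assumes X: "X = {u<..<v}" "0 \<le> u" "v \<le> 1" and r: "continuous_on X f" "A \<noteq> 0" "B \<noteq> 0"
    and ne: "\<And>t. t \<in> X \<Longrightarrow> cos (f t * Im (\<phi> t)) \<noteq> sgn (A * B)"
  shows "\<exists>C. \<forall>t\<in>X. \<bar>f t * Im (\<phi> t)\<bar> \<le> C"
proof (rule cos_barrier[where s="sgn (A * B)"])
  have "continuous_on X \<phi>" using X by (intro continuous_on_subset[OF cont]) auto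
  then show "continuous_on X (\<lambda>t. f t * Im (\<phi> t))" using r by (intro continuous_intros)
qed (use X sgn_mult_cases[OF r(2,3)] ne in auto)

text \<open>When three terms sum to 0, the moduli of two aligned ones add up to the third; this is
  applied to each of the three pairs. The last two parts are the reverse triangle
  inequality.\<close>

lemma trinomial_norms:
  assumes t: "t \<in> {0<..<1}"
  shows "cos (Im (\<phi> t)) = sgn (a * c) \<Longrightarrow> \<bar>a\<bar> + \<bar>c\<bar> * exp (Re (\<phi> t)) = \<bar>b\<bar> * exp (t * Re (\<phi> t))"
    "cos (t * Im (\<phi> t)) = sgn (a * b) \<Longrightarrow> \<bar>a\<bar> + \<bar>b\<bar> * exp (t * Re (\<phi> t)) = \<bar>c\<bar> * exp (Re (\<phi> t))"
    "cos ((1 - t) * Im (\<phi> t)) = sgn (b * c) \<Longrightarrow>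
      exp (t * Re (\<phi> t)) * (\<bar>b\<bar> + \<bar>c\<bar> * exp ((1 - t) * Re (\<phi> t))) = \<bar>a\<bar>"
    "\<bar>\<bar>b\<bar> * exp (t * Re (\<phi> t)) - \<bar>a\<bar>\<bar> \<le> \<bar>c\<bar> * exp (Re (\<phi> t))"
    "\<bar>\<bar>b\<bar> * exp (t * Re (\<phi> t)) - \<bar>c\<bar> * exp (Re (\<phi> t))\<bar> \<le> \<bar>a\<bar>"
proof -
  let ?x = "Re (\<phi> t)" and ?A = "of_real a :: complex"
    and ?B = "of_real b * exp (of_real t * \<phi> t)" and ?C = "of_real c * exp (\<phi> t)"
  have nB: "norm ?B = \<bar>b\<bar> * exp (t * ?x)" "norm ?C = \<bar>c\<bar> * exp ?x" "norm ?A = \<bar>a\<bar>"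
    by (simp_all add: norm_mult)
  have e: "?A + ?C = - ?B" "?A + ?B = - ?C" "?B + ?C = - ?A"
    using eq[OF t] by (simp_all add: eq_neg_iff_add_eq_0 add_ac)
  show "\<bar>a\<bar> + \<bar>c\<bar> * exp ?x = \<bar>b\<bar> * exp (t * ?x)" if "cos (Im (\<phi> t)) = sgn (a * c)"
    using norm_add_aligned[OF nz(1,3) that, of "exp ?x"] e(1) nB unfolding trinomial_exp by (simp add: norm_minus_cancel)
  show "\<bar>a\<bar> + \<bar>b\<bar> * exp (t * ?x) = \<bar>c\<bar> * exp ?x" if "cos (t * Im (\<phi> t)) = sgn (a * b)"
    using norm_add_aligned[OF nz(1,2) that, of "exp (t * ?x)"] e(2) nB unfolding exp_real_mult by (simp add: norm_minus_cancel)
  have "exp (\<phi> t) = exp (of_real t * \<phi> t) * exp (of_real (1 - t) * \<phi> t)"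
    by (simp add: algebra_simps flip: exp_add)
  then have f: "?B + ?C = exp (of_real t * \<phi> t) * (of_real b + of_real c * exp (of_real (1 - t) * \<phi> t))"
    by (simp add: algebra_simps)
  show "exp (t * ?x) * (\<bar>b\<bar> + \<bar>c\<bar> * exp ((1 - t) * ?x)) = \<bar>a\<bar>" if c: "cos ((1 - t) * Im (\<phi> t)) = sgn (b * c)"
  proof -
    have "norm (of_real b + of_real c * exp (of_real (1 - t) * \<phi> t)) = \<bar>b\<bar> + \<bar>c\<bar> * exp ((1 - t) * ?x)"
      unfolding exp_real_mult using norm_add_aligned[OF nz(2,3) c, of "exp ((1 - t) * ?x)"] by simp
    moreover have "norm (?B + ?C) = \<bar>a\<bar>" unfolding e(3) by simp
    ultimately show ?thesis unfolding f norm_mult by simp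
  qed
  show "\<bar>\<bar>b\<bar> * exp (t * ?x) - \<bar>a\<bar>\<bar> \<le> \<bar>c\<bar> * exp ?x"
    using norm_triangle_ineq3[of ?B "- ?A"] e(2) unfolding nB[symmetric] by (simp add: add.commute)
  show "\<bar>\<bar>b\<bar> * exp (t * ?x) - \<bar>c\<bar> * exp ?x\<bar> \<le> \<bar>a\<bar>"
    using norm_triangle_ineq3[of ?B "- ?C"] e(3) unfolding nB[symmetric] by simp
qed

text \<open>If \<open>\<bar>b\<bar> \<le> \<bar>a\<bar>\<close>, convexity of exp forbids alignment
  of the outer terms for small t. If b is larger, the values of \<open>t * Re (\<phi> t)\<close>
  split at \<open>- \<rho>\<close>, which is not attained because there the last term is too small
  to balance the other two. Below \<open>- \<rho>\<close> the last term stays negligible, and the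
  first two cannot be aligned; above it the middle term alone exceeds \<open>\<bar>a\<bar>\<close>,
  and the last two cannot be aligned. By connectedness the root stays on one side.\<close>

lemma trinomial_bound_near_0:
  "\<exists>t0 C. 0 < t0 \<and> t0 \<le> 1 \<and> (\<forall>t\<in>{0<..<t0}. t * \<bar>Im (\<phi> t)\<bar> \<le> C)"
proof (cases "\<bar>b\<bar> \<le> \<bar>a\<bar>")
  case True
  define t0 where "t0 = min 1 (\<bar>c\<bar> / \<bar>a\<bar>)"
  have t0: "0 < t0" "t0 \<le> 1" "t0 \<le> \<bar>c\<bar> / \<bar>a\<bar>" using nz by (auto simp: t0_def)
  have "\<exists>C. \<forall>t\<in>{0<..<t0}. \<bar>1 * Im (\<phi> t)\<bar> \<le> C"
  proof (rule trinomial_barrier[where A=a and B=c and u=0 and v=t0])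
    fix t assume t: "t \<in> {0<..<t0}"
    show "cos (1 * Im (\<phi> t)) \<noteq> sgn (a * c)"
    proof
      assume "cos (1 * Im (\<phi> t)) = sgn (a * c)"
      then have "\<bar>a\<bar> + \<bar>c\<bar> * exp (Re (\<phi> t)) = \<bar>b\<bar> * exp (t * Re (\<phi> t))"
        using trinomial_norms(1)[of t] t t0 by simp
      also have "\<dots> \<le> \<bar>a\<bar> * exp (t * Re (\<phi> t))" using True by simp
      also have "\<dots> \<le> \<bar>a\<bar> * (t * exp (Re (\<phi> t)) + (1 - t))"
        using exp_convex_combination[of t "Re (\<phi> t)"] t t0 by (intro mult_left_mono) auto
      also have "\<dots> = (\<bar>a\<bar> * t) * exp (Re (\<phi> t)) + \<bar>a\<bar> * (1 - t)" by (simp add: algebra_simps)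
      also have "\<dots> < \<bar>c\<bar> * exp (Re (\<phi> t)) + \<bar>a\<bar>"
      proof (rule add_less_le_mono)
        have "t < \<bar>c\<bar> / \<bar>a\<bar>" using t t0 by simp
        then have "\<bar>a\<bar> * t < \<bar>c\<bar>" using nz by (simp add: field_simps)
        then show "\<bar>a\<bar> * t * exp (Re (\<phi> t)) < \<bar>c\<bar> * exp (Re (\<phi> t))" by simp
        show "\<bar>a\<bar> * (1 - t) \<le> \<bar>a\<bar>" using t t0 by (simp add: mult_left_le)
      qed
      finally show False by simp
    qed
  qed (use t0 nz in auto)
  then obtain C where C: "\<forall>t\<in>{0<..<t0}. \<bar>1 * Im (\<phi> t)\<bar> \<le> C" by blast
  have "t * \<bar>Im (\<phi> t)\<bar> \<le> C" if t: "t \<in> {0<..<t0}" for t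
  proof -
    have "t * \<bar>Im (\<phi> t)\<bar> \<le> 1 * \<bar>Im (\<phi> t)\<bar>" using t t0 by (intro mult_right_mono) auto
    then show ?thesis using bspec[OF C t] by simp
  qed
  then show ?thesis using t0 by blast
next
  case False
  \<comment> \<open>\<open>- \<rho>\<close> is half of the logarithm of
    \<open>\<bar>a\<bar> / \<bar>b\<bar>\<close>, so that at
    \<open>t * Re (\<phi> t) = - \<rho>\<close> the middle term still strictly exceeds
    \<open>\<bar>a\<bar>\<close>.\<close>
  define e where "e = sqrt (\<bar>a\<bar> / \<bar>b\<bar>)"
  define \<rho> where "\<rho> = - ln e"
  have e: "0 < e" "e < 1" "\<bar>b\<bar> * e\<^sup>2 = \<bar>a\<bar>" using nz False by (auto simp: e_def)
  have rho: "0 < \<rho>" "exp (- \<rho>) = e" using e by (auto simp: \<rho>_def)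
  have be: "\<bar>a\<bar> < \<bar>b\<bar> * e"
  proof -
    have "\<bar>a\<bar> = (\<bar>b\<bar> * e) * e" using e(3) by (simp add: power2_eq_square)
    also have "\<dots> < (\<bar>b\<bar> * e) * 1" using e nz by (intro mult_strict_left_mono) auto
    finally show ?thesis by simp
  qed
  define \<eta> where "\<eta> = min (\<bar>b\<bar> * e - \<bar>a\<bar>) \<bar>a\<bar>"
  have eta: "0 < \<eta>" "\<eta> \<le> \<bar>b\<bar> * e - \<bar>a\<bar>" "\<eta> \<le> \<bar>a\<bar>" using be nz by (auto simp: \<eta>_def)
  \<comment> \<open>\<open>exp (- \<rho> / t) < t / \<rho>\<close> makes the last term smaller than
    \<open>\<eta>\<close> below this bound; 1/2 ensures \<open>t \<le> 1 - t\<close>.\<close>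
  define t0 where "t0 = min (1 / 2) (\<eta> * \<rho> / \<bar>c\<bar>)"
  have t0: "0 < t0" "t0 \<le> 1 / 2" "t0 \<le> \<eta> * \<rho> / \<bar>c\<bar>"
    unfolding t0_def by (rule min.cobounded1 min.cobounded2 | use nz eta rho in simp)+
  have small: "\<bar>c\<bar> * exp (Re (\<phi> t)) < \<eta>" if t: "t \<in> {0<..<t0}" and tx: "t * Re (\<phi> t) \<le> - \<rho>" for t
  proof -
    have "Re (\<phi> t) \<le> - (\<rho> / t)" using t tx by (simp add: field_simps)
    then have "exp (Re (\<phi> t)) \<le> exp (- (\<rho> / t))" by simp
    also have "\<dots> < t / \<rho>"
    proof -
      have "\<rho> / t < exp (\<rho> / t)" using exp_gt_self[of "\<rho> / t"] by simp
      then show ?thesis using t rho by (simp add: exp_minus field_simps)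
    qed
    finally have "\<bar>c\<bar> * exp (Re (\<phi> t)) < \<bar>c\<bar> * (t / \<rho>)"
      using nz by (intro mult_strict_left_mono) auto
    also have "\<dots> \<le> \<eta>"
    proof -
      have "t \<le> \<eta> * \<rho> / \<bar>c\<bar>" using t t0 by simp
      then show ?thesis using nz rho by (simp add: field_simps)
    qed
    finally show ?thesis .
  qed
  have ne: "t * Re (\<phi> t) \<noteq> - \<rho>" if t: "t \<in> {0<..<t0}" for t
  proof
    assume tx: "t * Re (\<phi> t) = - \<rho>"
    then have "\<bar>b\<bar> * e - \<bar>a\<bar> \<le> \<bar>c\<bar> * exp (Re (\<phi> t))"
      using trinomial_norms(4)[of t] t t0 rho by simp
    then show False using small[OF t] tx eta by simp
  qed
  have "continuous_on {0<..<t0} (\<lambda>t. t * Re (\<phi> t))"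
    using t0 by (intro continuous_intros continuous_on_subset[OF cont]) auto
  then consider "\<forall>t\<in>{0<..<t0}. t * Re (\<phi> t) < - \<rho>" | "\<forall>t\<in>{0<..<t0}. - \<rho> < t * Re (\<phi> t)"
    using connected_avoid_cases[of "{0<..<t0}" "\<lambda>t. t * Re (\<phi> t)" "- \<rho>"] ne by auto
  then have "\<exists>C. \<forall>t\<in>{0<..<t0}. t * \<bar>Im (\<phi> t)\<bar> \<le> C"
  proof cases
    case 1
    have "\<exists>C. \<forall>t\<in>{0<..<t0}. \<bar>t * Im (\<phi> t)\<bar> \<le> C"
    proof (rule trinomial_barrier[where A=a and B=b and u=0 and v=t0])
      fix t assume t: "t \<in> {0<..<t0}"
      show "cos (t * Im (\<phi> t)) \<noteq> sgn (a * b)"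
      proof
        assume "cos (t * Im (\<phi> t)) = sgn (a * b)"
        then have "\<bar>a\<bar> + \<bar>b\<bar> * exp (t * Re (\<phi> t)) = \<bar>c\<bar> * exp (Re (\<phi> t))"
          using trinomial_norms(2)[of t] t t0 by simp
        moreover have "0 < \<bar>b\<bar> * exp (t * Re (\<phi> t))" using nz by simp
        moreover have "\<bar>c\<bar> * exp (Re (\<phi> t)) < \<eta>" using small[OF t] 1 t by (simp add: less_imp_le)
        ultimately show False using eta by linarith
      qed
    qed (use t0 nz in auto)
    then show ?thesis using t0 by (auto simp: abs_mult)
  next
    case 2
    have "\<exists>C. \<forall>t\<in>{0<..<t0}. \<bar>(1 - t) * Im (\<phi> t)\<bar> \<le> C"
    proof (rule trinomial_barrier[where A=b and B=c and u=0 and v=t0])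
      fix t assume t: "t \<in> {0<..<t0}"
      show "cos ((1 - t) * Im (\<phi> t)) \<noteq> sgn (b * c)"
      proof
        assume "cos ((1 - t) * Im (\<phi> t)) = sgn (b * c)"
        then have "\<bar>a\<bar> = exp (t * Re (\<phi> t)) * (\<bar>b\<bar> + \<bar>c\<bar> * exp ((1 - t) * Re (\<phi> t)))"
          using trinomial_norms(3)[of t] t t0 by simp
        also have "\<dots> \<ge> e * (\<bar>b\<bar> + 0)"
        proof (rule mult_mono)
          show "e \<le> exp (t * Re (\<phi> t))" using 2 t unfolding rho(2)[symmetric] by (simp add: less_imp_le)
        qed (use e in auto)
        finally show False using be by (simp add: mult.commute)
      qed
    qed (use t0 nz in \<open>auto intro!: continuous_intros\<close>)
    then obtain C where C: "\<forall>t\<in>{0<..<t0}. \<bar>(1 - t) * Im (\<phi> t)\<bar> \<le> C" by blast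
    have "t * \<bar>Im (\<phi> t)\<bar> \<le> C" if t: "t \<in> {0<..<t0}" for t
    proof -
      have "t * \<bar>Im (\<phi> t)\<bar> \<le> (1 - t) * \<bar>Im (\<phi> t)\<bar>" using t t0 by (intro mult_right_mono) auto
      then show ?thesis using bspec[OF C t] t t0 by (simp add: abs_mult)
    qed
    then show ?thesis by blast
  qed
  moreover have "t0 \<le> 1" using t0 by simp
  ultimately show ?thesis using t0(1) by blast
qed

text \<open>The counterpart at the other end, with c in the role of a. For
  \<open>\<bar>c\<bar> < \<bar>b\<bar>\<close> the value
  \<open>(1 - t) * Re (\<phi> t) = \<rho>\<close> is excluded, since the difference of the last two
  terms would grow at least like \<open>1 / (1 - t)\<close> and exceed \<open>\<bar>a\<bar>\<close>.
  Below \<open>\<rho>\<close> the middle term is at least as large as the last, so it cannot be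
  aligned with the first; above \<open>\<rho>\<close> the root lies in the right half-plane and
  nothing is claimed.\<close>

lemma trinomial_bound_near_1:
  "\<exists>t1 C. 0 \<le> t1 \<and> t1 < 1 \<and> (\<forall>t\<in>{t1<..<1}. Re (\<phi> t) < 0 \<longrightarrow> t * \<bar>Im (\<phi> t)\<bar> \<le> C)"
proof (cases "\<bar>b\<bar> \<le> \<bar>c\<bar>")
  case True
  define t1 where "t1 = max 0 (1 - \<bar>a\<bar> / \<bar>c\<bar>)"
  have t1: "0 \<le> t1" "t1 < 1" "1 - \<bar>a\<bar> / \<bar>c\<bar> \<le> t1" using nz by (auto simp: t1_def)
  have "\<exists>C. \<forall>t\<in>{t1<..<1}. \<bar>1 * Im (\<phi> t)\<bar> \<le> C"
  proof (rule trinomial_barrier[where A=a and B=c])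
    fix t assume t: "t \<in> {t1<..<1}"
    show "cos (1 * Im (\<phi> t)) \<noteq> sgn (a * c)"
    proof
      assume "cos (1 * Im (\<phi> t)) = sgn (a * c)"
      then have "\<bar>a\<bar> + \<bar>c\<bar> * exp (Re (\<phi> t)) = \<bar>b\<bar> * exp (t * Re (\<phi> t))"
        using trinomial_norms(1)[of t] t t1 by simp
      also have "\<dots> \<le> \<bar>c\<bar> * exp (t * Re (\<phi> t))" using True by simp
      also have "\<dots> \<le> \<bar>c\<bar> * (t * exp (Re (\<phi> t)) + (1 - t))"
        using exp_convex_combination[of t "Re (\<phi> t)"] t t1 by (intro mult_left_mono) auto
      also have "\<dots> = (\<bar>c\<bar> * t) * exp (Re (\<phi> t)) + \<bar>c\<bar> * (1 - t)" by (simp add: algebra_simps)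
      also have "\<dots> < \<bar>c\<bar> * exp (Re (\<phi> t)) + \<bar>a\<bar>"
      proof (rule add_le_less_mono)
        have "1 - t < \<bar>a\<bar> / \<bar>c\<bar>" using t t1 by simp
        then show "\<bar>c\<bar> * (1 - t) < \<bar>a\<bar>" using nz by (simp add: field_simps)
        have "\<bar>c\<bar> * t \<le> \<bar>c\<bar>" using t t1 by (simp add: mult_left_le)
        then show "\<bar>c\<bar> * t * exp (Re (\<phi> t)) \<le> \<bar>c\<bar> * exp (Re (\<phi> t))" by (intro mult_right_mono) auto
      qed
      finally show False by simp
    qed
  qed (use t1 nz in auto)
  then obtain C where C: "\<forall>t\<in>{t1<..<1}. \<bar>1 * Im (\<phi> t)\<bar> \<le> C" by blast
  have "t * \<bar>Im (\<phi> t)\<bar> \<le> C" if t: "t \<in> {t1<..<1}" for t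
  proof -
    have "t * \<bar>Im (\<phi> t)\<bar> \<le> 1 * \<bar>Im (\<phi> t)\<bar>" using t by (intro mult_right_mono) auto
    then show ?thesis using bspec[OF C t] by simp
  qed
  then show ?thesis using t1 by blast
next
  case False
  define e where "e = sqrt (\<bar>c\<bar> / \<bar>b\<bar>)"
  define \<rho> where "\<rho> = - ln e"
  have e: "0 < e" "e < 1" "\<bar>b\<bar> * e\<^sup>2 = \<bar>c\<bar>" using nz False by (auto simp: e_def)
  have rho: "0 < \<rho>" "exp (- \<rho>) = e" using e by (auto simp: \<rho>_def)
  have be: "\<bar>c\<bar> < \<bar>b\<bar> * e"
  proof -
    have "\<bar>c\<bar> = (\<bar>b\<bar> * e) * e" using e(3) by (simp add: power2_eq_square)
    also have "\<dots> < (\<bar>b\<bar> * e) * 1" using e nz by (intro mult_strict_left_mono) auto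
    finally show ?thesis by simp
  qed
  define \<eta> where "\<eta> = \<bar>b\<bar> * e - \<bar>c\<bar>"
  have eta: "0 < \<eta>" using be by (simp add: \<eta>_def)
  define t1 where "t1 = max 0 (1 - \<eta> * \<rho> / \<bar>a\<bar>)"
  have t1: "0 \<le> t1" "t1 < 1" "1 - \<eta> * \<rho> / \<bar>a\<bar> \<le> t1" using nz eta rho by (auto simp: t1_def)
  have split: "exp (t * Re (\<phi> t)) = exp (- ((1 - t) * Re (\<phi> t))) * exp (Re (\<phi> t))" for t
    by (simp add: algebra_simps flip: exp_add)
  have ne: "(1 - t) * Re (\<phi> t) \<noteq> \<rho>" if t: "t \<in> {t1<..<1}" for t
  proof
    assume tx: "(1 - t) * Re (\<phi> t) = \<rho>"
    have "(\<bar>b\<bar> * e - \<bar>c\<bar>) * exp (Re (\<phi> t)) \<le> \<bar>a\<bar>"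
      using trinomial_norms(5)[of t] t t1 rho unfolding split tx by (simp add: algebra_simps)
    moreover have "\<rho> / (1 - t) < exp (Re (\<phi> t))"
    proof -
      have "Re (\<phi> t) = \<rho> / (1 - t)" using tx t by (simp add: field_simps)
      then show ?thesis using exp_gt_self[of "Re (\<phi> t)"] by simp
    qed
    ultimately have "\<eta> * (\<rho> / (1 - t)) < \<bar>a\<bar>"
      using eta unfolding \<eta>_def[symmetric] by (meson less_le_trans mult_strict_left_mono)
    moreover have "1 - t < \<eta> * \<rho> / \<bar>a\<bar>" using t t1 by simp
    ultimately show False using t nz by (simp add: field_simps)
  qed
  have "continuous_on {t1<..<1} (\<lambda>t. (1 - t) * Re (\<phi> t))"
    using t1 by (intro continuous_intros continuous_on_subset[OF cont]) auto
  then consider "\<forall>t\<in>{t1<..<1}. (1 - t) * Re (\<phi> t) < \<rho>" | "\<forall>t\<in>{t1<..<1}. \<rho> < (1 - t) * Re (\<phi> t)"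
    using connected_avoid_cases[of "{t1<..<1}" "\<lambda>t. (1 - t) * Re (\<phi> t)" \<rho>] ne by auto
  then have "\<exists>C. \<forall>t\<in>{t1<..<1}. Re (\<phi> t) < 0 \<longrightarrow> t * \<bar>Im (\<phi> t)\<bar> \<le> C"
  proof cases
    case 1
    have "\<exists>C. \<forall>t\<in>{t1<..<1}. \<bar>t * Im (\<phi> t)\<bar> \<le> C"
    proof (rule trinomial_barrier[where A=a and B=b])
      fix t assume t: "t \<in> {t1<..<1}"
      show "cos (t * Im (\<phi> t)) \<noteq> sgn (a * b)"
      proof
        assume "cos (t * Im (\<phi> t)) = sgn (a * b)"
        then have "\<bar>a\<bar> + \<bar>b\<bar> * exp (t * Re (\<phi> t)) = \<bar>c\<bar> * exp (Re (\<phi> t))"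
          using trinomial_norms(2)[of t] t t1 by simp
        moreover have "\<bar>c\<bar> * exp (Re (\<phi> t)) \<le> \<bar>b\<bar> * exp (t * Re (\<phi> t))"
        proof -
          have "exp (- \<rho>) \<le> exp (- ((1 - t) * Re (\<phi> t)))" using 1 t by (simp add: less_imp_le)
          then have "\<bar>b\<bar> * e \<le> \<bar>b\<bar> * exp (- ((1 - t) * Re (\<phi> t)))"
            unfolding rho(2) by (intro mult_left_mono) auto
          then have "\<bar>c\<bar> \<le> \<bar>b\<bar> * exp (- ((1 - t) * Re (\<phi> t)))" using be by linarith
          then have "\<bar>c\<bar> * exp (Re (\<phi> t)) \<le> \<bar>b\<bar> * exp (- ((1 - t) * Re (\<phi> t))) * exp (Re (\<phi> t))"
            by (intro mult_right_mono) auto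
          then show ?thesis unfolding split[of t] by (simp only: mult.assoc)
        qed
        moreover have "0 < \<bar>a\<bar>" using nz by simp
        ultimately show False by linarith
      qed
    qed (use t1 nz in auto)
    then obtain C where C: "\<forall>t\<in>{t1<..<1}. \<bar>t * Im (\<phi> t)\<bar> \<le> C" by blast
    have "t * \<bar>Im (\<phi> t)\<bar> \<le> C" if t: "t \<in> {t1<..<1}" for t
      using C t t1 by (auto simp: abs_mult)
    then show ?thesis by blast
  next
    case 2
    have "\<not> Re (\<phi> t) < 0" if t: "t \<in> {t1<..<1}" for t
    proof
      assume "Re (\<phi> t) < 0"
      then have "(1 - t) * Re (\<phi> t) \<le> 0" using t by (intro mult_nonneg_nonpos) auto
      then show False using 2 t rho by force
    qed
    then show ?thesis by blast
  qed
  then show ?thesis using t1 by blast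
qed

lemma trinomial_left_bound:
  "\<exists>C. \<forall>t\<in>{0<..<1}. Re (\<phi> t) < 0 \<longrightarrow> t * \<bar>Im (\<phi> t)\<bar> \<le> C"
proof -
  obtain t0 C0 where t0: "0 < t0" "t0 \<le> 1" "\<And>t. t \<in> {0<..<t0} \<Longrightarrow> t * \<bar>Im (\<phi> t)\<bar> \<le> C0"
    using trinomial_bound_near_0 by blast
  obtain t1 C1 where t1: "0 \<le> t1" "t1 < 1" "\<And>t. t \<in> {t1<..<1} \<Longrightarrow> Re (\<phi> t) < 0 \<Longrightarrow> t * \<bar>Im (\<phi> t)\<bar> \<le> C1"
    using trinomial_bound_near_1 by blast
  have "continuous_on {t0..t1} (\<lambda>t. t * \<bar>Im (\<phi> t)\<bar>)"
    using t0 t1 by (intro continuous_intros continuous_on_subset[OF cont]) auto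
  then have "compact ((\<lambda>t. t * \<bar>Im (\<phi> t)\<bar>) ` {t0..t1})" by (intro compact_continuous_image) auto
  then obtain C2 where C2: "\<And>t. t \<in> {t0..t1} \<Longrightarrow> t * \<bar>Im (\<phi> t)\<bar> \<le> C2"
    using compact_imp_bounded bounded_real by (metis (no_types, lifting) abs_le_D1 image_eqI)
  have "t * \<bar>Im (\<phi> t)\<bar> \<le> max C0 (max C1 C2)" if t: "t \<in> {0<..<1}" "Re (\<phi> t) < 0" for t
  proof -
    consider "t \<in> {0<..<t0}" | "t \<in> {t1<..<1}" | "t \<in> {t0..t1}" using t by force
    then show ?thesis
      by cases (use t0(3) t1(3) C2 t in \<open>fastforce simp: le_max_iff_disj\<close>)+
  qed
  then show ?thesis by blast
qed

end

section \<open>Boundedness of rescaled roots\<close>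

lemma exists_irrational_quotient:
  fixes x y u v :: real
  assumes "u < v" "0 < y"
  obtains t where "u < t" "t < v" "(x + t) / y \<notin> \<rat>"
proof -
  have "countable ((\<lambda>q. q * y - x) ` \<rat>)" by (intro countable_image countable_rat)
  then have "uncountable ({u<..<v} - (\<lambda>q. q * y - x) ` \<rat>)"
    using assms by (simp add: uncountable_minus_countable uncountable_open_interval)
  then obtain t where t: "t \<in> {u<..<v}" "t \<notin> (\<lambda>q. q * y - x) ` \<rat>"
    by (metis DiffE countable_empty equals0I)
  have "(x + t) / y \<notin> \<rat>"
  proof
    assume "(x + t) / y \<in> \<rat>"
    moreover have "t = (x + t) / y * y - x" using assms by simp
    ultimately show False using t(2) by blast
  qed
  then show thesis using t that by auto
qed

lemma connected_param_ratio:
  "connected {l \<in> param_space m. l k = r * l m}" if "k \<in> {1..m}"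
proof (rule connected_lerp_closed[of _ m])
  fix l l' t assume l: "l \<in> {l \<in> param_space m. l k = r * l m}" "l' \<in> {l \<in> param_space m. l k = r * l m}"
    and t: "0 \<le> t" "t \<le> (1 :: real)"
  have "m \<in> {1..m}" using that by auto
  then have "lerp m l l' t k = r * lerp m l l' t m"
    using l that by (simp add: lerp_def algebra_simps)
  then show "lerp m l l' t \<in> {l \<in> param_space m. l k = r * l m}" using lerp_param_space l t by auto
qed (rule param_space_extensional, simp)

lemma unit_top_param_space:
  assumes "1 \<le> m" "\<And>i. i \<in> {1..<m} \<Longrightarrow> 0 < f i \<and> f i < 1"
  shows "(\<lambda>i\<in>{1..m}. if i = m then 1 else f i) \<in> param_space m" (is "?v \<in> _")
proof (rule param_spaceI)
  fix i assume "i \<in> {1..m}"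
  then show "0 < ?v i" using assms(2)[of i] by (cases "i = m") auto
next
  fix i assume "i \<in> {1..<m}"
  then show "?v i < ?v m" using assms(2)[of i] by auto
qed (simp del: atLeastAtMost_iff)

text \<open>The analogue of the connectedness of the plane without its rational points: slices with
  one fixed irrational ratio are convex and lie in the set, and slices in the two directions
  meet.\<close>

lemma connected_irrational_ratios:
  assumes k: "k \<in> {1..<m}" and j: "j \<in> {1..<m}" "j \<noteq> k"
  shows "connected {l \<in> param_space m. l k / l m \<notin> \<rat> \<or> l j / l m \<notin> \<rat>}" (is "connected ?G")
proof -
  define A where "A r = {l \<in> param_space m. l k = r * l m}" for r
  define B where "B r = {l \<in> param_space m. l j = r * l m}" for r
  \<comment> \<open>A common point of the slices \<open>A r\<close> and \<open>B r'\<close>; the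
    value 1/2 of the remaining middle entries is arbitrary.\<close>
  define v :: "real \<Rightarrow> real \<Rightarrow> nat \<Rightarrow> real" where
    "v r r' = (\<lambda>i\<in>{1..m}. if i = m then 1 else if i = k then r else if i = j then r' else 1 / 2)" for r r'
  have km: "k \<in> {1..m}" "j \<in> {1..m}" "m \<in> {1..m}" "k \<noteq> m" "j \<noteq> m" using k j by auto
  have v: "v r r' \<in> A r \<inter> B r'" if "0 < r" "r < 1" "0 < r'" "r' < 1" for r r'
  proof -
    have "v r r' \<in> param_space m"
      unfolding v_def using that km by (intro unit_top_param_space) auto
    then show ?thesis using km j(2) by (simp add: A_def B_def v_def)
  qed
  have lm: "0 < l m" if "l \<in> param_space m" for l using param_spaceD(1)[OF that km(3)] .
  have AG: "A r \<subseteq> ?G" "B r \<subseteq> ?G" if "r \<notin> \<rat>" for r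
  proof -
    have "r * l m / l m \<notin> \<rat>" if "l \<in> param_space m" for l
      using lm[OF that] \<open>r \<notin> \<rat>\<close> by simp
    then show "A r \<subseteq> ?G" "B r \<subseteq> ?G" by (auto simp: A_def B_def)
  qed
  have conn: "connected (A r)" "connected (B r)" for r
    unfolding A_def B_def using km by (auto intro: connected_param_ratio)
  obtain r0 :: real where r0: "0 < r0" "r0 < 1" "r0 \<notin> \<rat>"
    using exists_irrational_quotient[of 0 1 1 0] by auto
  have ex: "\<exists>T. connected T \<and> T \<subseteq> ?G \<and> l \<in> T \<and> v r0 r0 \<in> T" if l: "l \<in> ?G" for l
  proof -
    have lp: "l \<in> param_space m" using l by simp
    define r where "r = l k / l m"
    define r' where "r' = l j / l m"
    have r: "0 < r" "r < 1" "l \<in> A r" "0 < r'" "r' < 1" "l \<in> B r'"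
      using param_spaceD(1)[OF lp km(1)] param_spaceD(1)[OF lp km(2)] param_spaceD(2)[OF lp k]
        param_spaceD(2)[OF lp j(1)] lm[OF lp] lp by (simp_all add: r_def r'_def A_def B_def)
    consider "r \<notin> \<rat>" | "r' \<notin> \<rat>" using l by (auto simp: r_def r'_def)
    then show ?thesis
    proof cases
      case 1
      \<comment> \<open>The slice through l meets the fixed slice \<open>B r0\<close>, which
        contains the base point \<open>v r0 r0\<close>.\<close>
      have "connected (A r \<union> B r0)" using v[of r r0] r r0 by (intro connected_Un conn) blast
      then show ?thesis using AG[OF 1] AG[OF r0(3)] r v[of r0 r0] r0 by (intro exI[of _ "A r \<union> B r0"]) blast
    next
      case 2
      have "connected (B r' \<union> A r0)" using v[of r0 r'] r r0 by (intro connected_Un conn) blast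
      then show ?thesis using AG[OF 2] AG[OF r0(3)] r v[of r0 r0] r0 by (intro exI[of _ "B r' \<union> A r0"]) blast
    qed
  qed
  define TT where "TT = {T. connected T \<and> T \<subseteq> ?G \<and> v r0 r0 \<in> T}"
  have "connected (\<Union>TT)" by (rule connected_Union) (auto simp: TT_def)
  also have "\<Union>TT = ?G"
  proof (rule subset_antisym)
    show "?G \<subseteq> \<Union>TT"
    proof
      fix l assume "l \<in> ?G"
      from ex[OF this] obtain T where T: "connected T" "T \<subseteq> ?G" "l \<in> T" "v r0 r0 \<in> T" by (elim exE conjE)
      show "l \<in> \<Union>TT" by (rule UnionI[of T]) (use T in \<open>simp_all add: TT_def\<close>)
    qed
    show "\<Union>TT \<subseteq> ?G" by (rule Union_least) (simp add: TT_def)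
  qed
  finally show ?thesis .
qed

text \<open>All three products are integer multiples of pi, so x, y and z are commensurable.\<close>

lemma sin_multiples_rational:
  fixes x y z t :: real
  assumes "t \<noteq> 0" "z \<noteq> 0" "sin (x * t) = 0" "sin ((z - x) * t) = 0" "sin ((y - x) * t) = 0"
  shows "x / z \<in> \<rat>" "y / z \<in> \<rat>"
proof -
  obtain n1 n2 n3 :: int where n: "x * t = n1 * pi" "(z - x) * t = n2 * pi" "(y - x) * t = n3 * pi"
    using assms(3-5) sin_zero_iff_int2 by metis
  have zt: "z * t = of_int (n1 + n2) * pi" and yt: "y * t = of_int (n1 + n3) * pi"
    using n by (simp_all add: algebra_simps)
  have "x / z = (x * t) / (z * t)" "y / z = (y * t) / (z * t)" using assms(1) by simp_all
  then have "x / z = of_int n1 / of_int (n1 + n2)" "y / z = of_int (n1 + n3) / of_int (n1 + n2)"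
    unfolding n(1) zt yt by simp_all
  then show "x / z \<in> \<rat>" "y / z \<in> \<rat>" by (auto intro!: Rats_divide)
qed

section \<open>Bounds for roots in the left half-plane\<close>

context root_system
begin

definition left_bounded :: "((nat \<Rightarrow> real) \<Rightarrow> complex) \<Rightarrow> bool" where
  "left_bounded f \<longleftrightarrow> (\<exists>C. \<forall>l\<in>param_space m. Re (f l) < 0 \<longrightarrow> min_entry m l * \<bar>Im (f l)\<bar> \<le> C)"

lemma left_boundedI:
  assumes "k \<in> {1..m}" "\<And>l. l \<in> param_space m \<Longrightarrow> Re (f l) < 0 \<Longrightarrow> l k * \<bar>Im (f l)\<bar> \<le> C"
  shows "left_bounded f"
  unfolding left_bounded_def
proof (intro exI ballI impI)
  fix l assume l: "l \<in> param_space m" "Re (f l) < 0"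
  have "min_entry m l * \<bar>Im (f l)\<bar> \<le> l k * \<bar>Im (f l)\<bar>"
    using min_entry_le[OF assms(1)] by (intro mult_right_mono) auto
  then show "min_entry m l * \<bar>Im (f l)\<bar> \<le> C" using assms(2)[OF l] by linarith
qed

lemma left_bounded_outer:
  assumes i: "i \<in> I" and dom: "(\<Sum>i=1..<m. \<bar>a i\<bar>) \<le> \<bar>a 0\<bar>" "(\<Sum>i=1..<m. \<bar>a i\<bar>) \<le> \<bar>a m\<bar>"
  shows "left_bounded (\<psi> i)"
proof -
  have "\<exists>C. \<forall>l\<in>param_space m. \<bar>l m * Im (\<psi> i l)\<bar> \<le> C"
  proof (rule cos_barrier[where s="sgn (a 0 * a m)"])
    show "continuous_on (param_space m) (\<lambda>l. l m * Im (\<psi> i l))"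
      by (intro continuous_intros cont i)
  qed (use connected_param_space sgn_mult_cases[OF a0 am] polyexp_outer_barrier[OF m_pos _ root[OF i] a0 am dom] in auto)
  then obtain C where C: "\<And>l. l \<in> param_space m \<Longrightarrow> \<bar>l m * Im (\<psi> i l)\<bar> \<le> C" by blast
  show ?thesis
  proof (rule left_boundedI[of m])
    fix l assume l: "l \<in> param_space m"
    show "l m * \<bar>Im (\<psi> i l)\<bar> \<le> C" using C[OF l] param_spaceD(1)[OF l, of m] m_pos by (simp add: abs_mult)
  qed (use m_pos in auto)
qed

text \<open>
  For parameters in the connected dense set \<open>G\<close> the root can meet the imaginary axis only at \<open>0\<close>,
  which glues the barrier functions of the two half-planes; the offset makes both
  avoid the same value \<open>s\<close> of the cosine.
\<close>
lemma left_bounded_inner: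
  assumes i: "i \<in> I" and k: "k \<in> {1..<m}" and j: "j \<in> {1..<m}" "j \<noteq> k" "a j \<noteq> 0"
    and dom: "\<bar>a 0\<bar> + \<bar>a m\<bar> + (\<Sum>i\<in>{1..<m} - {k}. \<bar>a i\<bar>) \<le> \<bar>a k\<bar>"
      "(\<Sum>i\<in>{1..<m} - {k}. \<bar>a i\<bar>) \<le> \<bar>a 0\<bar>" "(\<Sum>i\<in>{1..<m} - {k}. \<bar>a i\<bar>) \<le> \<bar>a m\<bar>"
  shows "left_bounded (\<psi> i)"
proof -
  define G where "G = {l \<in> param_space m. l k / l m \<notin> \<rat> \<or> l j / l m \<notin> \<rat>}"
  have GS: "G \<subseteq> param_space m" by (auto simp: G_def)
  have "0 \<le> (\<Sum>i\<in>{1..<m} - {k}. \<bar>a i\<bar>)" by (intro sum_nonneg) auto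
  moreover have "0 < \<bar>a 0\<bar>" "0 < \<bar>a m\<bar>" using a0 am by auto
  ultimately have ak: "a k \<noteq> 0" using dom(1) by linarith
  have lm: "0 < l m" "0 < l k" "l k < l m" if "l \<in> param_space m" for l
    using param_spaceD(1)[OF that, of m] param_spaceD(1)[OF that, of k] param_spaceD(2)[OF that k] m_pos k by auto
  define s where "s = sgn (a 0 * a k)"
  define s' where "s' = sgn (a k * a m)"
  have s: "s = 1 \<or> s = -1" "s' = 1 \<or> s' = -1"
    unfolding s_def s'_def using sgn_mult_cases a0 am ak by auto
  \<comment> \<open>A zero on the axis makes the exponents k, j and m commensurable unless its
    imaginary part is 0, which is what G excludes. At the point 0 both cosines are 1, whence
    \<open>s = s'\<close>.\<close>
  have axis: "Im (\<psi> i l) = 0 \<and> s = s'" if l: "l \<in> G" "Re (\<psi> i l) = 0" for l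
  proof -
    have lp: "l \<in> param_space m" using l GS by auto
    note z = polyexp_imaginary_zero[OF m_pos root[OF i lp] l(2) k a0 am dom(1)]
    have c: "cos (l k * Im (\<psi> i l)) = - s" "cos ((l m - l k) * Im (\<psi> i l)) = - s'"
      using z(1,2) by (simp_all add: s_def s'_def)
    have "sin (l k * Im (\<psi> i l)) = 0" "sin ((l m - l k) * Im (\<psi> i l)) = 0"
      using c s sin_cos_squared_add[of "l k * Im (\<psi> i l)"] sin_cos_squared_add[of "(l m - l k) * Im (\<psi> i l)"] by auto
    then have "Im (\<psi> i l) = 0"
      using sin_multiples_rational[of "Im (\<psi> i l)" "l m" "l k" "l j"] z(3)[of j] j lm(1)[OF lp] l(1)
      by (auto simp: G_def)
    then show ?thesis using c by simp
  qed
  \<comment> \<open>If \<open>s\<close> and \<open>s'\<close> differ, \<open>axis\<close> shows that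
    no root meets the imaginary axis over G, so the jump by \<open>pi\<close> does not harm
    continuity.\<close>
  define off where "off = (if s = s' then 0 else pi)"
  define g where "g l = (if Re (\<psi> i l) \<le> 0 then l k * Im (\<psi> i l) else (l m - l k) * Im (\<psi> i l) + off)" for l
  have "\<exists>C. \<forall>l\<in>G. \<bar>g l\<bar> \<le> C"
  proof (rule cos_barrier[where s=s])
    show "connected G" unfolding G_def by (rule connected_irrational_ratios[OF k j(1,2)])
    have cG: "continuous_on X (\<psi> i)" if "X \<subseteq> G" for X
      using cont[OF i] that GS by (meson continuous_on_subset order_trans)
    show "continuous_on G g"
      unfolding g_def
    proof (rule continuous_on_cases_le)
      fix l assume "l \<in> G" "Re (\<psi> i l) = 0"
      then show "l k * Im (\<psi> i l) = (l m - l k) * Im (\<psi> i l) + off" using axis[of l] by (simp add: off_def)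
    qed (auto intro!: continuous_intros cG)
    fix l assume "l \<in> G"
    then have l: "l \<in> param_space m" using GS by auto
    show "cos (g l) \<noteq> s"
    proof (cases "Re (\<psi> i l) \<le> 0")
      case True
      then show ?thesis
        using polyexp_inner_barrier[OF m_pos l root[OF i l] True a0 am k dom(1,2)] by (simp add: g_def s_def)
    next
      case False
      have rv: "rev_coeff a m 0 = a m" "rev_coeff a m m = a 0" "rev_coeff a m k = a k"
        using m_pos k by (auto simp: rev_coeff_def)
      have rvs: "(\<Sum>i\<in>{1..<m} - {k}. \<bar>rev_coeff a m i\<bar>) = (\<Sum>i\<in>{1..<m} - {k}. \<bar>a i\<bar>)"
        by (intro sum.cong) (auto simp: rev_coeff_def)
      \<comment> \<open>The right half-plane is the left one of the reversed polynomial, whose k-th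
        exponent is \<open>l m - l k\<close>.\<close>
      have "cos (flip m l k * Im (- \<psi> i l)) \<noteq> sgn (rev_coeff a m 0 * rev_coeff a m k)"
      proof (rule polyexp_inner_barrier[OF m_pos flip_param_space[OF m_pos l]])
        show "polyexp (rev_coeff a m) m (- \<psi> i l) (flip m l) = 0"
          using polyexp_flip_zero_iff[OF m_pos] root[OF i l] by simp
      qed (use False a0 am k dom rv rvs in auto)
      then have "cos ((l m - l k) * Im (\<psi> i l)) \<noteq> s'"
        using k rv by (simp add: flip_def s'_def mult.commute)
      then show ?thesis using False s by (auto simp: g_def off_def cos_add)
    qed
  qed (rule s)
  then obtain C where C: "\<And>l. l \<in> G \<Longrightarrow> \<bar>g l\<bar> \<le> C" by blast
  have CG: "l k * \<bar>Im (\<psi> i l)\<bar> \<le> C" if "l \<in> G" "Re (\<psi> i l) < 0" for l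
    using C[OF that(1)] that lm[of l] GS by (auto simp: g_def abs_mult)
  show ?thesis
  proof (rule left_boundedI[of k], use k in simp)
    fix l assume l: "l \<in> param_space m" "Re (\<psi> i l) < 0"
    \<comment> \<open>Raising only the entry k reaches points of G arbitrarily close to l; a
      violation of the bound at l would persist at such a point.\<close>
    define h where "h t = l(k := l k + t)" for t
    define e where "e = (l m - l k) / 2"
    have e: "0 < e" using lm[OF l(1)] by (simp add: e_def)
    have hS: "h t \<in> param_space m" if "t \<in> {0..e}" for t
    proof (rule param_spaceI)
      fix i assume "i \<in> {1..m}"
      then show "0 < h t i" using that param_spaceD(1)[OF l(1), of i] by (auto simp: h_def)
    next
      fix i assume "i \<in> {1..<m}"
      then show "h t i < h t m" using that k e param_spaceD(2)[OF l(1), of i] by (auto simp: h_def e_def)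
    next
      fix i assume "i \<notin> {1..m}"
      then show "h t i = undefined" using k param_spaceD(3)[OF l(1), of i] by (auto simp: h_def)
    qed
    have ch: "continuous_on {0..e} h"
    proof (rule continuous_on_coordinatewise_then_product)
      fix i show "continuous_on {0..e} (\<lambda>t. h t i)"
        by (cases "i = k") (auto simp: h_def intro!: continuous_intros)
    qed
    have "continuous_on {0..e} (\<lambda>t. \<psi> i (h t))"
      using hS by (intro continuous_on_compose2[OF cont[OF i] ch]) auto
    then have lim: "((\<lambda>t. \<psi> i (h t)) \<longlongrightarrow> \<psi> i l) (at 0 within {0..e})"
      using e by (auto simp: continuous_on_def h_def dest!: bspec[of _ _ 0])
    have wi: "at 0 within {0..e} = at_right (0 :: real)"
      using e by (simp add: at_within_Icc_at_right)
    show "l k * \<bar>Im (\<psi> i l)\<bar> \<le> C"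
    proof (rule ccontr)
      assume "\<not> l k * \<bar>Im (\<psi> i l)\<bar> \<le> C"
      then have "C < l k * \<bar>Im (\<psi> i l)\<bar>" by simp
      moreover have "((\<lambda>t. (l k + t) * \<bar>Im (\<psi> i (h t))\<bar>) \<longlongrightarrow> (l k + 0) * \<bar>Im (\<psi> i l)\<bar>) (at_right 0)"
        using lim unfolding wi by (intro tendsto_mult tendsto_add tendsto_const tendsto_ident_at tendsto_rabs tendsto_Im)
      ultimately have "eventually (\<lambda>t. C < (l k + t) * \<bar>Im (\<psi> i (h t))\<bar>) (at_right 0)"
        by (intro order_tendstoD(1)) auto
      moreover have "eventually (\<lambda>t. Re (\<psi> i (h t)) < 0) (at_right 0)"
        using lim l(2) unfolding wi by (intro order_tendstoD(2)[OF tendsto_Re]) auto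
      ultimately have "eventually (\<lambda>t. C < (l k + t) * \<bar>Im (\<psi> i (h t))\<bar> \<and> Re (\<psi> i (h t)) < 0) (at_right 0)"
        by (rule eventually_conj)
      then obtain b where b: "0 < b" "\<And>t. 0 < t \<Longrightarrow> t < b \<Longrightarrow> C < (l k + t) * \<bar>Im (\<psi> i (h t))\<bar> \<and> Re (\<psi> i (h t)) < 0"
        unfolding eventually_at_right_field by auto
      obtain t where t: "0 < t" "t < min b e" "(l k + t) / l m \<notin> \<rat>"
        using exists_irrational_quotient[of 0 "min b e" "l m" "l k"] b e lm[OF l(1)] by auto
      have "h t \<in> G" using hS[of t] t k by (auto simp: G_def h_def)
      then show False using CG[of "h t"] b(2)[of t] t by (simp add: h_def)
    qed
  qed
qed

text \<open>Here \<open>l m * \<psi> i l\<close> depends on \<open>l k / l m\<close> only, because along a path on which this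
  ratio is constant it stays in a countable set.\<close>
lemma left_bounded_single:
  assumes i: "i \<in> I" and k: "k \<in> {1..<m}" "a k \<noteq> 0" and z: "\<And>j. j \<in> {1..<m} \<Longrightarrow> j \<noteq> k \<Longrightarrow> a j = 0"
  shows "left_bounded (\<psi> i)"
proof -
  have km: "k \<in> {1..m}" "m \<in> {1..m}" "k \<noteq> m" using k by auto
  have Q: "polyexp a m w l = of_real (a 0) + of_real (a k) * exp (of_real (l k) * w) + of_real (a m) * exp (of_real (l m) * w)" for w l
  proof -
    have "(\<Sum>i\<in>{1..<m} - {k}. of_real (a i) * exp (of_real (l i) * w)) = 0"
      using z by (intro sum.neutral) auto
    then show ?thesis unfolding polyexp_split_at[OF m_pos k(1)] by simp
  qed
  define v :: "real \<Rightarrow> nat \<Rightarrow> real" where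
    "v t = (\<lambda>i\<in>{1..m}. if i = m then 1 else if i = k then t else 1 / 2)" for t
  have v: "v t \<in> param_space m" if "t \<in> {0<..<1}" for t
    unfolding v_def using that m_pos by (intro unit_top_param_space) auto
  have vk: "v t k = t" "v t m = 1" for t using km by (simp_all add: v_def)
  have cv: "continuous_on X v" for X
  proof (rule continuous_on_param[of m])
    fix i assume "i \<in> {1..m}"
    then show "continuous_on X (\<lambda>t. v t i)"
      by (cases "i = m"; cases "i = k") (auto simp: v_def intro!: continuous_intros)
  qed (simp add: v_def del: atLeastAtMost_iff)
  define \<phi> where "\<phi> t = \<psi> i (v t)" for t
  have "\<exists>C. \<forall>t\<in>{0<..<1}. Re (\<phi> t) < 0 \<longrightarrow> t * \<bar>Im (\<phi> t)\<bar> \<le> C"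
  proof (rule trinomial_left_bound[OF a0 k(2) am])
    show "continuous_on {0<..<1} \<phi>"
      unfolding \<phi>_def using v by (intro continuous_on_compose2[OF cont[OF i] cv]) auto
    fix t :: real assume "t \<in> {0<..<1}"
    then show "of_real (a 0) + of_real (a k) * exp (of_real t * \<phi> t) + of_real (a m) * exp (\<phi> t) = 0"
      using root[OF i v[of t]] unfolding Q vk by (simp add: \<phi>_def)
  qed
  then obtain C where C: "\<And>t. t \<in> {0<..<1} \<Longrightarrow> Re (\<phi> t) < 0 \<Longrightarrow> t * \<bar>Im (\<phi> t)\<bar> \<le> C" by blast
  show ?thesis
  proof (rule left_boundedI[OF km(1)])
    fix l assume l: "l \<in> param_space m" "Re (\<psi> i l) < 0"
    have lm: "0 < l m" "0 < l k" "l k < l m"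
      using param_spaceD(1)[OF l(1) km(1)] param_spaceD(1)[OF l(1) km(2)] param_spaceD(2)[OF l(1) k(1)] by auto
    define t where "t = l k / l m"
    have t: "t \<in> {0<..<1}" "l k = t * l m" using lm by (auto simp: t_def)
    define L where "L = lerp m l (v t)"
    \<comment> \<open>Only the entries k and m enter the equation, so by homogeneity
      \<open>q x\<close> is a zero at the fixed parameter \<open>v t\<close> for every x.\<close>
    define q where "q x = of_real (L x m) * \<psi> i (L x)" for x
    have LS: "L x \<in> param_space m" if "x \<in> {0..1}" for x
      unfolding L_def using lerp_param_space[OF l(1) v[OF t(1)], of x] that by simp
    have cL: "continuous_on {0..1} L"
    proof (rule continuous_on_param[of m])
      fix i assume "i \<in> {1..m}"
      then show "continuous_on {0..1} (\<lambda>x. L x i)" by (auto simp: L_def lerp_def intro!: continuous_intros)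
    qed (simp add: L_def lerp_def del: atLeastAtMost_iff)
    have cq: "continuous_on {0..1} q"
      unfolding q_def using LS
      by (intro continuous_intros continuous_on_compose2[OF cont[OF i] cL] continuous_on_compose2[OF continuous_on_component cL]) auto
    have Lk: "L x k = t * L x m" for x
      using km t(2) by (simp add: L_def lerp_def vk algebra_simps)
    have "q x \<in> (\<lambda>i. \<psi> i (v t)) ` I" if x: "x \<in> {0..1}" for x
    proof -
      have "polyexp a m (q x) (v t) = 0"
        using root[OF i LS[OF x]] unfolding Q vk Lk q_def by (simp add: mult.assoc)
      then obtain i' where "i' \<in> I" "\<psi> i' (v t) = q x" using full[OF v[OF t(1)]] by blast
      then show ?thesis by (intro image_eqI[of _ _ i']) auto
    qed
    then have "countable (q ` {0..1})"
      using cI by (meson countable_image countable_subset image_subsetI)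
    then have "q 0 = q 1"
      using connected_uncountable[OF connected_continuous_image[OF cq], of "q 0" "q 1"] by (metis atLeastAtMost_iff
        connected_Icc image_eqI order_refl zero_le_one)
    moreover have "L 0 = l" "L 1 = v t"
      using param_spaceD(3)[OF l(1)] by (auto simp: L_def lerp_def v_def fun_eq_iff)
    ultimately have q: "of_real (l m) * \<psi> i l = \<phi> t" by (simp add: q_def \<phi>_def vk)
    have "Re (\<phi> t) = l m * Re (\<psi> i l)" "Im (\<phi> t) = l m * Im (\<psi> i l)" unfolding q[symmetric] by simp_all
    moreover have "l m * Re (\<psi> i l) < 0" using lm l(2) by (simp add: mult_pos_neg)
    ultimately show "l k * \<bar>Im (\<psi> i l)\<bar> \<le> C"
      using C[OF t(1)] t(2) lm by (simp add: abs_mult mult.assoc)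
  qed
qed

lemma left_bounded_root:
  assumes i: "i \<in> I" shows "left_bounded (\<psi> i)"
proof (cases "\<exists>k\<in>{1..<m}. a k \<noteq> 0")
  case False
  then have "(\<Sum>i=1..<m. \<bar>a i\<bar>) = 0" by simp
  then show ?thesis using left_bounded_outer[OF i] by simp
next
  case True
  then obtain k where k: "k \<in> {1..<m}" "a k \<noteq> 0" by blast
  show ?thesis
  proof (cases "\<exists>j\<in>{1..<m}. j \<noteq> k \<and> a j \<noteq> 0")
    case False
    then show ?thesis using left_bounded_single[OF i k] by blast
  next
    case True
    then obtain j where j: "j \<in> {1..<m}" "k \<noteq> j" "a j \<noteq> 0" by blast
    from k(1) j(1,2) k(2) j(3) show ?thesis
    proof (cases rule: dominance_cases)
      case outer
      then show ?thesis by (rule left_bounded_outer[OF i])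
    next
      case (inner k')
      obtain j' where "j' \<in> {1..<m}" "j' \<noteq> k'" "a j' \<noteq> 0" using k j by metis
      then show ?thesis using left_bounded_inner[OF i inner(1) _ _ _ inner(2-4)] by blast
    qed
  qed
qed

text \<open>In the left half-plane every exponential is at most
  \<open>exp (min_entry m l * Re w)\<close>, yet together these terms have to cancel
  \<open>a 0\<close>.\<close>

lemma scaled_Re_bounded:
  "\<exists>C. \<forall>l\<in>param_space m. \<forall>w. polyexp a m w l = 0 \<longrightarrow> Re w < 0 \<longrightarrow> min_entry m l * \<bar>Re w\<bar> \<le> C"
proof (intro exI ballI allI impI)
  fix l w assume l: "l \<in> param_space m" and w: "polyexp a m w l = 0" "Re w < 0"
  let ?x = "min_entry m l * Re w"
  have "\<bar>a 0\<bar> = norm (\<Sum>i=1..m. of_real (a i) * exp (of_real (l i) * w))"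
    using w(1) unfolding polyexp_def by (metis add_eq_0_iff norm_minus_cancel norm_of_real)
  also have "\<dots> \<le> (\<Sum>i=1..m. \<bar>a i\<bar> * exp ?x)"
  proof (rule sum_norm_le)
    fix i assume i: "i \<in> {1..m}"
    have "l i * Re w \<le> ?x" using min_entry_le[OF i] w(2) by (intro mult_right_mono_neg) auto
    then show "norm (of_real (a i) * exp (of_real (l i) * w)) \<le> \<bar>a i\<bar> * exp ?x"
      by (simp add: norm_mult mult_left_mono)
  qed
  also have "\<dots> = (\<Sum>i=1..m. \<bar>a i\<bar>) * exp ?x" by (simp add: sum_distrib_right)
  finally have "\<bar>a 0\<bar> * exp (- ?x) \<le> (\<Sum>i=1..m. \<bar>a i\<bar>)" by (simp add: exp_minus field_simps)
  moreover have "\<bar>a 0\<bar> * (- ?x) \<le> \<bar>a 0\<bar> * exp (- ?x)"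
    using exp_gt_self[of "- ?x"] by (intro mult_left_mono) auto
  ultimately have "- ?x \<le> (\<Sum>i=1..m. \<bar>a i\<bar>) / \<bar>a 0\<bar>" using a0 by (simp add: field_simps)
  then show "min_entry m l * \<bar>Re w\<bar> \<le> (\<Sum>i=1..m. \<bar>a i\<bar>) / \<bar>a 0\<bar>" using w(2) by simp
qed

lemma scaled_root_bounded:
  assumes i: "i \<in> I"
  shows "\<exists>C. \<forall>l\<in>param_space m. Re (\<psi> i l) < 0 \<longrightarrow> norm (of_real (min_entry m l) * \<psi> i l) \<le> C"
proof -
  obtain C1 where C1: "\<And>l. l \<in> param_space m \<Longrightarrow> Re (\<psi> i l) < 0 \<Longrightarrow> min_entry m l * \<bar>Im (\<psi> i l)\<bar> \<le> C1"
    using left_bounded_root[OF i] unfolding left_bounded_def by blast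
  obtain C2 where C2: "\<And>l. l \<in> param_space m \<Longrightarrow> Re (\<psi> i l) < 0 \<Longrightarrow> min_entry m l * \<bar>Re (\<psi> i l)\<bar> \<le> C2"
    using scaled_Re_bounded root[OF i] by blast
  have "norm (of_real (min_entry m l) * \<psi> i l) \<le> C2 + C1" if l: "l \<in> param_space m" "Re (\<psi> i l) < 0" for l
    using cmod_le[of "of_real (min_entry m l) * \<psi> i l"] C1[OF l] C2[OF l] min_entry_pos[OF m_pos l(1)]
    by (simp add: abs_mult)
  then show ?thesis by blast
qed

end

section \<open>The approach filter\<close>

text \<open>
  A condition that is homogeneous and linear in \<open>u\<close> and \<open>v\<close>. Comparing each entry with one whose limit is
  \<open>1\<close>, rather than with the minimum, therefore gives convex neighbourhoods.
\<close>
definition near :: "real \<Rightarrow> ennreal \<Rightarrow> real \<Rightarrow> real \<Rightarrow> bool" where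
  "near \<epsilon> x u v \<longleftrightarrow> (if x = \<infinity> then v < \<epsilon> * u else \<bar>u - enn2real x * v\<bar> < \<epsilon> * v)"

lemma near_convex:
  assumes "near \<epsilon> x u v" "near \<epsilon> x u' v'" "0 \<le> t" "t \<le> 1"
  shows "near \<epsilon> x ((1 - t) * u + t * u') ((1 - t) * v + t * v')"
proof (cases "x = \<infinity>")
  case True
  then show ?thesis
    using convex_comb_less[of v "\<epsilon> * u" v' "\<epsilon> * u'" t] assms by (simp add: near_def algebra_simps)
next
  case False
  define y where "y = enn2real x"
  have "u - y * v < \<epsilon> * v" "u' - y * v' < \<epsilon> * v'" "- (\<epsilon> * v) < u - y * v" "- (\<epsilon> * v') < u' - y * v'"
    using assms(1,2) False by (auto simp: near_def y_def)
  note convex_comb_less[OF this(1,2) assms(3,4)] convex_comb_less[OF this(3,4) assms(3,4)]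
  then show ?thesis using False unfolding near_def y_def[symmetric] by (simp add: abs_less_iff algebra_simps)
qed

lemma near_mono:
  assumes "near \<epsilon> x u v" "\<epsilon> \<le> \<epsilon>'" "0 < u" "0 < v"
  shows "near \<epsilon>' x u v"
proof -
  have "\<epsilon> * u \<le> \<epsilon>' * u" "\<epsilon> * v \<le> \<epsilon>' * v" using assms by (auto intro: mult_right_mono)
  then show ?thesis using assms(1) by (auto simp: near_def)
qed

lemma eventually_near:
  fixes u v M :: "'a \<Rightarrow> real"
  assumes pos: "eventually (\<lambda>l. 0 < M l \<and> 0 < u l \<and> 0 < v l) F" and "0 < \<epsilon>"
    and u: "((\<lambda>l. ennreal (u l / M l)) \<longlongrightarrow> x) F" and v: "((\<lambda>l. ennreal (v l / M l)) \<longlongrightarrow> 1) F"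
  shows "eventually (\<lambda>l. near \<epsilon> x (u l) (v l)) F"
proof -
  have nonneg: "eventually (\<lambda>l. 0 \<le> v l / M l) F" "eventually (\<lambda>l. 0 \<le> u l / M l) F"
    using pos by (auto elim!: eventually_mono)
  have v': "((\<lambda>l. v l / M l) \<longlongrightarrow> 1) F"
    using v tendsto_ennrealD[of "\<lambda>l. v l / M l" 1 F] nonneg(1) by simp
  show ?thesis
  proof (cases "x = \<infinity>")
    case True
    then have "filterlim (\<lambda>l. u l / M l) at_top F"
      using u by (simp add: ennreal_tendsto_top_eq_at_top)
    then have "eventually (\<lambda>l. 2 / \<epsilon> \<le> u l / M l) F" by (auto simp: filterlim_at_top)
    moreover have "eventually (\<lambda>l. v l / M l < 2) F" using order_tendstoD(2)[OF v'] by simp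
    ultimately show ?thesis using pos
    proof eventually_elim
      case (elim l)
      then have "v l < 2 * M l" "2 * M l \<le> \<epsilon> * u l" using \<open>0 < \<epsilon>\<close> by (auto simp: field_simps)
      then show ?case using True by (simp add: near_def)
    qed
  next
    case False
    define y where "y = enn2real x"
    have x: "x = ennreal y" "0 \<le> y" using False by (auto simp: y_def less_top)
    have u': "((\<lambda>l. u l / M l) \<longlongrightarrow> y) F"
      by (rule tendsto_ennrealD[OF u[unfolded x(1)] nonneg(2) x(2)])
    have "((\<lambda>l. \<bar>u l / M l - y * (v l / M l)\<bar> - \<epsilon> * (v l / M l)) \<longlongrightarrow> \<bar>y - y * 1\<bar> - \<epsilon> * 1) F"
      by (intro tendsto_diff tendsto_rabs tendsto_mult tendsto_const u' v')
    then have "eventually (\<lambda>l. \<bar>u l / M l - y * (v l / M l)\<bar> - \<epsilon> * (v l / M l) < 0) F"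
      using \<open>0 < \<epsilon>\<close> by (intro order_tendstoD(2)) auto
    then show ?thesis using pos
    proof eventually_elim
      case (elim l)
      have "u l / M l - y * (v l / M l) = (u l - y * v l) / M l" by (simp add: diff_divide_distrib)
      then have "\<bar>u l - y * v l\<bar> < \<epsilon> * v l" using elim by (simp add: abs_divide field_simps)
      then show ?case using False by (simp add: near_def y_def)
    qed
  qed
qed

text \<open>All limits are at least 1, so eventually no entry is much smaller than the entry
  \<open>i0\<close>. Hence the minimum divided by the entry \<open>i0\<close> tends to 1, and
  normalising by either gives the same limits.\<close>

lemma tendsto_normalized_of_near:
  fixes f :: "'a \<Rightarrow> nat \<Rightarrow> real"
  assumes m: "1 \<le> m" and i0: "i0 \<in> {1..m}" and x: "\<And>i. i \<in> {1..m} \<Longrightarrow> 1 \<le> x i"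
    and pos: "eventually (\<lambda>l. \<forall>i\<in>{1..m}. 0 < f l i) F"
    and near: "\<And>\<epsilon>. 0 < \<epsilon> \<Longrightarrow> eventually (\<lambda>l. \<forall>i\<in>{1..m}. near \<epsilon> (x i) (f l i) (f l i0)) F"
    and i: "i \<in> {1..m}"
  shows "((\<lambda>l. normalized m (f l) i) \<longlongrightarrow> x i) F"
proof -
  define M where "M l = min_entry m (f l)" for l
  have M1: "((\<lambda>l. M l / f l i0) \<longlongrightarrow> 1) F"
  proof (rule tendstoI)
    fix e :: real assume e: "0 < e"
    define \<epsilon> where "\<epsilon> = min (e / 2) 1"
    have eps: "0 < \<epsilon>" "\<epsilon> < e" "\<epsilon> \<le> 1" using e by (auto simp: \<epsilon>_def min_def)
    from near[OF eps(1)] pos show "eventually (\<lambda>l. dist (M l / f l i0) 1 < e) F"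
    proof eventually_elim
      case (elim l)
      obtain k where k: "k \<in> {1..m}" "M l = f l k" using min_entry_in[OF m] unfolding M_def by blast
      have v: "0 < f l i0" using elim i0 by blast
      have "(1 - \<epsilon>) * f l i0 \<le> f l k"
      proof (cases "x k = \<infinity>")
        case True
        then have "f l i0 < \<epsilon> * f l k" using elim(1) k(1) by (auto simp: near_def)
        also have "\<dots> \<le> 1 * f l k" using eps elim(2) k(1) by (intro mult_right_mono) (auto simp: less_imp_le)
        finally have "f l i0 \<le> f l k" by simp
        moreover have "(1 - \<epsilon>) * f l i0 \<le> 1 * f l i0" using eps v by (intro mult_right_mono) auto
        ultimately show ?thesis by simp
      next
        case False
        then have "\<bar>f l k - enn2real (x k) * f l i0\<bar> < \<epsilon> * f l i0" using elim(1) k(1) by (auto simp: near_def)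
        moreover have "1 \<le> enn2real (x k)" using x[OF k(1)] False by (auto simp: enn2real_leI less_top intro: enn2real_mono[of 1 "x k", simplified])
        then have "1 * f l i0 \<le> enn2real (x k) * f l i0" using v by (intro mult_right_mono) auto
        ultimately show ?thesis by (simp add: algebra_simps abs_less_iff)
      qed
      then have "1 - \<epsilon> \<le> M l / f l i0" using v k by (simp add: field_simps)
      moreover have "M l / f l i0 \<le> 1" using min_entry_le[OF i0, of "f l"] v by (simp add: M_def)
      ultimately show ?case using eps by (simp add: dist_real_def)
    qed
  qed
  have pos': "eventually (\<lambda>l. 0 < f l i \<and> 0 < f l i0) F" using pos i i0 by (auto elim!: eventually_mono)
  have "((\<lambda>l. ennreal (f l i / M l)) \<longlongrightarrow> x i) F"
  proof (cases "x i = \<infinity>")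
    case True
    have top: "filterlim (\<lambda>l. f l i / M l) at_top F"
    proof (subst filterlim_at_top_gt[where c=0], intro allI impI)
      fix Z :: real assume Z: "0 < Z"
      then have "0 < 1 / Z" by simp
      from near[OF this] pos show "eventually (\<lambda>l. Z \<le> f l i / M l) F"
      proof eventually_elim
        case (elim l)
        have M: "0 < M l" "M l \<le> f l i0"
          using min_entry_in[OF m, of "f l"] min_entry_le[OF i0, of "f l"] elim(2) by (auto simp: M_def)
        have "f l i0 < 1 / Z * f l i" using bspec[OF elim(1) i] True by (simp add: near_def)
        then have "Z * f l i0 < f l i" using Z by (simp add: field_simps)
        moreover have "Z * M l \<le> Z * f l i0" using Z M(2) by simp
        ultimately have "Z * M l \<le> f l i" by linarith
        then show ?case using M(1) by (simp add: field_simps)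
      qed
    qed
    then show ?thesis using True by (simp add: ennreal_tendsto_top_eq_at_top)
  next
    case False
    define y where "y = enn2real (x i)"
    have xi: "x i = ennreal y" using False by (auto simp: y_def less_top)
    have "((\<lambda>l. f l i / f l i0) \<longlongrightarrow> y) F"
    proof (rule tendstoI)
      fix e :: real assume e: "0 < e"
      from near[OF e] pos' show "eventually (\<lambda>l. dist (f l i / f l i0) y < e) F"
      proof eventually_elim
        case (elim l)
        have "\<bar>f l i - y * f l i0\<bar> < e * f l i0" using elim(1) i False by (auto simp: near_def y_def)
        moreover have "f l i / f l i0 - y = (f l i - y * f l i0) / f l i0" using elim(2) by (simp add: field_simps)
        ultimately show ?case using elim(2) by (simp add: dist_real_def abs_divide field_simps)
      qed
    qed
    then have "((\<lambda>l. (f l i / f l i0) / (M l / f l i0)) \<longlongrightarrow> y / 1) F"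
      by (intro tendsto_divide M1) auto
    then have "((\<lambda>l. f l i / M l) \<longlongrightarrow> y / 1) F"
      by (rule Lim_transform_eventually) (use pos' in \<open>auto elim!: eventually_mono\<close>)
    then have "((\<lambda>l. f l i / M l) \<longlongrightarrow> y) F" by simp
    then show ?thesis unfolding xi by (rule tendsto_ennrealI)
  qed
  then show ?thesis using i by (simp add: normalized_def M_def)
qed

lemma tendsto_fun_iff:
  fixes f :: "'a \<Rightarrow> 'b \<Rightarrow> 'c::topological_space"
  shows "(f \<longlongrightarrow> g) F \<longleftrightarrow> (\<forall>i. ((\<lambda>x. f x i) \<longlongrightarrow> g i) F)"
  using limitin_componentwise[of "\<lambda>_. euclidean" UNIV f g F]
  by (simp add: euclidean_product_topology limitin_canonical_iff)

lemma tendsto_normalized_coord: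
  "((\<lambda>l. normalized m (f l)) \<longlongrightarrow> x) F \<Longrightarrow> i \<in> {1..m} \<Longrightarrow> ((\<lambda>l. ennreal (f l i / min_entry m (f l))) \<longlongrightarrow> x i) F"
  unfolding tendsto_fun_iff normalized_def by (drule spec[of _ i]) simp

lemma reversed_pos:
  assumes "l \<in> param_space m" "i \<in> {1..m}" shows "0 < reversed m l i"
proof (cases "i = 1")
  case True
  then show ?thesis using assms param_spaceD(1)[OF assms(1), of m] by (simp add: reversed_def)
next
  case False
  then have "i - 1 \<in> {1..<m}" using assms(2) by auto
  from param_spaceD(2)[OF assms(1) this] show ?thesis using assms(2) False by (simp add: reversed_def)
qed

lemma reversed_lerp:
  "i \<in> {1..m} \<Longrightarrow> reversed m (lerp m l l' t) i = (1 - t) * reversed m l i + t * reversed m l' i"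
  by (auto simp: reversed_def lerp_def algebra_simps)

lemma normalized_ge_1:
  assumes "1 \<le> m" "\<And>i. i \<in> {1..m} \<Longrightarrow> 0 < f i"
  shows "i \<in> {1..m} \<Longrightarrow> 1 \<le> normalized m f i" "\<exists>i\<in>{1..m}. normalized m f i = 1"
proof -
  obtain k where k: "k \<in> {1..m}" "min_entry m f = f k" using min_entry_in[OF assms(1)] by blast
  show "1 \<le> normalized m f i" if "i \<in> {1..m}"
    using min_entry_le[OF that, of f] assms(2)[OF k(1)] that k(2) by (simp add: normalized_def)
  show "\<exists>i\<in>{1..m}. normalized m f i = 1"
    using assms(2)[OF k(1)] k by (intro bexI[of _ k]) (simp_all add: normalized_def)
qed

text \<open>Connected neighbourhoods within X, phrased for filters so that the property passes to
  the image filter under \<open>flip\<close>.\<close>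

definition connected_basis :: "'a::topological_space filter \<Rightarrow> 'a set \<Rightarrow> bool" where
  "connected_basis F X \<longleftrightarrow> (\<forall>P. eventually P F \<longrightarrow>
     (\<exists>C. connected C \<and> C \<subseteq> X \<and> eventually (\<lambda>x. x \<in> C) F \<and> (\<forall>x\<in>C. P x)))"

text \<open>These conditions hold on the image of \<open>iota\<close> and are closed; for the
  existence of an entry 1 this uses that there are finitely many entries. The entries equal to 1
  become the reference entries of \<open>near\<close>.\<close>

lemma closure_iota_ge_1:
  assumes m: "1 \<le> m" and cl: "(p, q) \<in> closure (iota m ` param_space m)"
  shows "\<forall>i\<in>{1..m}. 1 \<le> p i \<and> 1 \<le> q i" "\<exists>i\<in>{1..m}. p i = 1" "\<exists>i\<in>{1..m}. q i = 1"
proof -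
  define T :: "((nat \<Rightarrow> ennreal) \<times> (nat \<Rightarrow> ennreal)) set" where
    "T = (\<Inter>i\<in>{1..m}. {x. 1 \<le> fst x i} \<inter> {x. 1 \<le> snd x i}) \<inter> (\<Union>i\<in>{1..m}. {x. fst x i = 1}) \<inter> (\<Union>i\<in>{1..m}. {x. snd x i = 1})"
  have c: "continuous_on UNIV (\<lambda>x :: (nat \<Rightarrow> ennreal) \<times> (nat \<Rightarrow> ennreal). fst x i)"
    "continuous_on UNIV (\<lambda>x :: (nat \<Rightarrow> ennreal) \<times> (nat \<Rightarrow> ennreal). snd x i)" for i
    by (rule continuous_on_product_then_coordinatewise, intro continuous_intros)+
  have "closed T"
    unfolding T_def using c
    by (intro closed_Int closed_INT closed_UN ballI closed_Collect_le closed_Collect_eq continuous_on_const finite_atLeastAtMost) auto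
  moreover have "iota m ` param_space m \<subseteq> T"
  proof
    fix x assume "x \<in> iota m ` param_space m"
    then obtain l where l: "l \<in> param_space m" "x = iota m l" by blast
    show "x \<in> T"
      using normalized_ge_1[OF m param_spaceD(1)[OF l(1)]] normalized_ge_1[OF m reversed_pos[OF l(1)]]
      unfolding T_def l(2) iota_def by (auto simp del: atLeastAtMost_iff)
  qed
  ultimately have "(p, q) \<in> T" using cl closure_minimal by blast
  then show "\<forall>i\<in>{1..m}. 1 \<le> p i \<and> 1 \<le> q i" "\<exists>i\<in>{1..m}. p i = 1" "\<exists>i\<in>{1..m}. q i = 1"
    by (auto simp: T_def)
qed

lemma iota_approach: "filterlim (iota m) (nhds pq) (approach m pq)"
  unfolding approach_def by (rule filterlim_mono[OF filterlim_filtercomap order_refl inf_le1])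

lemma eventually_approach_param_space: "eventually (\<lambda>l. l \<in> param_space m) (approach m pq)"
  unfolding approach_def by (simp add: eventually_inf_principal)

lemma approach_neq_bot:
  assumes "pq \<in> closure (iota m ` param_space m)" shows "approach m pq \<noteq> bot"
proof
  assume "approach m pq = bot"
  then have "eventually (\<lambda>_. False) (approach m pq)" by simp
  then obtain U where U: "open U" "pq \<in> U" "\<And>l. iota m l \<in> U \<Longrightarrow> l \<notin> param_space m"
    unfolding approach_def eventually_inf_principal eventually_filtercomap eventually_nhds by blast
  then show False using assms by (auto simp: closure_iff_nhds_not_empty)
qed

text \<open>The sets \<open>C \<epsilon>\<close> are cut out by conditions that survive convex
  combinations. They generate the filter: by \<open>lim\<close> every neighbourhood contains one of
  them, by \<open>evC\<close> each of them is a neighbourhood.\<close>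

lemma connected_basis_approach:
  assumes m: "1 \<le> m" and cl: "(p, q) \<in> closure (iota m ` param_space m)"
    and ext: "p \<in> extensional {1..m}" "q \<in> extensional {1..m}"
  shows "connected_basis (approach m (p, q)) (param_space m)"
proof -
  note ge1 = closure_iota_ge_1[OF m cl]
  obtain i0 where i0: "i0 \<in> {1..m}" "p i0 = 1" using ge1(2) by blast
  obtain j0 where j0: "j0 \<in> {1..m}" "q j0 = 1" using ge1(3) by blast
  define C where "C \<epsilon> = {l \<in> param_space m. (\<forall>i\<in>{1..m}. near \<epsilon> (p i) (l i) (l i0)) \<and>
     (\<forall>i\<in>{1..m}. near \<epsilon> (q i) (reversed m l i) (reversed m l j0))}" for \<epsilon>
  have conn: "connected (C \<epsilon>)" for \<epsilon>
  proof (rule connected_lerp_closed[of _ m])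
    fix l assume "l \<in> C \<epsilon>"
    then show "l \<in> extensional {1..m}" unfolding C_def by (intro param_space_extensional) simp
  next
    fix l l' t assume l: "l \<in> C \<epsilon>" "l' \<in> C \<epsilon>" and t: "0 \<le> t" "t \<le> (1 :: real)"
    have "lerp m l l' t \<in> param_space m" using l t by (intro lerp_param_space) (auto simp: C_def)
    moreover have "near \<epsilon> (p i) (lerp m l l' t i) (lerp m l l' t i0)" if "i \<in> {1..m}" for i
      using l t that i0 near_convex[of \<epsilon> "p i" "l i" "l i0" "l' i" "l' i0" t] by (simp add: lerp_def C_def)
    moreover have "near \<epsilon> (q i) (reversed m (lerp m l l' t) i) (reversed m (lerp m l l' t) j0)" if "i \<in> {1..m}" for i
      unfolding reversed_lerp[OF that] reversed_lerp[OF j0(1)] using l t that by (intro near_convex) (auto simp: C_def)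
    ultimately show "lerp m l l' t \<in> C \<epsilon>" unfolding C_def by blast
  qed
  have mono: "C \<epsilon> \<subseteq> C \<epsilon>'" if "\<epsilon> \<le> \<epsilon>'" for \<epsilon> \<epsilon>'
  proof
    fix l assume l: "l \<in> C \<epsilon>"
    then have lp: "l \<in> param_space m" by (simp add: C_def)
    have "near \<epsilon>' (p i) (l i) (l i0)" "near \<epsilon>' (q i) (reversed m l i) (reversed m l j0)" if i: "i \<in> {1..m}" for i
      using near_mono[OF _ \<open>\<epsilon> \<le> \<epsilon>'\<close> param_spaceD(1)[OF lp i] param_spaceD(1)[OF lp i0(1)]]
        near_mono[OF _ \<open>\<epsilon> \<le> \<epsilon>'\<close> reversed_pos[OF lp i] reversed_pos[OF lp j0(1)]] l i by (auto simp: C_def)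
    then show "l \<in> C \<epsilon>'" using lp by (simp add: C_def)
  qed
  define F' where "F' = (INF \<epsilon>\<in>{0<..}. principal (C \<epsilon>))"
  have ev: "eventually P F' \<longleftrightarrow> (\<exists>\<epsilon>>0. \<forall>l\<in>C \<epsilon>. P l)" for P
  proof -
    have "eventually P F' \<longleftrightarrow> (\<exists>\<epsilon>\<in>{0<..}. eventually P (principal (C \<epsilon>)))"
      unfolding F'_def
    proof (rule eventually_INF_base)
      fix a b :: real assume ab: "a \<in> {0<..}" "b \<in> {0<..}"
      have "C (min a b) \<subseteq> C a \<inter> C b" using mono[of "min a b" a] mono[of "min a b" b] by auto
      then show "\<exists>x\<in>{0<..}. principal (C x) \<le> inf (principal (C a)) (principal (C b))"
        using ab by (intro bexI[of _ "min a b"]) auto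
    qed auto
    then show ?thesis by (auto simp: eventually_principal)
  qed
  have lim: "filterlim (iota m) (nhds (p, q)) F'"
    unfolding iota_def
  proof (intro tendsto_Pair)
    have outside: "normalized m f i = undefined" if "i \<notin> {1..m}" for f i
      using that by (simp add: normalized_def del: atLeastAtMost_iff)
    show "((\<lambda>l. normalized m l) \<longlongrightarrow> p) F'"
      unfolding tendsto_fun_iff
    proof
      fix i show "((\<lambda>l. normalized m l i) \<longlongrightarrow> p i) F'"
      proof (cases "i \<in> {1..m}")
        case True
        show ?thesis
        proof (rule tendsto_normalized_of_near[OF m i0(1) _ _ _ True])
          show "eventually (\<lambda>l. \<forall>i\<in>{1..m}. 0 < l i) F'"
            unfolding ev using param_spaceD(1) by (intro exI[of _ 1]) (auto simp: C_def simp del: atLeastAtMost_iff)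
          fix \<epsilon> :: real assume "0 < \<epsilon>"
          then show "eventually (\<lambda>l. \<forall>i\<in>{1..m}. near \<epsilon> (p i) (l i) (l i0)) F'"
            unfolding ev by (intro exI[of _ \<epsilon>]) (auto simp: C_def)
        qed (use ge1(1) in blast)
      next
        case False
        then show ?thesis using ext by (simp add: outside extensional_def del: atLeastAtMost_iff)
      qed
    qed
    show "((\<lambda>l. normalized m (reversed m l)) \<longlongrightarrow> q) F'"
      unfolding tendsto_fun_iff
    proof
      fix i show "((\<lambda>l. normalized m (reversed m l) i) \<longlongrightarrow> q i) F'"
      proof (cases "i \<in> {1..m}")
        case True
        show ?thesis
        proof (rule tendsto_normalized_of_near[OF m j0(1) _ _ _ True])
          show "eventually (\<lambda>l. \<forall>i\<in>{1..m}. 0 < reversed m l i) F'"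
            unfolding ev using reversed_pos by (intro exI[of _ 1]) (auto simp: C_def simp del: atLeastAtMost_iff)
          fix \<epsilon> :: real assume "0 < \<epsilon>"
          then show "eventually (\<lambda>l. \<forall>i\<in>{1..m}. near \<epsilon> (q i) (reversed m l i) (reversed m l j0)) F'"
            unfolding ev by (intro exI[of _ \<epsilon>]) (auto simp: C_def)
        qed (use ge1(1) in blast)
      next
        case False
        then show ?thesis using ext by (simp add: outside extensional_def del: atLeastAtMost_iff)
      qed
    qed
  qed
  have evC: "eventually (\<lambda>l. l \<in> C \<epsilon>) (approach m (p, q))" if "0 < \<epsilon>" for \<epsilon>
  proof -
    let ?F = "approach m (p, q)"
    have "((\<lambda>l. fst (iota m l)) \<longlongrightarrow> fst (p, q)) ?F" "((\<lambda>l. snd (iota m l)) \<longlongrightarrow> snd (p, q)) ?F"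
      by (intro tendsto_fst tendsto_snd iota_approach)+
    then have n: "((\<lambda>l. normalized m l) \<longlongrightarrow> p) ?F" "((\<lambda>l. normalized m (reversed m l)) \<longlongrightarrow> q) ?F"
      by (simp_all add: iota_def)
    have pos: "eventually (\<lambda>l. 0 < min_entry m l \<and> 0 < l i \<and> 0 < l i0) ?F"
      "eventually (\<lambda>l. 0 < min_entry m (reversed m l) \<and> 0 < reversed m l i \<and> 0 < reversed m l j0) ?F" if "i \<in> {1..m}" for i
    proof -
      have *: "0 < min_entry m l \<and> 0 < l i \<and> 0 < l i0" if l: "l \<in> param_space m" for l
        using min_entry_pos[OF m l] param_spaceD(1)[OF l \<open>i \<in> {1..m}\<close>] param_spaceD(1)[OF l i0(1)] by simp
      have **: "0 < min_entry m (reversed m l) \<and> 0 < reversed m l i \<and> 0 < reversed m l j0" if l: "l \<in> param_space m" for l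
        using min_entry_pos[OF m flip_param_space[OF m l]] reversed_pos[OF l \<open>i \<in> {1..m}\<close>] reversed_pos[OF l j0(1)]
        by (simp add: min_entry_reversed[OF m])
      show "eventually (\<lambda>l. 0 < min_entry m l \<and> 0 < l i \<and> 0 < l i0) ?F"
        by (rule eventually_mono[OF eventually_approach_param_space *])
      show "eventually (\<lambda>l. 0 < min_entry m (reversed m l) \<and> 0 < reversed m l i \<and> 0 < reversed m l j0) ?F"
        by (rule eventually_mono[OF eventually_approach_param_space **])
    qed
    have "eventually (\<lambda>l. \<forall>i\<in>{1..m}. near \<epsilon> (p i) (l i) (l i0)) ?F"
    proof (rule eventually_ball_finite[OF finite_atLeastAtMost], intro ballI)
      fix i assume i: "i \<in> {1..m}"
      show "eventually (\<lambda>l. near \<epsilon> (p i) (l i) (l i0)) ?F"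
        using tendsto_normalized_coord[OF n(1) i] tendsto_normalized_coord[OF n(1) i0(1)] i0(2)
        by (intro eventually_near[OF pos(1)[OF i] that]) auto
    qed
    moreover have "eventually (\<lambda>l. \<forall>i\<in>{1..m}. near \<epsilon> (q i) (reversed m l i) (reversed m l j0)) ?F"
    proof (rule eventually_ball_finite[OF finite_atLeastAtMost], intro ballI)
      fix i assume i: "i \<in> {1..m}"
      show "eventually (\<lambda>l. near \<epsilon> (q i) (reversed m l i) (reversed m l j0)) ?F"
        using tendsto_normalized_coord[OF n(2) i] tendsto_normalized_coord[OF n(2) j0(1)] j0(2)
        by (intro eventually_near[OF pos(2)[OF i] that]) auto
    qed
    ultimately show ?thesis
      using eventually_approach_param_space[of m "(p, q)"] by eventually_elim (auto simp: C_def)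
  qed
  show ?thesis
    unfolding connected_basis_def
  proof (intro allI impI)
    fix P assume "eventually P (approach m (p, q))"
    then obtain U where U: "open U" "(p, q) \<in> U" "\<And>l. iota m l \<in> U \<Longrightarrow> l \<in> param_space m \<Longrightarrow> P l"
      unfolding approach_def eventually_inf_principal eventually_filtercomap eventually_nhds by blast
    have "eventually (\<lambda>l. iota m l \<in> U) F'" using lim U(1,2) by (rule topological_tendstoD)
    then obtain \<epsilon> where e: "0 < \<epsilon>" "\<And>l. l \<in> C \<epsilon> \<Longrightarrow> iota m l \<in> U" unfolding ev by blast
    show "\<exists>C. connected C \<and> C \<subseteq> param_space m \<and> eventually (\<lambda>x. x \<in> C) (approach m (p, q)) \<and> (\<forall>x\<in>C. P x)"
      using conn[of \<epsilon>] evC[OF e(1)] U(3) e(2) by (intro exI[of _ "C \<epsilon>"]) (auto simp: C_def)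
  qed
qed

section \<open>Limits of rescaled roots\<close>

lemma connected_basisE:
  assumes "connected_basis F X" "eventually P F"
  obtains C where "connected C" "C \<subseteq> X" "eventually (\<lambda>x. x \<in> C) F" "\<forall>x\<in>C. P x"
  using assms(1)[unfolded connected_basis_def, rule_format, OF assms(2)] that by (elim exE conjE)

text \<open>Joint continuity, also at an infinite exponent: there the real part stays below a
  negative constant, so the modulus decays as the exponent grows. This fails on the axis, which
  confines the limit argument to the open half-plane.\<close>

lemma tendsto_ext_exp:
  fixes x :: ennreal and z :: complex
  assumes X: "(X \<longlongrightarrow> x) F" and Z: "(Z \<longlongrightarrow> z) F" and z: "Re z < 0"
  shows "((\<lambda>t. ext_exp (X t) (Z t)) \<longlongrightarrow> ext_exp x z) F"
proof (cases "x = \<infinity>")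
  case False
  have "eventually (\<lambda>t. X t < \<infinity>) F"
    using False by (intro order_tendstoD(2)[OF X]) (simp add: less_top)
  then have ev: "eventually (\<lambda>t. exp (of_real (enn2real (X t)) * Z t) = ext_exp (X t) (Z t)) F"
    by eventually_elim (auto simp: ext_exp_def)
  have "((\<lambda>t. enn2real (X t)) \<longlongrightarrow> enn2real x) F"
    using False X by (intro tendsto_enn2real) (auto simp: less_top)
  then have "((\<lambda>t. exp (of_real (enn2real (X t)) * Z t)) \<longlongrightarrow> exp (of_real (enn2real x) * z)) F"
    using Z by (intro tendsto_exp tendsto_mult tendsto_of_real)
  then show ?thesis using Lim_transform_eventually[OF _ ev] False by (simp add: ext_exp_def)
next
  case True
  define d where "d = - Re z / 2"
  have d: "0 < d" using z by (simp add: d_def)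
  have "((\<lambda>t. ext_exp (X t) (Z t)) \<longlongrightarrow> 0) F"
  proof (rule tendstoI)
    fix e :: real assume e: "0 < e"
    have "eventually (\<lambda>t. ennreal (1 / (d * e)) < X t) F"
      using X True by (intro order_tendstoD(1)) (auto simp: less_top)
    moreover have "eventually (\<lambda>t. Re (Z t) < - d) F"
      using z by (intro order_tendstoD(2)[OF tendsto_Re[OF Z]]) (simp add: d_def)
    ultimately show "eventually (\<lambda>t. dist (ext_exp (X t) (Z t)) 0 < e) F"
    proof eventually_elim
      case (elim t)
      show ?case
      proof (cases "X t = \<infinity>")
        case True
        then show ?thesis using e by (simp add: ext_exp_def)
      next
        case False
        define r where "r = enn2real (X t)"
        have Xr: "X t = ennreal r" "0 \<le> r" using False by (auto simp: r_def less_top)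
        have r: "1 / (d * e) < r" using elim(1) d e unfolding Xr by (simp add: ennreal_less_iff)
        then have r0: "0 < r" using d e by (meson divide_pos_pos less_trans mult_pos_pos zero_less_one)
        have "norm (ext_exp (X t) (Z t)) = exp (r * Re (Z t))"
          using False by (simp add: ext_exp_def r_def)
        also have "\<dots> \<le> exp (- (r * d))"
        proof -
          have "r * Re (Z t) \<le> r * (- d)" using elim(2) r0 by (intro mult_left_mono) auto
          then show ?thesis by simp
        qed
        also have "\<dots> < 1 / (r * d)"
          using exp_gt_self[of "r * d"] r0 d by (simp add: exp_minus field_simps)
        also have "\<dots> < e" using r d e r0 by (simp add: field_simps)
        finally show ?thesis by simp
      qed
    qed
  qed
  then show ?thesis using True by (simp add: ext_exp_def)
qed

definition ext_polyexp :: "(nat \<Rightarrow> real) \<Rightarrow> nat \<Rightarrow> (nat \<Rightarrow> ennreal) \<Rightarrow> complex \<Rightarrow> complex" where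
  "ext_polyexp a m p z = of_real (a 0) + (\<Sum>i=1..m. of_real (a i) * ext_exp (p i) z)"

lemma Zneg_iff: "z \<in> Zneg a m p \<longleftrightarrow> Re z < 0 \<and> ext_polyexp a m p z = 0"
  by (auto simp: Zneg_def Hneg_def ext_polyexp_def)

lemma open_Hneg: "open Hneg"
  unfolding Hneg_def by (intro open_Collect_less continuous_intros)

lemma continuous_on_ext_polyexp:
  "continuous_on (UNIV \<times> Hneg) (\<lambda>x. ext_polyexp a m (fst x) (snd x))"
  unfolding continuous_on_def ext_polyexp_def
proof
  fix x :: "(nat \<Rightarrow> ennreal) \<times> complex" assume x: "x \<in> UNIV \<times> Hneg"
  let ?F = "at x within UNIV \<times> Hneg"
  have id: "((\<lambda>y. y) \<longlongrightarrow> x) ?F" by (rule tendsto_ident_at)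
  have "((\<lambda>y. fst y i) \<longlongrightarrow> fst x i) ?F" for i
    using tendsto_fst[OF id] unfolding tendsto_fun_iff by simp
  then show "((\<lambda>x. of_real (a 0) + (\<Sum>i=1..m. of_real (a i) * ext_exp (fst x i) (snd x))) \<longlongrightarrow>
      of_real (a 0) + (\<Sum>i=1..m. of_real (a i) * ext_exp (fst x i) (snd x))) ?F"
    using tendsto_snd[OF id] x by (intro tendsto_add tendsto_const tendsto_sum tendsto_mult tendsto_ext_exp) (auto simp: Hneg_def)
qed

lemma holomorphic_ext_polyexp: "ext_polyexp a m p holomorphic_on S"
proof -
  have "(\<lambda>z. ext_exp x z) holomorphic_on S" for x
    by (cases "x = \<infinity>") (auto simp: ext_exp_def intro!: holomorphic_intros)
  then show ?thesis unfolding ext_polyexp_def[abs_def] by (intro holomorphic_intros)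
qed

text \<open>The tube lemma turns joint continuity into uniformity over the compact set K, including
  infinite entries of p.\<close>

lemma eventually_ext_polyexp_in:
  assumes K: "compact K" "K \<subseteq> Hneg" and U: "open U" "\<And>z. z \<in> K \<Longrightarrow> ext_polyexp a m p z \<in> U"
    and N: "(N \<longlongrightarrow> p) F"
  shows "eventually (\<lambda>l. \<forall>z\<in>K. ext_polyexp a m (N l) z \<in> U) F"
proof -
  let ?W = "(\<lambda>x. ext_polyexp a m (fst x) (snd x)) -` U \<inter> (UNIV \<times> Hneg)"
  have "open (UNIV \<times> Hneg :: ((nat \<Rightarrow> ennreal) \<times> complex) set)"
    by (intro open_Times open_UNIV open_Hneg)
  then have W: "open ?W"
    using continuous_on_ext_polyexp U(1) by (simp add: continuous_on_open_vimage)
  have pK: "{p} \<times> K \<subseteq> ?W" using K U(2) by auto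
  from Elementary_Topology.tube_lemma[OF K(1) W pK]
  obtain V where V: "p \<in> V" "open V" "V \<times> K \<subseteq> ?W" by (elim exE conjE)
  have "eventually (\<lambda>l. N l \<in> V) F" using N V by (intro topological_tendstoD)
  then show ?thesis by eventually_elim (use V(3) in auto)
qed

text \<open>Far to the left the constant term dominates, because all exponents are at least 1. The
  witness \<open>- t\<close> with \<open>t = S / \<bar>a 0\<bar>\<close> works by
  \<open>t < exp t\<close>. This makes the zeros of the limit function isolated.\<close>

lemma ext_polyexp_nonzero_somewhere:
  assumes m: "1 \<le> m" and a: "a 0 \<noteq> 0" "a m \<noteq> 0" and p: "\<forall>i\<in>{1..m}. 1 \<le> p i"
  shows "\<exists>z\<in>Hneg. ext_polyexp a m p z \<noteq> 0"
proof -
  define S where "S = (\<Sum>i=1..m. \<bar>a i\<bar>)"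
  have "\<bar>a m\<bar> \<le> S" unfolding S_def using m by (intro member_le_sum) auto
  then have S: "0 < S" using a by auto
  define t where "t = S / \<bar>a 0\<bar>"
  have t: "0 < t" using S a by (simp add: t_def)
  have "norm (\<Sum>i=1..m. of_real (a i) * ext_exp (p i) (of_real (- t))) \<le> (\<Sum>i=1..m. \<bar>a i\<bar> * exp (- t))"
  proof (rule sum_norm_le)
    fix i assume i: "i \<in> {1..m}"
    have "norm (ext_exp (p i) (of_real (- t))) \<le> exp (- t)"
    proof (cases "p i = \<infinity>")
      case False
      then have "1 \<le> enn2real (p i)" using bspec[OF p i] enn2real_mono[of 1 "p i"] by (simp add: less_top)
      then have "1 * t \<le> enn2real (p i) * t" using t by (intro mult_right_mono) auto
      then show ?thesis using False by (simp add: ext_exp_def)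
    qed (simp add: ext_exp_def)
    then show "norm (of_real (a i) * ext_exp (p i) (of_real (- t))) \<le> \<bar>a i\<bar> * exp (- t)"
      by (simp add: norm_mult mult_left_mono)
  qed
  also have "\<dots> = S * exp (- t)" by (simp add: S_def sum_distrib_right)
  also have "\<dots> < \<bar>a 0\<bar>"
  proof -
    have "S < \<bar>a 0\<bar> * exp t" using exp_gt_self[of t] a by (simp add: t_def field_simps)
    then show ?thesis by (simp add: exp_minus field_simps)
  qed
  finally have "ext_polyexp a m p (of_real (- t)) \<noteq> 0"
    unfolding ext_polyexp_def by (metis add_eq_0_iff norm_minus_cancel norm_of_real order_less_irrefl)
  then show ?thesis using t by (intro bexI[of _ "of_real (- t)"]) (auto simp: Hneg_def)
qed

lemma ext_polyexp_normalized:
  assumes m: "1 \<le> m" and l: "l \<in> param_space m"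
  shows "ext_polyexp a m (normalized m l) (of_real (min_entry m l) * w) = polyexp a m w l"
proof -
  have M: "0 < min_entry m l" by (rule min_entry_pos[OF m l])
  have "ext_exp (normalized m l i) (of_real (min_entry m l) * w) = exp (of_real (l i) * w)" if i: "i \<in> {1..m}" for i
    using M param_spaceD(1)[OF l i] i by (simp add: normalized_def ext_exp_def)
  then show ?thesis by (simp add: ext_polyexp_def polyexp_def)
qed

section \<open>Roots in the left half-plane along a filter\<close>

context root_system
begin

definition scaled :: "'i \<Rightarrow> (nat \<Rightarrow> real) \<Rightarrow> complex" where
  "scaled i l = of_real (min_entry m l) * \<psi> i l"

lemma scaled_zero: "i \<in> I \<Longrightarrow> l \<in> param_space m \<Longrightarrow> ext_polyexp a m (normalized m l) (scaled i l) = 0"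
  unfolding scaled_def by (simp add: ext_polyexp_normalized[OF m_pos] root)

lemma continuous_on_scaled: "i \<in> I \<Longrightarrow> X \<subseteq> param_space m \<Longrightarrow> continuous_on X (scaled i)"
  unfolding scaled_def using continuous_on_subset[OF cont]
  by (intro continuous_intros continuous_on_min_entry[OF m_pos]) auto

text \<open>The filter is kept abstract because the results are used both for
  \<open>approach\<close> and for its image under \<open>flip\<close>.\<close>

context
  fixes F :: "(nat \<Rightarrow> real) filter" and p :: "nat \<Rightarrow> ennreal"
  assumes evS: "eventually (\<lambda>l. l \<in> param_space m) F" and F: "F \<noteq> bot"
    and basis: "connected_basis F (param_space m)"
    and N: "((\<lambda>l. normalized m l) \<longlongrightarrow> p) F" and p: "\<forall>i\<in>{1..m}. 1 \<le> p i"
begin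

lemma isolated_limit_zero:
  assumes "z \<in> Zneg a m p"
  obtains r where "0 < r" "cball z r \<subseteq> Hneg" "\<forall>w\<in>cball z r. w \<noteq> z \<longrightarrow> ext_polyexp a m p w \<noteq> 0"
proof -
  have z: "z \<in> Hneg" "ext_polyexp a m p z = 0" using assms by (auto simp: Zneg_iff Hneg_def)
  obtain b where b: "b \<in> Hneg" "ext_polyexp a m p b \<noteq> 0"
    using ext_polyexp_nonzero_somewhere[OF m_pos a0 am p] by blast
  have "connected Hneg" unfolding Hneg_def by (intro convex_connected convex_halfspace_Re_lt)
  then obtain r where "0 < r" "ball z r \<subseteq> Hneg" "\<And>w. w \<in> ball z r - {z} \<Longrightarrow> ext_polyexp a m p w \<noteq> 0"
    using isolated_zeros[OF holomorphic_ext_polyexp open_Hneg _ z b] by metis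
  moreover have "cball z (r / 2) \<subseteq> ball z r" using \<open>0 < r\<close> by auto
  ultimately show thesis by (intro that[of "r / 2"]) auto
qed

text \<open>The closed annulus is compact and contains no zero of the limit function. The case s = r
  is the bounding circle.\<close>

lemma eventually_annulus_free:
  assumes r: "cball z r \<subseteq> Hneg" "\<forall>w\<in>cball z r. w \<noteq> z \<longrightarrow> ext_polyexp a m p w \<noteq> 0" and s: "0 < s"
  shows "eventually (\<lambda>l. \<forall>w. s \<le> dist w z \<and> dist w z \<le> r \<longrightarrow> ext_polyexp a m (normalized m l) w \<noteq> 0) F"
proof -
  have "eventually (\<lambda>l. \<forall>w\<in>cball z r - ball z s. ext_polyexp a m (normalized m l) w \<in> - {0}) F"
  proof (rule eventually_ext_polyexp_in[OF _ _ _ _ N])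
    show "compact (cball z r - ball z s)" by (intro compact_diff compact_cball open_ball)
    fix w assume "w \<in> cball z r - ball z s"
    then show "ext_polyexp a m p w \<in> - {0}" using bspec[OF r(2), of w] s by (cases "w = z") auto
  qed (use r in auto)
  then show ?thesis by eventually_elim (auto simp: dist_commute)
qed

lemma captured_tendsto:
  assumes i: "i \<in> I" and r: "0 < r" "cball z r \<subseteq> Hneg"
    "\<forall>w\<in>cball z r. w \<noteq> z \<longrightarrow> ext_polyexp a m p w \<noteq> 0"
    and ev: "eventually (\<lambda>l. dist (scaled i l) z < r) F"
  shows "(scaled i \<longlongrightarrow> z) F"
proof (rule tendstoI)
  fix e :: real assume "0 < e"
  from eventually_annulus_free[OF r(2,3) this] ev evS
  show "eventually (\<lambda>l. dist (scaled i l) z < e) F"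
    by eventually_elim (use scaled_zero[OF i] in force)
qed

text \<open>On a connected set of parameters for which the circle carries no zeros, the distance of
  the root from z never equals r, so the root stays inside or outside throughout.\<close>

lemma capture_dichotomy:
  assumes i: "i \<in> I" and r: "0 < r" "cball z r \<subseteq> Hneg"
    "\<forall>w\<in>cball z r. w \<noteq> z \<longrightarrow> ext_polyexp a m p w \<noteq> 0"
  shows "(scaled i \<longlongrightarrow> z) F \<or> eventually (\<lambda>l. scaled i l \<notin> ball z r) F"
proof -
  obtain C where C: "connected C" "C \<subseteq> param_space m" "eventually (\<lambda>l. l \<in> C) F"
      "\<forall>l\<in>C. \<forall>w. r \<le> dist w z \<and> dist w z \<le> r \<longrightarrow> ext_polyexp a m (normalized m l) w \<noteq> 0"
    by (rule connected_basisE[OF basis eventually_annulus_free[OF r(2,3,1)]])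
  have ne: "dist (scaled i l) z \<noteq> r" if "l \<in> C" for l
    using scaled_zero[OF i, of l] C(2) bspec[OF C(4) that] that by auto
  have "continuous_on C (\<lambda>l. dist (scaled i l) z)"
    by (intro continuous_intros continuous_on_scaled i C)
  from connected_avoid_cases[OF C(1) this ne]
  consider "\<forall>l\<in>C. dist (scaled i l) z < r" | "\<forall>l\<in>C. r < dist (scaled i l) z"
    by blast
  then show ?thesis
  proof cases
    case 1
    then have "eventually (\<lambda>l. dist (scaled i l) z < r) F" using C(3) by (auto elim: eventually_mono)
    then show ?thesis using captured_tendsto[OF i r] by blast
  next
    case 2
    then have "eventually (\<lambda>l. scaled i l \<notin> ball z r) F"
      using C(3) by (auto elim!: eventually_mono simp: dist_commute)
    then show ?thesis ..
  qed
qed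

lemma eventually_avoids_point:
  assumes i: "i \<in> I" and no: "\<forall>z\<in>Zneg a m p. \<not> (scaled i \<longlongrightarrow> z) F" and z: "z \<in> Hneg"
  shows "\<exists>r>0. eventually (\<lambda>l. scaled i l \<notin> ball z r) F"
proof (cases "ext_polyexp a m p z = 0")
  case True
  then have zz: "z \<in> Zneg a m p" using z by (simp add: Zneg_iff Hneg_def)
  obtain r where r: "0 < r" "cball z r \<subseteq> Hneg" "\<forall>w\<in>cball z r. w \<noteq> z \<longrightarrow> ext_polyexp a m p w \<noteq> 0"
    using isolated_limit_zero[OF zz] by blast
  then show ?thesis using capture_dichotomy[OF i r] bspec[OF no zz] by blast
next
  case False
  have "continuous_on Hneg (ext_polyexp a m p)"
    by (intro holomorphic_on_imp_continuous_on holomorphic_ext_polyexp)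
  then have "\<forall>B. open B \<longrightarrow> open (ext_polyexp a m p -` B \<inter> Hneg)"
    using continuous_on_open_vimage[OF open_Hneg] by blast
  then have "open (ext_polyexp a m p -` (- {0}) \<inter> Hneg)"
    by (rule allE[of _ "- {0}"]) (simp add: open_Compl)
  moreover have "z \<in> ext_polyexp a m p -` (- {0}) \<inter> Hneg" using False z by simp
  ultimately obtain r where r: "0 < r" "cball z r \<subseteq> ext_polyexp a m p -` (- {0}) \<inter> Hneg"
    unfolding open_contains_cball by blast
  have "eventually (\<lambda>l. \<forall>w\<in>cball z r. ext_polyexp a m (normalized m l) w \<in> - {0}) F"
    by (rule eventually_ext_polyexp_in[OF _ _ _ _ N]) (use r(2) in auto)
  then have "eventually (\<lambda>l. scaled i l \<notin> ball z r) F"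
    using evS by eventually_elim (use scaled_zero[OF i] in force)
  then show ?thesis using r(1) by blast
qed

lemma eventually_avoids_compact:
  assumes i: "i \<in> I" and no: "\<forall>z\<in>Zneg a m p. \<not> (scaled i \<longlongrightarrow> z) F"
    and K: "compact K" "K \<subseteq> Hneg"
  shows "eventually (\<lambda>l. scaled i l \<notin> K) F"
proof -
  have "\<forall>z\<in>K. \<exists>r>0. eventually (\<lambda>l. scaled i l \<notin> ball z r) F"
    using eventually_avoids_point[OF i no] K(2) by blast
  then obtain r where r: "\<And>z. z \<in> K \<Longrightarrow> 0 < r z" "\<And>z. z \<in> K \<Longrightarrow> eventually (\<lambda>l. scaled i l \<notin> ball z (r z)) F"
    by metis
  have "K \<subseteq> (\<Union>z\<in>K. ball z (r z))" using r(1) by force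
  then obtain D where D: "D \<subseteq> K" "finite D" "K \<subseteq> (\<Union>z\<in>D. ball z (r z))"
    by (rule compactE_image[OF K(1), of K "\<lambda>z. ball z (r z)", rotated]) auto
  have "eventually (\<lambda>l. \<forall>z\<in>D. scaled i l \<notin> ball z (r z)) F"
    using r(2) D by (intro eventually_ball_finite) auto
  then show ?thesis by eventually_elim (use D(3) in blast)
qed

text \<open>Comparing the modulus at z with that on a small circle yields a zero in the disc for
  each nearby parameter, as in Hurwitz's theorem. The index of the root that takes this value could
  depend on the parameter; connectedness lets one root, chosen at a single parameter, stay in the
  disc.\<close>

lemma limit_zero_attained:
  assumes z: "z \<in> Zneg a m p"
  shows "\<exists>i\<in>I. (scaled i \<longlongrightarrow> z) F"
proof -
  let ?f = "ext_polyexp a m"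
  obtain r where r: "0 < r" "cball z r \<subseteq> Hneg" "\<forall>w\<in>cball z r. w \<noteq> z \<longrightarrow> ?f p w \<noteq> 0"
    using isolated_limit_zero[OF z] by blast
  have "compact ((\<lambda>w. norm (?f p w)) ` sphere z r)"
    by (intro compact_continuous_image continuous_intros holomorphic_on_imp_continuous_on holomorphic_ext_polyexp) simp
  moreover have "0 \<notin> (\<lambda>w. norm (?f p w)) ` sphere z r" using r(1,3) by force
  ultimately have "open (- (\<lambda>w. norm (?f p w)) ` sphere z r)" "0 \<in> - (\<lambda>w. norm (?f p w)) ` sphere z r"
    by (auto intro: compact_imp_closed)
  then obtain e where e: "0 < e" "ball 0 e \<subseteq> - (\<lambda>w. norm (?f p w)) ` sphere z r"
    unfolding open_contains_ball by blast
  have e': "e \<le> norm (?f p w)" if "w \<in> sphere z r" for w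
  proof -
    have "norm (?f p w) \<notin> ball 0 e" using e(2) that by blast
    then show ?thesis by simp
  qed
  have "eventually (\<lambda>l. \<forall>w\<in>sphere z r. ?f (normalized m l) w \<in> - cball 0 (e / 2)) F"
    by (rule eventually_ext_polyexp_in[OF _ _ _ _ N]) (use r(2) e(1) e' in \<open>force+\<close>)
  moreover have "eventually (\<lambda>l. \<forall>w\<in>{z}. ?f (normalized m l) w \<in> ball 0 (e / 2)) F"
    by (rule eventually_ext_polyexp_in[OF _ _ _ _ N]) (use z e(1) in \<open>auto simp: Zneg_iff Hneg_def\<close>)
  ultimately have ev: "eventually (\<lambda>l. \<exists>i\<in>I. dist (scaled i l) z < r) F"
    using evS
  proof eventually_elim
    case (elim l)
    obtain w where w: "w \<in> ball z r" "?f (normalized m l) w = 0"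
    proof (rule holomorphic_contract_to_zero[of z r "?f (normalized m l)"])
      show "continuous_on (cball z r) (?f (normalized m l))"
        by (intro holomorphic_on_imp_continuous_on holomorphic_ext_polyexp)
      fix w assume "norm (z - w) = r"
      then have "w \<in> sphere z r" by (simp add: dist_norm)
      then show "norm (?f (normalized m l) z) < norm (?f (normalized m l) w)" using elim(1,2) by force
    qed (use r holomorphic_ext_polyexp in auto)
    have M: "0 < min_entry m l" by (rule min_entry_pos[OF m_pos elim(3)])
    have "polyexp a m (w / of_real (min_entry m l)) l = 0"
      using ext_polyexp_normalized[OF m_pos elim(3), of a "w / of_real (min_entry m l)"] M w(2) by simp
    then obtain i where "i \<in> I" "\<psi> i l = w / of_real (min_entry m l)" using full[OF elim(3)] by blast
    then show ?case using M w(1) by (intro bexI[of _ i]) (auto simp: scaled_def dist_commute)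
  qed
  have "eventually (\<lambda>l. \<forall>w. r \<le> dist w z \<and> dist w z \<le> r \<longrightarrow> ?f (normalized m l) w \<noteq> 0) F"
    by (rule eventually_annulus_free[OF r(2,3,1)])
  then have "eventually (\<lambda>l. (\<exists>i\<in>I. dist (scaled i l) z < r) \<and> (\<forall>w. dist w z = r \<longrightarrow> ?f (normalized m l) w \<noteq> 0)) F"
    using ev by eventually_elim auto
  from connected_basisE[OF basis this] obtain C where C: "connected C" "C \<subseteq> param_space m" "eventually (\<lambda>l. l \<in> C) F"
      "\<forall>l\<in>C. (\<exists>i\<in>I. dist (scaled i l) z < r) \<and> (\<forall>w. dist w z = r \<longrightarrow> ?f (normalized m l) w \<noteq> 0)"
    by blast
  obtain l0 where l0: "l0 \<in> C" using eventually_happens'[OF F C(3)] by blast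
  then obtain i where i: "i \<in> I" "dist (scaled i l0) z < r" using C(4) by blast
  have ne: "dist (scaled i l) z \<noteq> r" if "l \<in> C" for l
    using scaled_zero[OF i(1), of l] C(2) bspec[OF C(4) that] that by auto
  have "continuous_on C (\<lambda>l. dist (scaled i l) z)"
    by (intro continuous_intros continuous_on_scaled i C)
  from connected_avoid_cases[OF C(1) this ne] have "\<forall>l\<in>C. dist (scaled i l) z < r"
    using l0 i(2) by force
  then have "eventually (\<lambda>l. dist (scaled i l) z < r) F" using C(3) by (auto elim: eventually_mono)
  then show ?thesis using captured_tendsto[OF i(1) r] i(1) by blast
qed

end

end

section \<open>Limits in the quotient space\<close>

lemma tendsto_proj: "(f \<longlongrightarrow> z) F \<Longrightarrow> ((\<lambda>x. proj (f x)) \<longlongrightarrow> proj z) F"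
  by (rule topological_tendstoI) (auto simp: open_collapsed_def dest: topological_tendstoD)

lemma connected_basis_filtermap:
  assumes "connected_basis F X" "continuous_on X f" "f ` X \<subseteq> Y"
  shows "connected_basis (filtermap f F) Y"
  unfolding connected_basis_def
proof (intro allI impI)
  fix P assume "eventually P (filtermap f F)"
  then obtain C where C: "connected C" "C \<subseteq> X" "eventually (\<lambda>x. x \<in> C) F" "\<forall>x\<in>C. P (f x)"
    using assms(1) unfolding connected_basis_def eventually_filtermap by meson
  have "connected (f ` C)"
    using C assms(2) by (intro connected_continuous_image continuous_on_subset[OF assms(2)])
  moreover have "eventually (\<lambda>x. x \<in> f ` C) (filtermap f F)"
    unfolding eventually_filtermap using C(3) by (auto elim: eventually_mono)
  ultimately show "\<exists>C. connected C \<and> C \<subseteq> Y \<and> eventually (\<lambda>x. x \<in> C) (filtermap f F) \<and> (\<forall>x\<in>C. P x)"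
    using C assms(3) by (intro exI[of _ "f ` C"]) auto
qed

theorem theorem1p7:
  fixes a :: "nat \<Rightarrow> real" and m :: nat
    and I :: "'i set" and \<psi> :: "'i \<Rightarrow> (nat \<Rightarrow> real) \<Rightarrow> complex"
    and p q :: "nat \<Rightarrow> ennreal"
  assumes "m \<ge> 1"
    and "a 0 \<noteq> 0" and "a m \<noteq> 0"
    and "countable I"
    and "\<And>i. i \<in> I \<Longrightarrow> is_root a m (\<psi> i)"
    and "\<And>i. i \<in> I \<Longrightarrow> continuous_on (param_space m) (\<psi> i)"
    and "\<And>l. l \<in> param_space m \<Longrightarrow> zero_set a m l = (\<lambda>i. \<psi> i l) ` I"
    and "p \<in> {1..m} \<rightarrow>\<^sub>E UNIV" and "q \<in> {1..m} \<rightarrow>\<^sub>E UNIV"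
    and "(p, q) \<in> closure (iota m ` param_space m)"
  shows "(\<forall>i\<in>I. \<exists>c. (rescaled m (\<psi> i) \<longlongrightarrow> c) (approach m (p, q))) \<and>
    (\<lambda>i. Lim (approach m (p, q)) (rescaled m (\<psi> i))) ` I - {proj 0}
      = proj ` limit_zeros a m p q"
proof -
  interpret left: root_system a m I \<psi>
  proof
    show "\<And>i l. i \<in> I \<Longrightarrow> l \<in> param_space m \<Longrightarrow> polyexp a m (\<psi> i l) l = 0"
      using assms(5) by (auto simp: is_root_def zero_set_def)
    show "\<exists>i\<in>I. \<psi> i l = w" if "l \<in> param_space m" "polyexp a m w l = 0" for l w
    proof -
      have "w \<in> (\<lambda>i. \<psi> i l) ` I" using assms(7)[OF that(1)] that(2) by (auto simp: zero_set_def)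
      then show ?thesis by blast
    qed
  qed (use assms in auto)
  interpret right: root_system "rev_coeff a m" m I "\<lambda>i l. - \<psi> i (flip m l)"
    by (rule left.reversed_root_system)
  define F where "F = approach m (p, q)"
  \<comment> \<open>The reversed vector lists the largest exponent first, \<open>flip\<close> keeps
    it last; \<open>q'\<close> is q reordered accordingly.\<close>
  define q' where "q' = (\<lambda>i\<in>{1..m}. q (if i = m then 1 else i + 1))"
  have S: "eventually (\<lambda>l. l \<in> param_space m) F" unfolding F_def by (rule eventually_approach_param_space)
  have F: "F \<noteq> bot" unfolding F_def by (rule approach_neq_bot[OF assms(10)])
  have "p \<in> extensional {1..m}" "q \<in> extensional {1..m}" using assms(8,9) by (auto simp: PiE_def)
  then have basis: "connected_basis F (param_space m)"
    unfolding F_def by (rule connected_basis_approach[OF assms(1,10)])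
  have "((\<lambda>l. fst (iota m l)) \<longlongrightarrow> fst (p, q)) F" "((\<lambda>l. snd (iota m l)) \<longlongrightarrow> snd (p, q)) F"
    unfolding F_def by (intro tendsto_fst tendsto_snd iota_approach)+
  then have lim: "((\<lambda>l. normalized m l) \<longlongrightarrow> p) F" "((\<lambda>l. normalized m (reversed m l)) \<longlongrightarrow> q) F"
    by (simp_all add: iota_def)
  have p1: "\<forall>i\<in>{1..m}. 1 \<le> p i" "\<forall>i\<in>{1..m}. 1 \<le> q i"
    using closure_iota_ge_1(1)[OF assms(1,10)] by auto
  define F' where "F' = filtermap (flip m) F"
  have S': "eventually (\<lambda>l. l \<in> param_space m) F'"
    unfolding F'_def eventually_filtermap using S by eventually_elim (rule flip_param_space[OF assms(1)])
  have F'0: "F' \<noteq> bot" using F by (simp add: F'_def filtermap_bot_iff)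
  have basis': "connected_basis F' (param_space m)"
    unfolding F'_def using basis continuous_on_flip flip_param_space[OF assms(1)]
    by (intro connected_basis_filtermap) auto
  have q'1: "\<forall>i\<in>{1..m}. 1 \<le> q' i"
    using p1(2) assms(1) by (auto simp: q'_def)
  have lim': "((\<lambda>l. normalized m l) \<longlongrightarrow> q') F'"
    unfolding F'_def filterlim_filtermap tendsto_fun_iff
  proof
    fix i show "((\<lambda>l. normalized m (flip m l) i) \<longlongrightarrow> q' i) F"
    proof (cases "i \<in> {1..m}")
      case True
      define j where "j = (if i = m then 1 else i + 1)"
      have j: "j \<in> {1..m}" using True by (auto simp: j_def)
      have "flip m l i = reversed m l j" for l
        using True assms(1) by (auto simp: flip_def reversed_def j_def)
      then have "normalized m (flip m l) i = normalized m (reversed m l) j" for l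
        using True j by (simp add: normalized_def min_entry_reversed[OF assms(1)])
      moreover have "q' i = q j" using True by (simp add: q'_def j_def)
      ultimately show ?thesis using lim(2) by (simp add: tendsto_fun_iff)
    qed (simp add: normalized_def q'_def del: atLeastAtMost_iff)
  qed
  have Zrev: "Zneg (rev_coeff a m) m q' = Zneg_rev a m q"
  proof -
    have "(\<Sum>i=1..m. of_real (rev_coeff a m i) * ext_exp (q' i) w)
      = of_real (a 0) * ext_exp (q 1) w + (\<Sum>i=1..<m. of_real (a i) * ext_exp (q (i + 1)) w)" for w
    proof -
      have "(\<Sum>i=1..<m. of_real (rev_coeff a m i) * ext_exp (q' i) w) = (\<Sum>i=1..<m. of_real (a i) * ext_exp (q (i + 1)) w)"
        by (intro sum.cong) (auto simp: rev_coeff_def q'_def)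
      then show ?thesis using assms(1) unfolding sum_to_last[OF assms(1)] by (simp add: rev_coeff_def q'_def)
    qed
    then show ?thesis unfolding Zneg_def Zneg_rev_def by (simp add: rev_coeff_def add.assoc)
  qed
  note L = S F basis lim(1) p1(1)
  note R = S' F'0 basis' lim' q'1
  \<comment> \<open>The negative of the root rescaled for the right half-plane, so that it is in the
    left half-plane exactly when the root is in the right one.\<close>
  define \<nu> where "\<nu> i l = right.scaled i (flip m l)" for i l
  have \<nu>: "\<nu> i l = - (of_real (min_entry m (reversed m l)) * \<psi> i l)" if "l \<in> param_space m" for i l
    using flip_flip[OF that] by (simp add: \<nu>_def right.scaled_def min_entry_reversed[OF assms(1)])
  have \<nu>_lim: "(right.scaled i \<longlongrightarrow> z) F' \<longleftrightarrow> (\<nu> i \<longlongrightarrow> z) F" for i z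
    by (simp add: F'_def filterlim_filtermap \<nu>_def[abs_def])
  have M: "0 < min_entry m l" "0 < min_entry m (reversed m l)" if "l \<in> param_space m" for l
    using min_entry_pos[OF assms(1) that] min_entry_pos[OF assms(1) flip_param_space[OF assms(1) that]]
    by (simp_all add: min_entry_reversed[OF assms(1)])
  have resc: "rescaled m (\<psi> i) l = (if Re (\<psi> i l) = 0 then proj 0 else if Re (\<psi> i l) < 0 then proj (left.scaled i l) else proj (- \<nu> i l))"
    if "l \<in> param_space m" for i l
    using \<nu>[OF that] by (simp add: rescaled_def Hzero_def Hneg_def left.scaled_def proj_eq_iff)
  have left_lim: "(rescaled m (\<psi> i) \<longlongrightarrow> proj z) F" if z: "z \<in> Zneg a m p" "(left.scaled i \<longlongrightarrow> z) F" for i z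
  proof -
    have "eventually (\<lambda>l. left.scaled i l \<in> Hneg) F"
      using z by (intro topological_tendstoD[OF _ open_Hneg]) (auto simp: Zneg_def)
    then have "eventually (\<lambda>l. proj (left.scaled i l) = rescaled m (\<psi> i) l) F"
      using S
    proof eventually_elim
      case (elim l)
      then have "Re (\<psi> i l) < 0" using M(1)[OF elim(2)] by (simp add: left.scaled_def Hneg_def mult_less_0_iff)
      then show ?case using resc[OF elim(2)] by simp
    qed
    then show ?thesis using Lim_transform_eventually[OF tendsto_proj[OF z(2)]] by blast
  qed
  have right_lim: "(rescaled m (\<psi> i) \<longlongrightarrow> proj (- z)) F" if z: "z \<in> Zneg_rev a m q" "(\<nu> i \<longlongrightarrow> z) F" for i z
  proof -
    have "eventually (\<lambda>l. \<nu> i l \<in> Hneg) F"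
      using z by (intro topological_tendstoD[OF _ open_Hneg]) (auto simp: Zneg_rev_def)
    then have "eventually (\<lambda>l. proj (- \<nu> i l) = rescaled m (\<psi> i) l) F"
      using S
    proof eventually_elim
      case (elim l)
      then have "0 < Re (\<psi> i l)" using M(2)[OF elim(2)] \<nu>[OF elim(2)] by (simp add: Hneg_def zero_less_mult_iff)
      then show ?case using resc[OF elim(2)] by simp
    qed
    then show ?thesis using Lim_transform_eventually[OF tendsto_proj[OF tendsto_minus[OF z(2)]]] by blast
  qed
  \<comment> \<open>A neighbourhood of the collapsed axis pulls back to an open set V that contains
    the axis but may be thin at infinity. The bound C confines the rescaled root to a half disc,
    whose part outside V is a compact subset of \<open>Hneg\<close> and is eventually
    avoided.\<close>
  have zero_lim: "(rescaled m (\<psi> i) \<longlongrightarrow> proj 0) F"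
    if i: "i \<in> I" and nl: "\<forall>z\<in>Zneg a m p. \<not> (left.scaled i \<longlongrightarrow> z) F"
      and nr: "\<forall>z\<in>Zneg_rev a m q. \<not> (\<nu> i \<longlongrightarrow> z) F" for i
  proof (rule topological_tendstoI)
    fix U :: "collapsed set" assume U: "open U" "proj 0 \<in> U"
    define V where "V = proj -` U"
    have V: "open V" using U by (simp add: V_def open_collapsed_def)
    have HV: "\<forall>z. Re z = 0 \<longrightarrow> z \<in> V"
    proof (intro allI impI)
      fix z assume that: "Re z = 0"
      have "proj z = proj 0" using that by (simp add: proj_eq_iff Hzero_def)
      then show "z \<in> V" using U by (simp add: V_def)
    qed
    have V': "open (uminus ` V)" using V by (rule open_negations)
    have HV': "\<forall>z. Re z = 0 \<longrightarrow> z \<in> uminus ` V"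
    proof (intro allI impI)
      fix z assume "Re z = 0"
      then have "- z \<in> V" using HV by simp
      then show "z \<in> uminus ` V" by (metis image_eqI minus_minus)
    qed
    have K: "compact (cball 0 C \<inter> {z. Re z \<le> 0} - W)" "cball 0 C \<inter> {z. Re z \<le> 0} - W \<subseteq> Hneg"
      if "open W" "\<forall>z. Re z = 0 \<longrightarrow> z \<in> W" for C and W :: "complex set"
      using that by (auto simp: Hneg_def less_le intro!: compact_diff compact_Int_closed closed_halfspace_Re_le)
    obtain C where C: "\<And>l. l \<in> param_space m \<Longrightarrow> Re (\<psi> i l) < 0 \<Longrightarrow> norm (left.scaled i l) \<le> C"
      using left.scaled_root_bounded[OF i] unfolding left.scaled_def by blast
    obtain C' where C': "\<And>l. l \<in> param_space m \<Longrightarrow> Re (- \<psi> i (flip m l)) < 0 \<Longrightarrow> norm (right.scaled i l) \<le> C'"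
      using right.scaled_root_bounded[OF i] unfolding right.scaled_def by blast
    have "eventually (\<lambda>l. left.scaled i l \<notin> cball 0 C \<inter> {z. Re z \<le> 0} - V) F"
      by (rule left.eventually_avoids_compact[OF L i nl K[OF V HV]])
    moreover have "eventually (\<lambda>l. right.scaled i l \<notin> cball 0 C' \<inter> {z. Re z \<le> 0} - uminus ` V) F'"
      by (rule right.eventually_avoids_compact[OF R i _ K[OF V' HV']]) (use nr \<nu>_lim Zrev in simp)
    then have "eventually (\<lambda>l. \<nu> i l \<notin> cball 0 C' \<inter> {z. Re z \<le> 0} - uminus ` V) F"
      by (simp add: F'_def eventually_filtermap \<nu>_def)
    ultimately show "eventually (\<lambda>l. rescaled m (\<psi> i) l \<in> U) F"
      using S
    proof eventually_elim
      case (elim l)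
      consider "Re (\<psi> i l) = 0" | "Re (\<psi> i l) < 0" | "0 < Re (\<psi> i l)" by linarith
      then show ?case
      proof cases
        case 1
        then show ?thesis using resc[OF elim(3)] U by simp
      next
        case 2
        have "Re (left.scaled i l) \<le> 0"
          using 2 M(1)[OF elim(3)] by (simp add: left.scaled_def mult_nonneg_nonpos less_imp_le)
        then have "left.scaled i l \<in> V" using elim(1) C[OF elim(3) 2] by auto
        then show ?thesis using resc[OF elim(3)] 2 by (simp add: V_def)
      next
        case 3
        have "norm (\<nu> i l) \<le> C'"
          unfolding \<nu>_def using C'[OF flip_param_space[OF assms(1) elim(3)]] 3 flip_flip[OF elim(3)] by simp
        moreover have "Re (\<nu> i l) \<le> 0" using 3 M(2)[OF elim(3)] \<nu>[OF elim(3)] by simp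
        ultimately have "\<nu> i l \<in> uminus ` V" using elim(2) by auto
        then show ?thesis using resc[OF elim(3)] 3 by (auto simp: V_def)
      qed
    qed
  qed
  have lims: "(rescaled m (\<psi> i) \<longlongrightarrow> proj 0) F \<or> (\<exists>z\<in>limit_zeros a m p q. (rescaled m (\<psi> i) \<longlongrightarrow> proj z) F)"
    if i: "i \<in> I" for i
    using left_lim right_lim zero_lim[OF i] unfolding limit_zeros_def by blast
  have Lim_eq: "Lim F (rescaled m (\<psi> i)) = c" if "(rescaled m (\<psi> i) \<longlongrightarrow> c) F" for i c
    by (rule tendsto_Lim[OF F that])
  have nz: "proj z \<noteq> proj 0" if "z \<in> limit_zeros a m p q" for z
    using that by (auto simp: limit_zeros_def Zneg_def Zneg_rev_def Hneg_def proj_eq_iff Hzero_def)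
  have attained: "\<exists>i\<in>I. (rescaled m (\<psi> i) \<longlongrightarrow> proj z) F" if z: "z \<in> limit_zeros a m p q" for z
  proof -
    consider "z \<in> Zneg a m p" | z' where "z' \<in> Zneg_rev a m q" "z = - z'" using z by (auto simp: limit_zeros_def)
    then show ?thesis
    proof cases
      case 1
      then show ?thesis using left.limit_zero_attained[OF L 1] left_lim[OF 1] by blast
    next
      case 2
      then have "z' \<in> Zneg (rev_coeff a m) m q'" by (simp add: Zrev)
      then obtain i where "i \<in> I" "(\<nu> i \<longlongrightarrow> z') F"
        using right.limit_zero_attained[OF R] \<nu>_lim by blast
      then show ?thesis using right_lim[OF 2(1)] 2(2) by blast
    qed
  qed
  show ?thesis
    unfolding F_def[symmetric]
  proof (intro conjI ballI equalityI subsetI)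
    fix i assume "i \<in> I"
    then show "\<exists>c. (rescaled m (\<psi> i) \<longlongrightarrow> c) F" using lims by blast
  next
    fix c assume "c \<in> (\<lambda>i. Lim F (rescaled m (\<psi> i))) ` I - {proj 0}"
    then show "c \<in> proj ` limit_zeros a m p q" using lims Lim_eq by blast
  next
    fix c assume "c \<in> proj ` limit_zeros a m p q"
    then obtain z where z: "z \<in> limit_zeros a m p q" "c = proj z" by blast
    obtain i where "i \<in> I" "(rescaled m (\<psi> i) \<longlongrightarrow> proj z) F" using attained[OF z(1)] by blast
    then have "i \<in> I" "c = Lim F (rescaled m (\<psi> i))" using Lim_eq z(2) by auto
    then show "c \<in> (\<lambda>i. Lim F (rescaled m (\<psi> i))) ` I - {proj 0}" 
      by (intro DiffI rev_image_eqI[of i]) (use nz[OF z(1)] z(2) in simp_all)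
  qed
qed

end
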